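(* Assume $r_0>-\infty$ and $\mathbb E[(\min\{t_1^+,\dots,t_{2d}^+\})^d]<\infty$. Fix $\diamond\in\{\text{none},o\}$. There exists a deterministic, continuous, convex shape function $g^\diamond:\operatorname{int}\mathcal U\to[r_0\wedge0,\infty)$ with the following property. For each $\alpha,\varepsilon>0$ there exists an almost surely finite random constant $K(\alpha,\varepsilon)$ such that $$|G^\diamond_{0,(k),x}-k\,g^\diamond(x/k)|\le\varepsilon k$$ whenever $k\ge K(\alpha,\varepsilon)$, $k\ge(1+\alpha)|x|_1$, and $x\in\mathcal D^\diamond_k$.
   Context: Let $d\ge2$. The weights $\{t(e)\}$ on the undirected nearest-neighbor edges of $\mathbb Z^d$ are i.i.d. real, and $t_i$ are i.i.d. copies with $t_i^+=t_i\vee0$. Set $r_0=\operatorname{ess\,inf}t(e)$, $\mathcal U=\{\xi\in\mathbb R^d:|\xi|_1\le1\}$, and $\operatorname{int}\mathcal U=\{|\xi|_1<1\}$. Let $\mathcal R=\{\pm e_1,\dots,\pm e_d\}$ and $\mathcal R^o=\mathcal R\cup\{0\}$; zero steps have weight $0$. For $\diamond=\text{none}$, admissible $n$-paths from $x$ are sequences $(x_0=x,x_1,\dots,x_n)$ with steps in $\mathcal R$; for $\diamond=o$, steps are in $\mathcal R^o$. $G^\diamond_{0,(k),x}$ is the minimum of $\sum_{i=0}^{k-1}t(\{x_i,x_{i+1}\})$ over admissible $k$-paths from $0$ to $x$, and $\mathcal D^\diamond_k$ is the set of $x$ reachable from $0$ by such $k$-paths. Write $G=G^{\text{none}}$ and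 $g=g^{\text{none}}$. *)

theory Defs
  imports "HOL-Probability.Probability"
begin

definition l1_int :: "int ^ 'd \<Rightarrow> int" where
  "l1_int x = (\<Sum>i\<in>UNIV. \<bar>x $ i\<bar>)"

definition l1_real :: "real ^ 'd \<Rightarrow> real" where
  "l1_real \<xi> = (\<Sum>i\<in>UNIV. \<bar>\<xi> $ i\<bar>)"

definition intU :: "(real ^ 'd) set" where
  "intU = {\<xi>. l1_real \<xi> < 1}"

definition lattice_edges :: "(int ^ 'd) set set" where
  "lattice_edges = {{a, b} | a b. l1_int (a - b) = 1}"

text \<open>Admissible steps: R (unit vectors) for diamond = none (False), R^o = R plus 0 for diamond = o (True).\<close>
definition steps :: "bool \<Rightarrow> (int ^ 'd) set" where
  "steps lazy = {v. l1_int v = 1} \<union> (if lazy then {0} else {})"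

definition adm_path :: "bool \<Rightarrow> nat \<Rightarrow> (nat \<Rightarrow> int ^ 'd) \<Rightarrow> bool" where
  "adm_path lazy n p \<longleftrightarrow> (\<forall>i<n. p (Suc i) - p i \<in> steps lazy)"

definition step_weight :: "((int ^ 'd) set \<Rightarrow> real) \<Rightarrow> int ^ 'd \<Rightarrow> int ^ 'd \<Rightarrow> real" where
  "step_weight w a b = (if a = b then 0 else w {a, b})"

definition path_weight :: "((int ^ 'd) set \<Rightarrow> real) \<Rightarrow> nat \<Rightarrow> (nat \<Rightarrow> int ^ 'd) \<Rightarrow> real" where
  "path_weight w n p = (\<Sum>i<n. step_weight w (p i) (p (Suc i)))"

definition Gpp :: "bool \<Rightarrow> ((int ^ 'd) set \<Rightarrow> real) \<Rightarrow> nat \<Rightarrow> int ^ 'd \<Rightarrow> real" where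
  "Gpp lazy w k x = Inf {path_weight w k p | p. adm_path lazy k p \<and> p 0 = 0 \<and> p k = x}"

definition reach :: "bool \<Rightarrow> nat \<Rightarrow> (int ^ 'd) set" where
  "reach lazy k = {x. \<exists>p. adm_path lazy k p \<and> p 0 = 0 \<and> p k = x}"

definition ess_inf :: "real measure \<Rightarrow> ereal" where
  "ess_inf \<mu> = - esssup \<mu> (\<lambda>y. - ereal y)"

end

theory Submission
  imports Defs
begin

text \<open>
Subtracting \<open>\<rho> = r\<^sub>0 \<and> 0\<close> from every step makes all step costs nonnegative and changes the cost
of a \<open>k\<close>-path by the deterministic amount \<open>k \<rho>\<close>. Restricted passage costs are then subadditive, so
along a rational ray the costs obey a law of large numbers: the upper bound follows from Chebyshev's
inequality for the locally dependent block costs, the lower bound from the covering proof of Kingman's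
theorem. The closed convex hull of the normalized expectations defines \<open>g\<close>.

To pass from rays to all endpoints one joins a point \<open>x\<close> at time \<open>k\<close> to a ray point at a time close to
\<open>(1 \<plusminus> \<eta>) k\<close>, at a cost \<open>O(\<eta> k)\<close> that holds simultaneously for all \<open>x\<close>. Near \<open>x\<close> one of the
\<open>2d\<close> short straight arms is cheap, which is where the moment hypothesis is needed and is used in full;
from the arm start many disjoint parallel lines, each of which is widened by local detours so that its
cost is at most linear with probability \<open>1 - O(l powr (-1/4))\<close>, and by independence some line of
every family is good. Surplus steps are spent oscillating across a cheap edge of such a line.
\<close>

section \<open>Lattice geometry and restricted path costs\<close>

text \<open>The number of steps is prescribed exactly, so a connection must be cheap and also have
  the right length and, without zero steps, the right parity. The geometric estimates therefore
  bound lengths only from above, and one final adjustment fills up the missing steps. The moment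
  hypothesis yields for one weight only a tail of order \<open>s powr (-1/2)\<close>: all
  \<open>2d\<close> copies exceed \<open>s\<close> with probability at most \<open>m / s^d\<close>,
  and a \<open>2d\<close>-th root is taken. Means may thus be infinite and a straight line may be
  too expensive; three edge-disjoint routes give \<open>s powr (-3/2)\<close>, hence a finite mean
  and room for a truncated Chebyshev bound. The exponent \<open>d\<close> itself enters where all
  sites are treated at once: the number of sites within distance \<open>\<Lambda> A\<close> of the
  origin is of order \<open>A^d\<close>. Rays are taken near \<open>\<xi> / (1 -+ \<eta>)\<close>,
  which lies in the open l1 ball when \<open>\<eta>\<close> is small; this is why the uniformity
  stops short of the boundary.\<close>

lemma l1_int_zero [simp]: "l1_int 0 = 0"
  by (simp add: l1_int_def)

lemma l1_int_nonneg [simp]: "0 \<le> l1_int x"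
  by (simp add: l1_int_def sum_nonneg)

lemma l1_int_eq_0_iff [simp]: "l1_int x = 0 \<longleftrightarrow> x = 0"
  by (auto simp: l1_int_def sum_nonneg_eq_0_iff vec_eq_iff)

lemma l1_int_triangle: "l1_int (x + y) \<le> l1_int x + l1_int y"
  unfolding l1_int_def sum.distrib[symmetric] by (intro sum_mono) (auto simp: abs_triangle_ineq)

lemma l1_int_minus [simp]: "l1_int (- x) = l1_int x"
  by (simp add: l1_int_def)

lemma l1_int_diff_commute: "l1_int (x - y) = l1_int (y - x)"
  using l1_int_minus[of "x - y"] by simp

lemma l1_int_triangle_diff: "l1_int (x - z) \<le> l1_int (x - y) + l1_int (y - z)"
  using l1_int_triangle[of "x - y" "y - z"] by simp

lemma abs_nth_le_l1_int: "\<bar>x $ i\<bar> \<le> l1_int x"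
  unfolding l1_int_def by (rule member_le_sum) auto

lemma l1_int_axis [simp]: "l1_int (axis i r) = \<bar>r\<bar>"
proof -
  have "l1_int (axis i r) = (\<Sum>j\<in>UNIV. if j = i then \<bar>r\<bar> else 0)"
    unfolding l1_int_def by (intro sum.cong) (auto simp: axis_def)
  then show ?thesis by simp
qed

lemma l1_int_scale: "l1_int (k *s x) = \<bar>k\<bar> * l1_int x"
  by (simp add: l1_int_def abs_mult sum_distrib_left)

lemma finite_int_box: "finite {x::int^'d. \<forall>i. \<bar>x $ i\<bar> \<le> r}"
  and card_int_box: "r \<ge> 0 \<Longrightarrow> real (card {x::int^'d. \<forall>i. \<bar>x $ i\<bar> \<le> r}) \<le> (2 * real_of_int r + 1) ^ CARD('d)"
proof -
  let ?B = "{x::int^'d. \<forall>i. \<bar>x $ i\<bar> \<le> r}"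
  let ?P = "PiE UNIV (\<lambda>_::'d. {- r .. r})"
  have inj: "inj_on vec_nth ?B" by (auto intro: inj_onI simp: vec_eq_iff)
  have sub: "vec_nth ` ?B \<subseteq> ?P"
  proof
    fix f assume "f \<in> vec_nth ` ?B"
    then obtain x where x: "\<forall>i. \<bar>x $ i\<bar> \<le> r" "f = vec_nth x" by auto
    have "f i \<in> {-r..r}" for i using x(1)[rule_format, of i] x(2) by auto
    then show "f \<in> ?P" by (auto simp: PiE_def)
  qed
  have fin: "finite ?P" by (intro finite_PiE) auto
  show "finite ?B" using finite_imageD[OF finite_subset[OF sub fin] inj] .
  assume r: "r \<ge> 0"
  have "card ?B = card (vec_nth ` ?B)" using inj by (simp add: card_image)
  also have "\<dots> \<le> card ?P" by (intro card_mono fin sub)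
  also have "card ?P = nat (2 * r + 1) ^ CARD('d)" by (simp add: card_PiE algebra_simps)
  finally have "card ?B \<le> nat (2 * r + 1) ^ CARD('d)" .
  then show "real (card ?B) \<le> (2 * real_of_int r + 1) ^ CARD('d)"
  proof -
    assume "card ?B \<le> nat (2 * r + 1) ^ CARD('d)"
    then have "real (card ?B) \<le> real (nat (2 * r + 1) ^ CARD('d))" by (rule of_nat_mono)
    also have "\<dots> = (2 * real_of_int r + 1) ^ CARD('d)" using r by simp
    finally show ?thesis .
  qed
qed

lemma finite_l1_ball: "finite {x. l1_int x \<le> r}"
  by (rule finite_subset[OF _ finite_int_box[of r]]) (auto intro: order_trans[OF abs_nth_le_l1_int])

lemma finite_steps: "finite (steps lazy)"
  unfolding steps_def using finite_subset[OF _ finite_l1_ball[of 1]]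
  by (auto intro: finite_subset[OF _ finite_l1_ball[of 1]])

lemma steps_ne: "steps lazy \<noteq> {}"
proof -
  have "axis (undefined::'d) 1 \<in> (steps lazy :: (int^'d) set)" by (simp add: steps_def)
  then show ?thesis by blast
qed

lemma steps_uminus: "v \<in> steps lazy \<Longrightarrow> - v \<in> steps lazy"
  by (auto simp: steps_def split: if_splits)

lemma steps_l1: "v \<in> steps lazy \<Longrightarrow> l1_int v \<le> 1"
  by (auto simp: steps_def split: if_splits)

lemma edge_iff: "{a, b} \<in> lattice_edges \<longleftrightarrow> l1_int (a - b) = 1"
  unfolding lattice_edges_def by (auto simp: doubleton_eq_iff l1_int_diff_commute)

lemma countable_lattice_edges: "countable (lattice_edges :: (int^'d) set set)"
proof -
  have "lattice_edges \<subseteq> (\<Union>a::int^'d. \<Union>b::int^'d. {{a, b}})"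
    by (auto simp: lattice_edges_def)
  moreover have "countable (\<Union>a::int^'d. \<Union>b::int^'d. {{a, b}})"
    by (intro countable_UN countableI_type) auto
  ultimately show ?thesis by (rule countable_subset)
qed

section \<open>Passage costs with a prescribed number of steps, as a recursion over the first
  step\<close>

definition ecost :: "real \<Rightarrow> ((int^'d) set \<Rightarrow> real) \<Rightarrow> int^'d \<Rightarrow> int^'d \<Rightarrow> ennreal" where
  "ecost c W a b = (if a = b then ennreal c else ennreal \<bar>W {a, b}\<bar>)"

text \<open>Zero steps cost \<open>c\<close>, so that all step costs stay nonnegative after the weights are shifted;
  the value is infinite when no admissible path exists.\<close>

primrec pcost :: "bool \<Rightarrow> real \<Rightarrow> ((int^'d) set \<Rightarrow> real) \<Rightarrow> nat \<Rightarrow> int^'d \<Rightarrow> int^'d \<Rightarrow> ennreal" where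
  "pcost lazy c W 0 x y = (if x = y then 0 else \<infinity>)"
| "pcost lazy c W (Suc n) x y = (INF v\<in>steps lazy. ecost c W x (x + v) + pcost lazy c W n (x + v) y)"

lemma pcost_Suc_le: "v \<in> steps lazy \<Longrightarrow> pcost lazy c W (Suc n) x y \<le> ecost c W x (x + v) + pcost lazy c W n (x + v) y"
  by (auto intro: INF_lower)

text \<open>The infimum runs over a finite nonempty set of steps, hence is attained; inductions on
  the number of steps can follow one optimal first step.\<close>

lemma pcost_Suc_attained:
  obtains v where "v \<in> steps lazy" "pcost lazy c W (Suc n) x y = ecost c W x (x + v) + pcost lazy c W n (x + v) y"
proof -
  let ?S = "(\<lambda>v. ecost c W x (x + v) + pcost lazy c W n (x + v) y) ` steps lazy"
  have "Inf ?S = Min ?S" using finite_steps steps_ne by (intro cInf_eq_Min) auto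
  moreover have "Min ?S \<in> ?S" using finite_steps steps_ne by (intro Min_in) auto
  ultimately show ?thesis using that by auto
qed

lemma pcost_triangle: "pcost lazy c W (n + m) x z \<le> pcost lazy c W n x y + pcost lazy c W m y z"
proof (induction n arbitrary: x)
  case (Suc n)
  obtain v where v: "v \<in> steps lazy" "pcost lazy c W (Suc n) x y = ecost c W x (x + v) + pcost lazy c W n (x + v) y"
    by (rule pcost_Suc_attained)
  have "pcost lazy c W (Suc n + m) x z \<le> ecost c W x (x + v) + pcost lazy c W (n + m) (x + v) z"
    using pcost_Suc_le[OF v(1), of c W "n + m" x z] by simp
  also have "\<dots> \<le> ecost c W x (x + v) + (pcost lazy c W n (x + v) y + pcost lazy c W m y z)"
    by (intro add_left_mono Suc)
  finally show ?case using v(2) by (simp add: add.assoc)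
qed auto

lemma ecost_commute: "ecost c W a b = ecost c W b a"
  by (auto simp: ecost_def insert_commute)

lemma pcost_1: "y - x \<in> steps lazy \<Longrightarrow> pcost lazy c W 1 x y \<le> ecost c W x y"
  using pcost_Suc_le[of "y - x" lazy c W 0 x y] by simp

text \<open>Path reversal: an optimal first step is split off and appended at the far end by
  \<open>pcost_triangle\<close>. This uses that steps come in pairs \<open>v\<close>,
  \<open>- v\<close> and that edges are undirected.\<close>

lemma pcost_commute: "pcost lazy c W n x y = pcost lazy c W n y x"
proof -
  have "pcost lazy c W n y x \<le> pcost lazy c W n x y" for x y
  proof (induction n arbitrary: x)
    case (Suc n)
    obtain v where v: "v \<in> steps lazy" "pcost lazy c W (Suc n) x y = ecost c W x (x + v) + pcost lazy c W n (x + v) y"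
      by (rule pcost_Suc_attained)
    have "pcost lazy c W (n + 1) y x \<le> pcost lazy c W n y (x + v) + pcost lazy c W 1 (x + v) x"
      by (rule pcost_triangle)
    also have "\<dots> \<le> pcost lazy c W n (x + v) y + ecost c W (x + v) x"
      using steps_uminus[OF v(1)] by (intro add_mono Suc pcost_1) auto
    finally show ?case unfolding v(2) ecost_commute[of c W "x + v" x] by (simp add: add.commute del: pcost.simps)
  qed auto
  then show ?thesis by (intro antisym)
qed

text \<open>The configuration seen from \<open>z\<close>. Restricting it to
  \<open>lattice_edges\<close> keeps it an extensional function, as points of the product space are,
  so that the shift acts on that space.\<close>

definition shiftW :: "int^'d \<Rightarrow> ((int^'d) set \<Rightarrow> real) \<Rightarrow> (int^'d) set \<Rightarrow> real" where
  "shiftW z W = (\<lambda>e\<in>lattice_edges. W ((+) z ` e))"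

lemma step_edge: "v \<in> steps lazy \<Longrightarrow> v \<noteq> 0 \<Longrightarrow> {x, x + v} \<in> lattice_edges"
  by (auto simp: edge_iff steps_def split: if_splits)

lemma pcost_shift: "pcost lazy c (shiftW z W) n x y = pcost lazy c W n (z + x) (z + y)"
proof (induction n arbitrary: x)
  case (Suc n)
  have "ecost c (shiftW z W) x (x + v) = ecost c W (z + x) (z + x + v)" if "v \<in> steps lazy" for v
    using step_edge[OF that] by (auto simp: ecost_def shiftW_def add.assoc)
  then show ?case by (simp add: Suc add.assoc)
qed auto

definition ball_edges :: "int^'d \<Rightarrow> nat \<Rightarrow> (int^'d) set set" where
  "ball_edges x n = {e \<in> lattice_edges. \<forall>a\<in>e. l1_int (a - x) \<le> int n}"

text \<open>A path of \<open>n\<close> steps stays in the l1 ball of radius \<open>n\<close> around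
  its start. This finite range is what makes distant blocks of a ray independent later.\<close>

lemma pcost_local:
  "(\<And>e. e \<in> ball_edges x n \<Longrightarrow> W e = W' e) \<Longrightarrow> pcost lazy c W n x y = pcost lazy c W' n x y"
proof (induction n arbitrary: x)
  case (Suc n)
  have "ecost c W x (x + v) + pcost lazy c W n (x + v) y = ecost c W' x (x + v) + pcost lazy c W' n (x + v) y"
    if v: "v \<in> steps lazy" for v
  proof -
    have "{x, x + v} \<in> ball_edges x (Suc n)" if "v \<noteq> 0"
      using steps_l1[OF v] step_edge[OF v that] by (auto simp: ball_edges_def)
    then have 1: "ecost c W x (x + v) = ecost c W' x (x + v)"
      using Suc.prems by (auto simp: ecost_def)
    have "ball_edges (x + v) n \<subseteq> ball_edges x (Suc n)"
    proof (clarsimp simp: ball_edges_def)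
      fix e a assume "\<forall>a\<in>e. l1_int (a - (x + v)) \<le> int n" "a \<in> e"
      then have "l1_int (a - (x + v)) \<le> int n" by auto
      moreover have "l1_int (a - x) \<le> l1_int (a - (x + v)) + l1_int v"
        using l1_int_triangle[of "a - (x + v)" v] by (simp add: algebra_simps)
      ultimately show "l1_int (a - x) \<le> 1 + int n" using steps_l1[OF v] by simp
    qed
    then show ?thesis using 1 Suc.IH[of "x + v"] Suc.prems by (metis subsetD)
  qed
  then show ?case by (auto intro!: INF_cong)
qed auto

lemma measurable_pcost [measurable]:
  "(\<lambda>W. pcost lazy c W n x y) \<in> borel_measurable (PiM lattice_edges (\<lambda>_. borel))"
proof (induction n arbitrary: x)
  case (Suc n)
  have "(\<lambda>W. ecost c W x (x + v)) \<in> borel_measurable (PiM lattice_edges (\<lambda>_. borel))" if "v \<in> steps lazy" for v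
    using step_edge[OF that, of x] by (cases "v = 0") (auto simp: ecost_def intro!: measurable_compose[OF measurable_component_singleton])
  then show ?case using Suc countable_finite[OF finite_steps]
    by (auto intro!: borel_measurable_INF)
qed auto

text \<open>The lattice is bipartite: every unit step flips the parity of the coordinate sum, so
  without zero steps this sum and the number of steps are tied together.\<close>

lemma pcost_finite_parity:
  assumes "pcost False c W n x y < \<infinity>"
  shows "even (int n + (\<Sum>i\<in>UNIV. (y - x) $ i))"
  using assms
proof (induction n arbitrary: x)
  case 0
  then show ?case by (auto split: if_splits)
next
  case (Suc n)
  obtain v where v: "v \<in> steps False" "pcost False c W (Suc n) x y = ecost c W x (x + v) + pcost False c W n (x + v) y"
    by (rule pcost_Suc_attained)
  then have "pcost False c W n (x + v) y < \<infinity>" using Suc.prems by (auto simp: ennreal_add_eq_top less_top)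
  from Suc.IH[OF this] have 1: "even (int n + (\<Sum>i\<in>UNIV. (y - (x + v)) $ i))" .
  have 2: "even (l1_int v) = even (\<Sum>i\<in>UNIV. v $ i)"
    unfolding l1_int_def by (induction rule: infinite_finite_induct) auto
  have "l1_int v = 1" using v by (simp add: steps_def)
  then have "odd (\<Sum>i\<in>UNIV. v $ i)" using 2 by simp
  moreover have "(\<Sum>i\<in>UNIV. (y - x) $ i) = (\<Sum>i\<in>UNIV. (y - (x + v)) $ i) + (\<Sum>i\<in>UNIV. v $ i)"
    by (simp add: sum_subtractf sum.distrib)
  ultimately show ?case using 1 by simp
qed

lemma pcost_le_path:
  "adm_path lazy n p \<Longrightarrow> pcost lazy c W n (p 0) (p n) \<le> (\<Sum>i<n. ecost c W (p i) (p (Suc i)))"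
proof (induction n arbitrary: p)
  case (Suc n)
  have 1: "adm_path lazy n (\<lambda>i. p (Suc i))" and v: "p 1 - p 0 \<in> steps lazy"
    using Suc.prems by (auto simp: adm_path_def)
  have "pcost lazy c W (Suc n) (p 0) (p (Suc n)) \<le> ecost c W (p 0) (p 1) + pcost lazy c W n (p 1) (p (Suc n))"
    using pcost_Suc_le[OF v, of c W n "p 0" "p (Suc n)"] by simp
  also have "\<dots> \<le> ecost c W (p 0) (p 1) + (\<Sum>i<n. ecost c W (p (Suc i)) (p (Suc (Suc i))))"
    using Suc.IH[OF 1] by (intro add_left_mono) simp
  finally show ?case by (subst sum.lessThan_Suc_shift) (simp del: pcost.simps)
qed auto

text \<open>Together with \<open>pcost_le_path\<close> this identifies the recursion with a minimum
  over paths.\<close>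

lemma pcost_path_attained:
  assumes "pcost lazy c W n x y < \<infinity>"
  obtains p where "adm_path lazy n p" "p 0 = x" "p n = y"
    "pcost lazy c W n x y = (\<Sum>i<n. ecost c W (p i) (p (Suc i)))"
  using assms
proof (induction n arbitrary: x thesis)
  case 0
  then show ?case by (auto simp: adm_path_def split: if_splits)
next
  case (Suc n)
  obtain v where v: "v \<in> steps lazy" "pcost lazy c W (Suc n) x y = ecost c W x (x + v) + pcost lazy c W n (x + v) y"
    by (rule pcost_Suc_attained)
  then have "pcost lazy c W n (x + v) y < \<infinity>" using Suc.prems by (auto simp: ennreal_add_eq_top less_top)
  from Suc.IH[OF _ this] obtain p where p: "adm_path lazy n p" "p 0 = x + v" "p n = y"
    "pcost lazy c W n (x + v) y = (\<Sum>i<n. ecost c W (p i) (p (Suc i)))" by blast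
  let ?q = "case_nat x p"
  have "adm_path lazy (Suc n) ?q" using p v by (auto simp: adm_path_def split: nat.split)
  moreover have "pcost lazy c W (Suc n) x y = (\<Sum>i<Suc n. ecost c W (?q i) (?q (Suc i)))"
    using v(2) p by (subst sum.lessThan_Suc_shift) simp
  ultimately show ?case using Suc.prems(1)[of ?q] p by simp
qed

section \<open>Independent weights\<close>

text \<open>Dependence on the coordinates in \<open>E\<close> only, stated pointwise; this is easy
  to check for path costs, and \<open>indep_local\<close> turns it into independence.\<close>

definition local_on :: "'e set \<Rightarrow> (('e \<Rightarrow> real) \<Rightarrow> 'b) \<Rightarrow> bool" where
  "local_on E F \<longleftrightarrow> (\<forall>W W'. (\<forall>e\<in>E. W e = W' e) \<longrightarrow> F W = F W')"

lemma local_onD: "local_on E F \<Longrightarrow> (\<And>e. e \<in> E \<Longrightarrow> W e = W' e) \<Longrightarrow> F W = F W'"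
  by (auto simp: local_on_def)

lemma (in prob_space) borel_cantelli_bound:
  assumes "\<And>n. A n \<in> events" "\<And>n. n \<ge> n0 \<Longrightarrow> prob (A n) \<le> f n" "summable f"
  shows "AE x in M. eventually (\<lambda>n. x \<notin> A n) sequentially"
proof -
  have "summable (\<lambda>n. prob (A n))"
    by (rule summable_comparison_test_ev[OF _ assms(3)]) (auto intro!: eventually_sequentiallyI[of n0] assms)
  from borel_cantelli_AE1[OF assms(1) _ this] have "AE x in M. \<forall>\<^sub>F n in sequentially. x \<in> space M - A n"
    by (simp add: emeasure_eq_measure)
  then show ?thesis by eventually_elim (auto elim: eventually_mono)
qed

text \<open>Only pairs with \<open>j \<in> N i\<close> contribute to the variance of the sum, and
  each contributes at most \<open>s\<close>. There are at most \<open>card I * B\<close> such pairs,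
  and Chebyshev's inequality gives the bound.\<close>

lemma (in prob_space) local_dependence_chebyshev:
  fixes Y :: "'i \<Rightarrow> 'a \<Rightarrow> real"
  assumes fin: "finite I" and Y[measurable]: "\<And>i. i \<in> I \<Longrightarrow> Y i \<in> borel_measurable M"
    and sq: "\<And>i. i \<in> I \<Longrightarrow> integrable M (\<lambda>x. (Y i x)\<^sup>2)" "\<And>i. i \<in> I \<Longrightarrow> expectation (\<lambda>x. (Y i x)\<^sup>2) \<le> s"
    and ind: "\<And>i j. i \<in> I \<Longrightarrow> j \<in> I \<Longrightarrow> j \<notin> N i \<Longrightarrow> expectation (\<lambda>x. Y i x * Y j x) = expectation (Y i) * expectation (Y j)"
    and B: "\<And>i. i \<in> I \<Longrightarrow> card (N i \<inter> I) \<le> B"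
    and a: "a > 0"
  shows "prob {x\<in>space M. (\<Sum>i\<in>I. Y i x) \<ge> (\<Sum>i\<in>I. expectation (Y i)) + a} \<le> real (card I) * real B * s / a\<^sup>2"
proof -
  define Z where "Z i x = Y i x - expectation (Y i)" for i x
  have int: "integrable M (Y i)" if "i \<in> I" for i
    using square_integrable_imp_integrable[OF Y[OF that] sq(1)[OF that]] .
  have Zm[measurable]: "Z i \<in> borel_measurable M" if "i \<in> I" for i
    using Y[OF that] unfolding Z_def[abs_def] by measurable
  have intp: "integrable M (\<lambda>x. Y i x * Y j x)" if "i \<in> I" "j \<in> I" for i j
  proof (rule Bochner_Integration.integrable_bound)
    show "integrable M (\<lambda>x. (Y i x)\<^sup>2 + (Y j x)\<^sup>2)" using sq that by auto
    show "AE x in M. norm (Y i x * Y j x) \<le> norm ((Y i x)\<^sup>2 + (Y j x)\<^sup>2)"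
    proof (rule AE_I2)
      fix x
      have "2 * \<bar>Y i x\<bar> * \<bar>Y j x\<bar> \<le> (Y i x)\<^sup>2 + (Y j x)\<^sup>2"
        using sum_squares_bound[of "\<bar>Y i x\<bar>" "\<bar>Y j x\<bar>"] by simp
      moreover have "0 \<le> \<bar>Y i x\<bar> * \<bar>Y j x\<bar>" by simp
      ultimately have "\<bar>Y i x\<bar> * \<bar>Y j x\<bar> \<le> (Y i x)\<^sup>2 + (Y j x)\<^sup>2" by linarith
      then show "norm (Y i x * Y j x) \<le> norm ((Y i x)\<^sup>2 + (Y j x)\<^sup>2)" by (simp add: abs_mult)
    qed
  qed (use that in simp)
  have Zp: "integrable M (\<lambda>x. Z i x * Z j x)"
    "expectation (\<lambda>x. Z i x * Z j x) = expectation (\<lambda>x. Y i x * Y j x) - expectation (Y i) * expectation (Y j)"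
    if "i \<in> I" "j \<in> I" for i j
  proof -
    have *: "(\<lambda>x. Z i x * Z j x) = (\<lambda>x. Y i x * Y j x - expectation (Y j) * Y i x - expectation (Y i) * Y j x + expectation (Y i) * expectation (Y j))"
      by (auto simp: Z_def algebra_simps)
    show "integrable M (\<lambda>x. Z i x * Z j x)" unfolding * using intp[OF that] int that by auto
    show "expectation (\<lambda>x. Z i x * Z j x) = expectation (\<lambda>x. Y i x * Y j x) - expectation (Y i) * expectation (Y j)"
      unfolding * using intp[OF that] int that by (simp add: prob_space)
  qed
  have Zs: "expectation (\<lambda>x. (Z i x)\<^sup>2) \<le> s" if "i \<in> I" for i
    using Zp(2)[OF that that] sq(2)[OF that] zero_le_square[of "expectation (Y i)"]
    by (simp add: power2_eq_square del: zero_le_square)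
  \<comment> \<open>A dependent pair is handled by \<open>2 u v \<le> u^2 + v^2\<close>; the
    variance of one term is at most its second moment, hence at most \<open>s\<close>.\<close>
  have cov: "expectation (\<lambda>x. Z i x * Z j x) \<le> (if j \<in> N i then s else 0)" if "i \<in> I" "j \<in> I" for i j
  proof (cases "j \<in> N i")
    case True
    have i2: "integrable M (\<lambda>x. (Z i x)\<^sup>2)" if "i \<in> I" for i using Zp(1)[OF that that] by (simp add: power2_eq_square)
    have "expectation (\<lambda>x. Z i x * Z j x) \<le> expectation (\<lambda>x. ((Z i x)\<^sup>2 + (Z j x)\<^sup>2) / 2)"
    proof (rule integral_mono)
      show "Z i x * Z j x \<le> ((Z i x)\<^sup>2 + (Z j x)\<^sup>2) / 2" for x using sum_squares_bound[of "Z i x" "Z j x"] by simp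
    qed (use Zp(1)[OF that] i2 that in auto)
    also have "\<dots> = (expectation (\<lambda>x. (Z i x)\<^sup>2) + expectation (\<lambda>x. (Z j x)\<^sup>2)) / 2" using i2 that by simp
    also have "\<dots> \<le> s" using Zs[OF that(1)] Zs[OF that(2)] by simp
    finally show ?thesis using True by simp
  qed (use Zp(2)[OF that] ind[OF that] in simp)
  define S where "S x = (\<Sum>i\<in>I. Z i x)" for x
  have Ssq: "(S x)\<^sup>2 = (\<Sum>i\<in>I. \<Sum>j\<in>I. Z i x * Z j x)" for x
    by (simp add: S_def power2_eq_square sum_product)
  have Si: "integrable M (\<lambda>x. (S x)\<^sup>2)" unfolding Ssq using Zp(1) by auto
  have "expectation (\<lambda>x. (S x)\<^sup>2) = (\<Sum>i\<in>I. \<Sum>j\<in>I. expectation (\<lambda>x. Z i x * Z j x))"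
    unfolding Ssq using Zp(1) by (simp add: Bochner_Integration.integral_sum)
  also have "\<dots> \<le> (\<Sum>i\<in>I. \<Sum>j\<in>I. if j \<in> N i then s else 0)" by (intro sum_mono cov)
  also have "\<dots> = (\<Sum>i\<in>I. real (card (N i \<inter> I)) * s)"
    by (intro sum.cong refl) (simp add: sum.If_cases[OF fin] Int_commute)
  also have "\<dots> \<le> (\<Sum>i\<in>I. real B * s)"
  proof (intro sum_mono mult_right_mono)
    fix i assume i: "i \<in> I"
    show "real (card (N i \<inter> I)) \<le> real B" using B[OF i] by simp
    have "0 \<le> expectation (\<lambda>x. (Z i x)\<^sup>2)" by simp
    then show "0 \<le> s" using Zs[OF i] by linarith
  qed
  also have "\<dots> = real (card I) * real B * s" by simp
  finally have ES: "expectation (\<lambda>x. (S x)\<^sup>2) \<le> real (card I) * real B * s" .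
  have Sm[measurable]: "S \<in> borel_measurable M" unfolding S_def[abs_def] by measurable
  have "prob {x\<in>space M. (\<Sum>i\<in>I. Y i x) \<ge> (\<Sum>i\<in>I. expectation (Y i)) + a} \<le> prob {x\<in>space M. (S x)\<^sup>2 \<ge> a\<^sup>2}"
  proof (rule finite_measure_mono)
    show "{x\<in>space M. (\<Sum>i\<in>I. Y i x) \<ge> (\<Sum>i\<in>I. expectation (Y i)) + a} \<subseteq> {x\<in>space M. (S x)\<^sup>2 \<ge> a\<^sup>2}"
      using a by (auto simp: S_def Z_def sum_subtractf intro!: power_mono)
  qed simp
  also have "\<dots> \<le> expectation (\<lambda>x. (S x)\<^sup>2) / a\<^sup>2"
    using integral_Markov_inequality_measure[OF Si, of "space M" "a\<^sup>2"] a by simp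
  also have "\<dots> \<le> real (card I) * real B * s / a\<^sup>2" using ES by (intro divide_right_mono) auto
  finally show ?thesis .
qed

text \<open>Here \<open>\<nu>\<close> stands for the law of the shifted weights. Costs and the
  moment bound are stated through absolute values, which encodes nonnegativity without a condition
  on the support of \<open>\<nu>\<close>. The parameter \<open>D\<close> ties the dimension type to
  the locale.\<close>

locale iid_env =
  fixes \<nu> :: "real measure" and D :: "'d::finite itself"
  assumes prob_nu: "prob_space \<nu>" and sets_nu [measurable_cong]: "sets \<nu> = sets borel"
    and dim2: "CARD('d) \<ge> 2"
    and mom: "(\<integral>\<^sup>+ y. ennreal ((Min ((\<lambda>i. \<bar>y i\<bar>) ` {..<2 * CARD('d)})) ^ CARD('d))
                   \<partial>(PiM {..<2 * CARD('d)} (\<lambda>_. \<nu>))) < \<infinity>"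
begin

section \<open>The environment as a stationary product measure\<close>

definition P :: "((int^'d) set \<Rightarrow> real) measure" where
  "P = PiM lattice_edges (\<lambda>_. \<nu>)"

sublocale P: prob_space P
  unfolding P_def by (intro prob_space_PiM prob_nu)

lemma sets_P [measurable_cong]: "sets P = sets (PiM lattice_edges (\<lambda>_. borel))"
  unfolding P_def by (intro sets_PiM_cong refl sets_nu)

lemma measurable_edge [measurable]: "e \<in> lattice_edges \<Longrightarrow> (\<lambda>W. W e) \<in> borel_measurable P"
  by measurable

lemma pcost_measurable [measurable]: "(\<lambda>W. pcost lazy c W n x y) \<in> borel_measurable P"
  by measurable

lemma indep_coordinates: "P.indep_vars (\<lambda>_. borel) (\<lambda>e W. W e) lattice_edges"
proof -
  have ne: "lattice_edges \<noteq> ({} :: (int^'d) set set)"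
    using step_edge[of "axis undefined 1" False 0] by (auto simp: steps_def)
  interpret pp: product_prob_space "\<lambda>_. \<nu>" "lattice_edges :: (int^'d) set set"
    using prob_nu by (auto simp: product_prob_space_def product_prob_space_axioms_def product_sigma_finite_def prob_space_imp_sigma_finite)
  have "P.indep_vars (\<lambda>_. \<nu>) (\<lambda>e W. W e) lattice_edges"
  proof (subst P.indep_vars_iff_distr_eq_PiM'[OF ne])
    show "distr P (PiM lattice_edges (\<lambda>_. \<nu>)) (\<lambda>x. \<lambda>i\<in>lattice_edges. x i) = PiM lattice_edges (\<lambda>i. distr P \<nu> (\<lambda>W. W i))"
    proof -
      have "distr P (PiM lattice_edges (\<lambda>_. \<nu>)) (\<lambda>x. \<lambda>i\<in>lattice_edges. x i) = distr P P (\<lambda>x. x)"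
        by (intro distr_cong) (auto simp: P_def space_PiM PiE_restrict)
      moreover have "PiM lattice_edges (\<lambda>i. distr P \<nu> (\<lambda>W. W i)) = P"
        unfolding P_def by (intro PiM_cong refl) (auto simp: pp.PiM_component)
      ultimately show ?thesis by simp
    qed
  qed (auto simp: P_def)
  then show ?thesis
    by (subst P.indep_vars_def) (auto simp: P.indep_vars_def sets_nu sets_eq_imp_space_eq[OF sets_nu] cong: measurable_cong_sets)
qed

text \<open>A function that is local on \<open>E j\<close> factors through the restriction of the
  configuration to \<open>E j\<close>, and restrictions to disjoint sets of edges are
  independent.\<close>

lemma indep_local:
  assumes E: "\<And>j. j \<in> L \<Longrightarrow> E j \<subseteq> lattice_edges" and disj: "disjoint_family_on E L"
    and F: "\<And>j. j \<in> L \<Longrightarrow> F j \<in> measurable P N" "\<And>j. j \<in> L \<Longrightarrow> local_on (E j) (F j)"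
  shows "P.indep_vars (\<lambda>_. N) F L"
proof -
  \<comment> \<open>\<open>fill\<close> extends a partial configuration by \<open>0\<close> so that
    \<open>F j\<close> can be evaluated on it; by locality the values off \<open>E j\<close> have no
    effect.\<close>
  define fill where "fill j V = (\<lambda>e\<in>lattice_edges. if e \<in> E j then V e else 0)" for j and V :: "(int^'d) set \<Rightarrow> real"
  have fm: "fill j \<in> measurable (PiM (E j) (\<lambda>_. borel)) P" if "j \<in> L" for j
    unfolding fill_def measurable_cong_sets[OF refl sets_P]
  proof (rule measurable_restrict)
    fix e show "(\<lambda>V. if e \<in> E j then V e else 0) \<in> borel_measurable (PiM (E j) (\<lambda>_. borel))"
      by (cases "e \<in> E j") auto
  qed
  have "P.indep_vars (\<lambda>j. PiM (E j) (\<lambda>_. borel)) (\<lambda>j W. restrict (\<lambda>e. W e) (E j)) L"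
    by (intro P.indep_vars_restrict[OF indep_coordinates E disj])
  then have "P.indep_vars (\<lambda>_. N) (\<lambda>j W. F j (fill j (restrict (\<lambda>e. W e) (E j)))) L"
    by (rule P.indep_vars_compose2) (rule measurable_compose[OF fm F(1)])
  moreover have "F j (fill j (restrict (\<lambda>e. W e) (E j))) = F j W" if "j \<in> L" for j W
    using E[OF that] by (intro local_onD[OF F(2)[OF that]]) (auto simp: fill_def)
  ultimately show ?thesis
    by (subst P.indep_vars_cong[where Y="\<lambda>j W. F j (fill j (restrict (\<lambda>e. W e) (E j)))", OF refl _ refl]) auto
qed

lemma expectation_mult_local:
  fixes F G :: "((int^'d) set \<Rightarrow> real) \<Rightarrow> real"
  assumes "E1 \<subseteq> lattice_edges" "E2 \<subseteq> lattice_edges" "E1 \<inter> E2 = {}"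
    "local_on E1 F" "local_on E2 G" "integrable P F" "integrable P G"
  shows "P.expectation (\<lambda>W. F W * G W) = P.expectation F * P.expectation G"
proof -
  have "P.indep_vars (\<lambda>_. borel) (\<lambda>b. if b then F else G) (UNIV :: bool set)"
    by (rule indep_local[where E="\<lambda>b. if b then E1 else E2"]) (use assms in \<open>auto simp: disjoint_family_on_def\<close>)
  from P.indep_vars_lebesgue_integral[OF _ this] show ?thesis using assms by (simp add: UNIV_bool mult.commute)
qed

text \<open>The indicators of events determined by disjoint edge sets are independent, so the
  expectation of their product factorises.\<close>

lemma prob_all_local:
  assumes fin: "finite L" and E: "\<And>j. j \<in> L \<Longrightarrow> E j \<subseteq> lattice_edges" and disj: "disjoint_family_on E L"
    and Q: "\<And>j. j \<in> L \<Longrightarrow> Measurable.pred P (Q j)" "\<And>j. j \<in> L \<Longrightarrow> local_on (E j) (Q j)"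
  shows "P.prob {W\<in>space P. \<forall>j\<in>L. Q j W} = (\<Prod>j\<in>L. P.prob {W\<in>space P. Q j W})"
proof -
  have [measurable]: "{W\<in>space P. Q j W} \<in> sets P" if "j \<in> L" for j using Q(1)[OF that] by measurable
  define F where "F j W = (if Q j W then 1 else 0 :: ennreal)" for j W
  have "P.indep_vars (\<lambda>_. borel) F L"
  proof (rule indep_local[where E=E, OF E disj])
    show "F j \<in> borel_measurable P" if "j \<in> L" for j unfolding F_def[abs_def] using Q(1)[OF that] by measurable
    show "local_on (E j) (F j)" if "j \<in> L" for j using Q(2)[OF that] unfolding local_on_def F_def by metis
  qed auto
  from P.indep_vars_nn_integral[OF fin this]
  have 1: "(\<integral>\<^sup>+W. (\<Prod>j\<in>L. F j W) \<partial>P) = (\<Prod>j\<in>L. \<integral>\<^sup>+W. F j W \<partial>P)" by simp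
  have 2: "(\<integral>\<^sup>+W. F j W \<partial>P) = ennreal (P.prob {W\<in>space P. Q j W})" if "j \<in> L" for j
  proof -
    have "(\<integral>\<^sup>+W. F j W \<partial>P) = (\<integral>\<^sup>+W. indicator {W\<in>space P. Q j W} W \<partial>P)"
      by (intro nn_integral_cong) (auto simp: F_def indicator_def)
    then show ?thesis using that by (simp add: P.emeasure_eq_measure)
  qed
  have [measurable]: "{W\<in>space P. \<forall>j\<in>L. Q j W} \<in> sets P"
    using fin Q(1) by (intro sets.sets_Collect_finite_All) auto
  have "(\<integral>\<^sup>+W. (\<Prod>j\<in>L. F j W) \<partial>P) = (\<integral>\<^sup>+W. indicator {W\<in>space P. \<forall>j\<in>L. Q j W} W \<partial>P)"
    using fin by (intro nn_integral_cong) (auto simp: F_def indicator_def prod_zero_iff)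
  also have "\<dots> = ennreal (P.prob {W\<in>space P. \<forall>j\<in>L. Q j W})" by (simp add: P.emeasure_eq_measure)
  finally have "ennreal (P.prob {W\<in>space P. \<forall>j\<in>L. Q j W}) = (\<Prod>j\<in>L. ennreal (P.prob {W\<in>space P. Q j W}))"
    using 1 2 by (simp cong: prod.cong)
  also have "\<dots> = ennreal (\<Prod>j\<in>L. P.prob {W\<in>space P. Q j W})" by (intro prod_ennreal) simp
  finally show ?thesis by (simp add: prod_nonneg)
qed

lemma translate_edge: "e \<in> lattice_edges \<Longrightarrow> (+) z ` e \<in> lattice_edges"
  by (auto simp: lattice_edges_def) (metis add_diff_cancel_left)

text \<open>Translation maps edges injectively to edges and all coordinates have the same law, so
  this is a reindexing of the product measure.\<close>

lemma distr_shift: "distr P P (shiftW z) = P"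
proof -
  have "inj_on ((`) ((+) z)) (lattice_edges :: (int^'d) set set)"
    by (intro inj_onI) (simp add: inj_image_eq_iff)
  from distr_PiM_reindex[OF _ this, of lattice_edges "\<lambda>_. \<nu>"] show ?thesis
    using prob_nu translate_edge by (auto simp: P_def shiftW_def[abs_def])
qed

lemma measurable_shift [measurable]: "shiftW z \<in> measurable P P"
  unfolding measurable_cong_sets[OF refl sets_P] shiftW_def[abs_def]
  by (intro measurable_restrict measurable_edge translate_edge)

lemma nn_integral_shift:
  assumes "F \<in> borel_measurable P"
  shows "(\<integral>\<^sup>+W. F (shiftW z W) \<partial>P) = (\<integral>\<^sup>+W. F W \<partial>P)"
  using nn_integral_distr[OF measurable_shift[of z], of F] assms by (simp add: distr_shift)

lemma prob_shift:
  assumes [measurable]: "Measurable.pred P Q"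
  shows "P.prob {W\<in>space P. Q (shiftW z W)} = P.prob {W\<in>space P. Q W}"
proof -
  have "P.prob {W\<in>space P. Q W} = measure (distr P P (shiftW z)) {W\<in>space P. Q W}" by (simp add: distr_shift)
  also have "\<dots> = P.prob (shiftW z -` {W\<in>space P. Q W} \<inter> space P)" by (intro measure_distr) auto
  also have "shiftW z -` {W\<in>space P. Q W} \<inter> space P = {W\<in>space P. Q (shiftW z W)}"
    using measurable_space[OF measurable_shift] by auto
  finally show ?thesis by simp
qed

text \<open>Any \<open>2d\<close> distinct edges carry an i.i.d. family with law
  \<open>\<nu>\<close>, so the moment hypothesis about abstract copies applies to them.\<close>

lemma nn_integral_distinct_edges:
  assumes phi: "inj_on \<phi> {..<2 * CARD('d)}" "\<And>i. i < 2 * CARD('d) \<Longrightarrow> \<phi> i \<in> lattice_edges"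
  shows "(\<integral>\<^sup>+W. ennreal ((Min ((\<lambda>i. \<bar>W (\<phi> i)\<bar>) ` {..<2 * CARD('d)})) ^ CARD('d)) \<partial>P)
    = (\<integral>\<^sup>+ y. ennreal ((Min ((\<lambda>i. \<bar>y i\<bar>) ` {..<2 * CARD('d)})) ^ CARD('d)) \<partial>(PiM {..<2 * CARD('d)} (\<lambda>_. \<nu>)))"
proof -
  let ?I = "{..<2 * CARD('d)}"
  let ?h = "\<lambda>y. ennreal ((Min ((\<lambda>i. \<bar>y i\<bar>) ` ?I)) ^ CARD('d))"
  have ne: "?I \<noteq> {}" using dim2 by (simp add: lessThan_empty_iff)
  have "(\<integral>\<^sup>+ y. ?h y \<partial>(PiM ?I (\<lambda>_. \<nu>))) = (\<integral>\<^sup>+ y. ?h y \<partial>(distr P (PiM ?I (\<lambda>_. \<nu>)) (\<lambda>W. \<lambda>n\<in>?I. W (\<phi> n))))"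
    using distr_PiM_reindex[OF _ phi(1), of lattice_edges "\<lambda>_. \<nu>"] phi(2) prob_nu by (auto simp: P_def)
  also have "\<dots> = (\<integral>\<^sup>+W. ?h (\<lambda>n\<in>?I. W (\<phi> n)) \<partial>P)"
  proof (rule nn_integral_distr)
    show "(\<lambda>W. \<lambda>n\<in>?I. W (\<phi> n)) \<in> measurable P (PiM ?I (\<lambda>_. \<nu>))"
      using phi(2) by (intro measurable_restrict) (auto simp: measurable_cong_sets[OF refl sets_nu] intro!: measurable_edge)
    have m: "(\<lambda>y. Min ((\<lambda>i. \<bar>y i\<bar>) ` ?I)) \<in> borel_measurable (PiM ?I (\<lambda>_. \<nu>))"
    proof (rule borel_measurable_Min)
      fix i assume "i \<in> ?I"
      then have "(\<lambda>y. y i) \<in> measurable (PiM ?I (\<lambda>_. \<nu>)) \<nu>" by (rule measurable_component_singleton)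
      then have "(\<lambda>y. y i) \<in> borel_measurable (PiM ?I (\<lambda>_. \<nu>))"
        by (simp add: measurable_cong_sets[OF refl sets_nu])
      then show "(\<lambda>y. \<bar>y i\<bar>) \<in> borel_measurable (PiM ?I (\<lambda>_. \<nu>))" by measurable
    qed simp
    show "?h \<in> borel_measurable (distr P (PiM ?I (\<lambda>_. \<nu>)) (\<lambda>W. \<lambda>n\<in>?I. W (\<phi> n)))"
      unfolding measurable_distr_eq1 using m by measurable
  qed
  also have "\<dots> = (\<integral>\<^sup>+W. ?h (\<lambda>i. W (\<phi> i)) \<partial>P)"
    by (intro nn_integral_cong arg_cong[where f=ennreal] arg_cong[where f="\<lambda>x. x ^ _"] arg_cong[where f=Min] image_cong) auto
  finally show ?thesis by simp
qed

end

section \<open>Thick edges and families of parallel paths\<close>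

lemma l1_int_diff_axis:
  assumes "x $ a \<noteq> 0"
  shows "l1_int (x - axis a (sgn (x $ a))) = l1_int x - 1"
proof -
  let ?y = "x - axis a (sgn (x $ a))"
  have "l1_int ?y = \<bar>?y $ a\<bar> + (\<Sum>i\<in>UNIV - {a}. \<bar>?y $ i\<bar>)"
    unfolding l1_int_def by (rule sum.remove) auto
  also have "(\<Sum>i\<in>UNIV - {a}. \<bar>?y $ i\<bar>) = (\<Sum>i\<in>UNIV - {a}. \<bar>x $ i\<bar>)"
    by (intro sum.cong) (auto simp: axis_def)
  also have "\<bar>?y $ a\<bar> = \<bar>x $ a\<bar> - 1" using assms by (auto simp: axis_def sgn_if)
  also have "\<bar>x $ a\<bar> - 1 + (\<Sum>i\<in>UNIV - {a}. \<bar>x $ i\<bar>) = l1_int x - 1"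
    unfolding l1_int_def by (subst sum.remove[of UNIV a]) auto
  finally show ?thesis .
qed

lemma unit_int_vec_cases:
  assumes "l1_int v = 1"
  obtains a s where "v = axis a s" "\<bar>s\<bar> = 1"
proof -
  have "v \<noteq> 0" using assms by auto
  then obtain a where a: "v $ a \<noteq> 0" by (metis vec_eq_iff zero_index)
  have "v = axis a (sgn (v $ a))" using l1_int_diff_axis[OF a] assms by simp
  moreover have "\<bar>sgn (v $ a)\<bar> = 1" using a by (simp add: sgn_if)
  ultimately show ?thesis using that by blast
qed

text \<open>For a unit vector \<open>d\<close> this says that \<open>z' - z\<close> is orthogonal to
  \<open>d\<close>; translates along \<open>d\<close> of a path from \<open>z\<close> to
  \<open>z'\<close> can then be kept apart.\<close>

definition flat :: "int^'d \<Rightarrow> int^'d \<Rightarrow> int^'d \<Rightarrow> bool" where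
  "flat d z z' \<longleftrightarrow> (\<forall>a. d $ a \<noteq> 0 \<longrightarrow> z $ a = z' $ a)"

text \<open>The last clause keeps the path inside every coordinate hyperplane that contains both
  ends; together with \<open>flat\<close> it rules out any motion in the direction
  \<open>d\<close>.\<close>

definition geodesic :: "(nat \<Rightarrow> int^'d) \<Rightarrow> int^'d \<Rightarrow> int^'d \<Rightarrow> bool" where
  "geodesic p z z' \<longleftrightarrow> p 0 = z \<and> p (nat (l1_int (z' - z))) = z' \<and>
     (\<forall>i<nat (l1_int (z' - z)). l1_int (p (Suc i) - p i) = 1) \<and>
     (\<forall>a. z $ a = z' $ a \<longrightarrow> (\<forall>i\<le>nat (l1_int (z' - z)). p i $ a = z $ a))"

lemma geodesic_exists: "\<exists>p. geodesic p z z'"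
proof (induction "nat (l1_int (z' - z))" arbitrary: z)
  case 0
  then have "l1_int (z' - z) = 0" using l1_int_nonneg[of "z' - z"] by linarith
  then have "z' = z" by simp
  then show ?case by (intro exI[of _ "\<lambda>_. z"]) (auto simp: geodesic_def)
next
  case (Suc n)
  then have "z' - z \<noteq> 0" by auto
  then obtain a where a: "(z' - z) $ a \<noteq> 0" by (metis vec_eq_iff zero_index)
  define v where "v = axis a (sgn ((z' - z) $ a))"
  have v: "l1_int v = 1" using a by (simp add: v_def sgn_if)
  have l: "l1_int (z' - (z + v)) = l1_int (z' - z) - 1"
    using l1_int_diff_axis[OF a] by (simp add: v_def algebra_simps)
  then have n: "n = nat (l1_int (z' - (z + v)))" using Suc by linarith
  from Suc(1)[OF this] obtain p where p: "geodesic p (z + v) z'" by blast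
  have S: "nat (l1_int (z' - z)) = Suc n" using Suc by simp
  have p': "p 0 = z + v" "p n = z'" "\<And>i. i < n \<Longrightarrow> l1_int (p (Suc i) - p i) = 1"
    "\<And>a i. (z + v) $ a = z' $ a \<Longrightarrow> i \<le> n \<Longrightarrow> p i $ a = (z + v) $ a"
    using p unfolding geodesic_def n[symmetric] by blast+
  have "geodesic (case_nat z p) z z'"
    unfolding geodesic_def S
  proof (intro conjI allI impI)
    fix i assume "i < Suc n"
    then show "l1_int (case_nat z p (Suc i) - case_nat z p i) = 1"
      using p'(1,3) v by (cases i) auto
  next
    fix b i assume b: "z $ b = z' $ b" and i: "i \<le> Suc n"
    then have "b \<noteq> a" using a by auto
    then have vb: "v $ b = 0" by (simp add: v_def axis_def)
    show "case_nat z p i $ b = z $ b"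
    proof (cases i)
      case (Suc k)
      then show ?thesis using p'(4)[of b k] b vb i by simp
    qed simp
  qed (use p' in simp_all)
  then show ?case by blast
qed

definition geo :: "int^'d \<Rightarrow> int^'d \<Rightarrow> nat \<Rightarrow> int^'d" where
  "geo z z' = (SOME p. geodesic p z z')"

definition dst :: "int^'d \<Rightarrow> int^'d \<Rightarrow> nat" where
  "dst z z' = nat (l1_int (z' - z))"

lemma int_dst: "int (dst z z') = l1_int (z' - z)"
  by (simp add: dst_def)

lemma geo_geodesic: "geodesic (geo z z') z z'"
  unfolding geo_def using geodesic_exists by (rule someI_ex)

lemma geo_0 [simp]: "geo z z' 0 = z"
  using geo_geodesic[of z z'] by (simp add: geodesic_def)

lemma geo_end [simp]: "geo z z' (dst z z') = z'"
  using geo_geodesic[of z z'] by (simp add: geodesic_def dst_def)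

lemma geo_step: "i < dst z z' \<Longrightarrow> l1_int (geo z z' (Suc i) - geo z z' i) = 1"
  using geo_geodesic[of z z'] by (simp add: geodesic_def dst_def)

lemma geo_const: "z $ a = z' $ a \<Longrightarrow> i \<le> dst z z' \<Longrightarrow> geo z z' i $ a = z $ a"
  using geo_geodesic[of z z'] unfolding geodesic_def dst_def by blast

lemma geo_dist_le:
  assumes "i \<le> j" "j \<le> dst z z'"
  shows "l1_int (geo z z' j - geo z z' i) \<le> int (j - i)"
  using assms
proof (induction j rule: dec_induct)
  case (step j)
  then show ?case
    using l1_int_triangle_diff[of "geo z z' (Suc j)" "geo z z' i" "geo z z' j"] geo_step[of j z z'] by simp
qed auto

text \<open>Consecutive points are one unit apart, so each of three pieces spans at most its number
  of steps; as the total equals the distance of the ends, all three bounds are equalities. Hence no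
  point is visited twice (\<open>geo_inj\<close>).\<close>

lemma geo_dist:
  assumes "i \<le> j" "j \<le> dst z z'"
  shows "l1_int (geo z z' j - geo z z' i) = int (j - i)"
proof -
  have "int (dst z z') \<le> l1_int (geo z z' (dst z z') - geo z z' i) + l1_int (geo z z' i - geo z z' 0)"
    using l1_int_triangle_diff[of z' z "geo z z' i"] by (simp add: int_dst)
  moreover have "l1_int (geo z z' (dst z z') - geo z z' i) \<le> l1_int (geo z z' (dst z z') - geo z z' j) + l1_int (geo z z' j - geo z z' i)"
    by (rule l1_int_triangle_diff)
  moreover have "l1_int (geo z z' i - geo z z' 0) \<le> int i" using geo_dist_le[of 0 i z z'] assms by simp
  moreover have "l1_int (geo z z' (dst z z') - geo z z' j) \<le> int (dst z z' - j)" using assms by (intro geo_dist_le) auto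
  moreover have "l1_int (geo z z' j - geo z z' i) \<le> int (j - i)" by (intro geo_dist_le assms)
  ultimately show ?thesis using assms by linarith
qed

lemma geo_inj: "i \<le> dst z z' \<Longrightarrow> j \<le> dst z z' \<Longrightarrow> geo z z' i = geo z z' j \<Longrightarrow> i = j"
proof -
  assume a: "i \<le> dst z z'" "j \<le> dst z z'" "geo z z' i = geo z z' j"
  have "l1_int (geo z z' j - geo z z' i) = 0" "l1_int (geo z z' i - geo z z' j) = 0" using a(3) by simp_all
  then show "i = j" using geo_dist[of i j z z'] geo_dist[of j i z z'] a(1,2) by linarith
qed

text \<open>A thick edge may be crossed directly or by either of the two detours of length three in
  the direction \<open>d\<close>; three disjoint routes give its cost a finite moment of order \<open>5/4\<close>
  although a single edge weight need not have a finite mean.\<close>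

definition detour :: "int^'d \<Rightarrow> ((int^'d) set \<Rightarrow> real) \<Rightarrow> int^'d \<Rightarrow> int^'d \<Rightarrow> real" where
  "detour d W a b = \<bar>W {a, a + d}\<bar> + \<bar>W {a + d, b + d}\<bar> + \<bar>W {b + d, b}\<bar>"

definition sedge :: "bool \<Rightarrow> int^'d \<Rightarrow> ((int^'d) set \<Rightarrow> real) \<Rightarrow> int^'d \<Rightarrow> int^'d \<Rightarrow> real" where
  "sedge thick d W a b =
     (if thick then min \<bar>W {a, b}\<bar> (min (detour d W a b) (detour (- d) W a b)) else \<bar>W {a, b}\<bar>)"

definition sedge_edges :: "int^'d \<Rightarrow> int^'d \<Rightarrow> int^'d \<Rightarrow> (int^'d) set set" where
  "sedge_edges d a b = {{a, b}, {a, a + d}, {a + d, b + d}, {b + d, b}, {a, a + - d}, {a + - d, b + - d}, {b + - d, b}}"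

text \<open>The \<open>j\<close>-th parallel copy of the geodesic. A thick path extends one unit to
  either side in the direction \<open>d\<close>, so a spacing of four keeps the thickened copies
  vertex-disjoint.\<close>

definition fam_pt :: "int^'d \<Rightarrow> int^'d \<Rightarrow> int^'d \<Rightarrow> nat \<Rightarrow> nat \<Rightarrow> int^'d" where
  "fam_pt d z z' j i = geo z z' i + (4 * int j) *s d"

definition fam_cost :: "bool \<Rightarrow> int^'d \<Rightarrow> int^'d \<Rightarrow> int^'d \<Rightarrow> nat \<Rightarrow> ((int^'d) set \<Rightarrow> real) \<Rightarrow> real" where
  "fam_cost thick d z z' j W = (\<Sum>i<dst z z'. sedge thick d W (fam_pt d z z' j i) (fam_pt d z z' j (Suc i)))"

lemma sedge_nonneg: "0 \<le> sedge thick d W a b"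
  by (auto simp: sedge_def detour_def)

lemma fam_cost_nonneg: "0 \<le> fam_cost thick d z z' j W"
  unfolding fam_cost_def by (intro sum_nonneg sedge_nonneg)

lemma sedge_edges_lattice:
  "l1_int (b - a) = 1 \<Longrightarrow> l1_int d = 1 \<Longrightarrow> sedge_edges d a b \<subseteq> lattice_edges"
  unfolding sedge_edges_def using l1_int_diff_commute[of a b] by (simp add: edge_iff)

lemma local_on_sedge: "local_on (sedge_edges d a b) (\<lambda>W. sedge thick d W a b)"
  unfolding local_on_def sedge_def detour_def sedge_edges_def by simp

text \<open>Contains the ends of all seven edges of a thick edge; edge sets are separated by showing
  that these vertex sets are disjoint.\<close>

definition thick_vertices :: "int^'d \<Rightarrow> int^'d \<Rightarrow> int^'d \<Rightarrow> (int^'d) set" where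
  "thick_vertices d a b = {x + u *s d | x u. x \<in> {a, b} \<and> \<bar>u\<bar> \<le> 1}"

lemma sedge_edges_vertices: "e \<in> sedge_edges d a b \<Longrightarrow> e \<noteq> {} \<and> e \<subseteq> thick_vertices d a b"
proof -
  have *: "x + u *s d \<in> thick_vertices d a b" if "x \<in> {a, b}" "\<bar>u\<bar> \<le> 1" for x u
    using that unfolding thick_vertices_def by blast
  have "a \<in> thick_vertices d a b" "b \<in> thick_vertices d a b" using *[of a 0] *[of b 0] by simp_all
  moreover have "a + d \<in> thick_vertices d a b" "b + d \<in> thick_vertices d a b" using *[of a 1] *[of b 1] by simp_all
  moreover have "x + (-1) *s d = x + - d" for x by (simp add: vec_eq_iff)
  then have "a + - d \<in> thick_vertices d a b" "b + - d \<in> thick_vertices d a b" using *[of a "-1"] *[of b "-1"] by simp_all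
  moreover assume "e \<in> sedge_edges d a b"
  ultimately show ?thesis unfolding sedge_edges_def by blast
qed

lemma thick_vertices_disjoint_imp:
  assumes "thick_vertices d a b \<inter> thick_vertices d a' b' = {}"
  shows "sedge_edges d a b \<inter> sedge_edges d a' b' = {}"
proof (rule ccontr)
  assume "\<not> ?thesis"
  then obtain e where "e \<in> sedge_edges d a b" "e \<in> sedge_edges d a' b'" by blast
  from sedge_edges_vertices[OF this(1)] sedge_edges_vertices[OF this(2)] assms show False by blast
qed

lemma fam_step: "i < dst z z' \<Longrightarrow> l1_int (fam_pt d z z' j (Suc i) - fam_pt d z z' j i) = 1"
  by (simp add: fam_pt_def geo_step)

lemma fam_coord:
  assumes "flat d z z'" "d $ a \<noteq> 0" "i \<le> dst z z'"
  shows "fam_pt d z z' j i $ a = z $ a + 4 * int j * d $ a"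
  using assms geo_const[of z a z' i] by (auto simp: flat_def fam_pt_def)

text \<open>In the coordinate along \<open>d\<close>, counted from \<open>z\<close>, the vertices of
  copy \<open>j\<close> lie within one unit of level \<open>4 j\<close>, and these ranges are
  disjoint for distinct \<open>j\<close>.\<close>

lemma fam_disjoint_members:
  assumes d: "l1_int d = 1" and fl: "flat d z z'" and j: "j \<noteq> j'" and i: "i < dst z z'" "i' < dst z z'"
  shows "sedge_edges d (fam_pt d z z' j i) (fam_pt d z z' j (Suc i)) \<inter>
    sedge_edges d (fam_pt d z z' j' i') (fam_pt d z z' j' (Suc i')) = {}"
proof (rule thick_vertices_disjoint_imp, rule ccontr)
  assume "thick_vertices d (fam_pt d z z' j i) (fam_pt d z z' j (Suc i)) \<inter>
    thick_vertices d (fam_pt d z z' j' i') (fam_pt d z z' j' (Suc i')) \<noteq> {}"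
  then obtain k k' u u' where k: "k \<le> dst z z'" "k' \<le> dst z z'" and u: "\<bar>u\<bar> \<le> 1" "\<bar>u'\<bar> \<le> 1"
    and eq: "fam_pt d z z' j k + u *s d = fam_pt d z z' j' k' + u' *s d"
    using i unfolding thick_vertices_def by (fastforce simp: less_eq_Suc_le)
  obtain a s where s: "d = axis a s" "\<bar>s\<bar> = 1" using unit_int_vec_cases[OF d] by blast
  then have da: "d $ a = s" by simp
  have "fam_pt d z z' j k $ a + u * s = fam_pt d z z' j' k' $ a + u' * s"
    using arg_cong[OF eq, of "\<lambda>v. v $ a"] da by simp
  then have "(4 * int j + u) * s = (4 * int j' + u') * s"
    using fam_coord[OF fl _ k(1), of a j] fam_coord[OF fl _ k(2), of a j'] da s by (auto simp: algebra_simps)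
  then have "4 * int j + u = 4 * int j' + u'" using s by auto
  then show False using u j by presburger
qed

text \<open>A common vertex has one height along \<open>d\<close>, which determines its point on the
  geodesic, and the geodesic is injective. So only neighbouring steps can share a vertex.\<close>

lemma fam_disjoint_steps:
  assumes d: "l1_int d = 1" and fl: "flat d z z'" and i: "i < dst z z'" "i' < dst z z'" and far: "i' \<notin> {i - 1, i, i + 1}"
  shows "sedge_edges d (fam_pt d z z' j i) (fam_pt d z z' j (Suc i)) \<inter>
    sedge_edges d (fam_pt d z z' j i') (fam_pt d z z' j (Suc i')) = {}"
proof (rule thick_vertices_disjoint_imp, rule ccontr)
  assume "thick_vertices d (fam_pt d z z' j i) (fam_pt d z z' j (Suc i)) \<inter>
    thick_vertices d (fam_pt d z z' j i') (fam_pt d z z' j (Suc i')) \<noteq> {}"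
  then obtain k k' u u' where k: "k \<in> {i, Suc i}" "k' \<in> {i', Suc i'}"
    and eq: "fam_pt d z z' j k + u *s d = fam_pt d z z' j k' + u' *s d"
    unfolding thick_vertices_def by auto
  have kd: "k \<le> dst z z'" "k' \<le> dst z z'" using k i by auto
  obtain a s where s: "d = axis a s" "\<bar>s\<bar> = 1" using unit_int_vec_cases[OF d] by blast
  then have da: "d $ a = s" by simp
  have "fam_pt d z z' j k $ a + u * s = fam_pt d z z' j k' $ a + u' * s"
    using arg_cong[OF eq, of "\<lambda>v. v $ a"] da by simp
  then have "u * s = u' * s"
    using fam_coord[OF fl _ kd(1), of a j] fam_coord[OF fl _ kd(2), of a j] da s by auto
  then have "u = u'" using s by auto
  then have "geo z z' k = geo z z' k'" using eq by (simp add: fam_pt_def)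
  from geo_inj[OF kd this] show False using k far by auto
qed

definition fam_edges :: "int^'d \<Rightarrow> int^'d \<Rightarrow> int^'d \<Rightarrow> nat \<Rightarrow> (int^'d) set set" where
  "fam_edges d z z' j = (\<Union>i<dst z z'. sedge_edges d (fam_pt d z z' j i) (fam_pt d z z' j (Suc i)))"

lemma fam_edges_lattice: "l1_int d = 1 \<Longrightarrow> fam_edges d z z' j \<subseteq> lattice_edges"
  unfolding fam_edges_def by (intro UN_least sedge_edges_lattice fam_step) auto

lemma fam_edges_disjoint: "l1_int d = 1 \<Longrightarrow> flat d z z' \<Longrightarrow> j \<noteq> j' \<Longrightarrow> fam_edges d z z' j \<inter> fam_edges d z z' j' = {}"
  using fam_disjoint_members[of d z z' j j'] unfolding fam_edges_def by blast

lemma local_on_fam_cost: "local_on (fam_edges d z z' j) (\<lambda>W. fam_cost thick d z z' j W)"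
  unfolding local_on_def
proof (intro allI impI)
  fix W W' :: "(int^'a) set \<Rightarrow> real" assume *: "\<forall>e\<in>fam_edges d z z' j. W e = W' e"
  show "fam_cost thick d z z' j W = fam_cost thick d z z' j W'"
    unfolding fam_cost_def
  proof (intro sum.cong refl)
    fix i assume "i \<in> {..<dst z z'}"
    then show "sedge thick d W (fam_pt d z z' j i) (fam_pt d z z' j (Suc i)) = sedge thick d W' (fam_pt d z z' j i) (fam_pt d z z' j (Suc i))"
      using * by (intro local_onD[OF local_on_sedge]) (auto simp: fam_edges_def)
  qed
qed

section \<open>Tail estimates\<close>

text \<open>\<open>X powr (5/4)\<close> is at most the number of \<open>n\<close> with
  \<open>X powr (5/4) > n\<close>. For \<open>n > 0\<close> this is the event
  \<open>X > n powr (4/5)\<close>, whose probability has the exponent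
  \<open>(4/5) * (-3/2) = -6/5\<close>, which is summable.\<close>

lemma (in prob_space) nn_integral_powr_le_tail:
  fixes X :: "'a \<Rightarrow> real"
  assumes [measurable]: "X \<in> borel_measurable M" and X: "\<And>x. 0 \<le> X x"
    and tail: "\<And>s. s > 0 \<Longrightarrow> prob {x\<in>space M. X x > s} \<le> K * s powr (-3/2)"
    and K: "K \<ge> 0"
  shows "(\<integral>\<^sup>+x. ennreal (X x powr (5/4)) \<partial>M) \<le> ennreal (1 + K * (\<Sum>n. real n powr (-6/5)))"
proof -
  let ?A = "\<lambda>n. {x\<in>space M. X x powr (5/4) > real n}"
  have sm: "summable (\<lambda>n. real n powr (-6/5))" by (subst summable_real_powr_iff) simp
  have "ennreal (X x powr (5/4)) \<le> (\<Sum>n. indicator (?A n) x)" if x: "x \<in> space M" for x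
  proof -
    let ?N = "nat \<lceil>X x powr (5/4)\<rceil>"
    have "ennreal (X x powr (5/4)) \<le> of_nat ?N"
      unfolding ennreal_of_nat_eq_real_of_nat by (intro ennreal_leI) (simp add: real_nat_ceiling_ge)
    also have "of_nat ?N = (\<Sum>n<?N. indicator (?A n) x :: ennreal)"
    proof -
      have "real n < X x powr (5/4)" if "n < ?N" for n using that by linarith
      then have "(\<Sum>n<?N. indicator (?A n) x :: ennreal) = (\<Sum>n<?N. 1)"
        using x by (intro sum.cong refl) (auto simp: indicator_def)
      then show ?thesis by simp
    qed
    also have "\<dots> \<le> (\<Sum>n. indicator (?A n) x)" by (intro sum_le_suminf) auto
    finally show ?thesis .
  qed
  then have "(\<integral>\<^sup>+x. ennreal (X x powr (5/4)) \<partial>M) \<le> (\<integral>\<^sup>+x. (\<Sum>n. indicator (?A n) x) \<partial>M)"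
    by (intro nn_integral_mono)
  also have "\<dots> = (\<Sum>n. emeasure M (?A n))" by (subst nn_integral_suminf) auto
  \<comment> \<open>The term \<open>n = 0\<close> has probability at most \<open>1\<close>; since
    \<open>0 powr (-6/5)\<close> is \<open>0\<close>, it gets a summand of its own.\<close>
  also have "\<dots> \<le> (\<Sum>n. ennreal ((if n = 0 then 1 else 0) + K * real n powr (-6/5)))"
  proof (intro suminf_le allI)
    fix n
    show "emeasure M (?A n) \<le> ennreal ((if n = 0 then 1 else 0) + K * real n powr (-6/5))"
    proof (cases "n = 0")
      case True
      have "emeasure M (?A n) \<le> 1" by (rule emeasure_le_1)
      then show ?thesis using True by simp
    next
      case False
      then have n: "real n > 0" by simp
      have "?A n \<subseteq> {x\<in>space M. X x > real n powr (4/5)}"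
      proof safe
        fix x assume "real n < X x powr (5/4)"
        then have "real n powr (4/5) < (X x powr (5/4)) powr (4/5)" by (intro powr_less_mono2) auto
        then show "real n powr (4/5) < X x" using X[of x] by (simp add: powr_powr)
      qed
      then have "prob (?A n) \<le> prob {x\<in>space M. X x > real n powr (4/5)}" by (intro finite_measure_mono) auto
      also have "\<dots> \<le> K * (real n powr (4/5)) powr (-3/2)" using n by (intro tail) simp
      also have "(real n powr (4/5)) powr (-3/2) = real n powr (-6/5)" by (simp add: powr_powr)
      finally show ?thesis using False by (simp add: emeasure_eq_measure ennreal_leI)
    qed
  qed auto
  also have "\<dots> = ennreal (1 + K * (\<Sum>n. real n powr (-6/5)))"
  proof (rule suminf_ennreal_eq)
    have "(\<lambda>n. if n = 0 then 1 else 0 :: real) sums 1" using sums_single[of 0 "\<lambda>_. 1::real"] by simp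
    moreover have "(\<lambda>n. K * real n powr (-6/5)) sums (K * (\<Sum>n. real n powr (-6/5)))"
      using sm by (intro sums_mult summable_sums)
    ultimately show "(\<lambda>n. (if n = 0 then 1 else 0) + K * real n powr (-6/5)) sums (1 + K * (\<Sum>n. real n powr (-6/5)))"
      by (rule sums_add)
  qed (use K in auto)
  finally show ?thesis .
qed

context iid_env begin

section \<open>Power tails of single edges, thick edges and thick paths\<close>

definition edge_tail :: "real \<Rightarrow> real" where "edge_tail s = measure \<nu> {x. \<bar>x\<bar> > s}"

lemma prob_edge_gt:
  assumes e: "e \<in> lattice_edges"
  shows "P.prob {W\<in>space P. \<bar>W e\<bar> > s} = edge_tail s"
proof -
  interpret pp: product_prob_space "\<lambda>_. \<nu>" "lattice_edges :: (int^'d) set set"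
    using prob_nu by (auto simp: product_prob_space_def product_prob_space_axioms_def product_sigma_finite_def prob_space_imp_sigma_finite)
  have "{x::real. \<bar>x\<bar> > s} \<in> sets \<nu>" unfolding sets_nu by measurable
  from pp.emeasure_PiM_Collect_single[OF e this] show ?thesis
    unfolding edge_tail_def measure_def by (simp add: P_def)
qed

lemma edge_tail_nonneg: "0 \<le> edge_tail s" by (simp add: edge_tail_def)

text \<open>All \<open>2d\<close> independent copies exceed \<open>s\<close> with probability
  \<open>edge_tail s ^ (2d)\<close>. Markov's inequality for the \<open>d\<close>-th power of their
  minimum bounds this by \<open>m / s^d\<close>, and the \<open>2d\<close>-th root gives an exponent
  that does not depend on \<open>d\<close>.\<close>

lemma edge_tail_le: "\<exists>K\<ge>0. \<forall>s>0. edge_tail s \<le> K * s powr (-1/2)"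
proof -
  let ?N = "2 * CARD('d)" let ?I = "{..<?N}"
  let ?Q = "PiM ?I (\<lambda>_. \<nu>)"
  define m where "m = enn2real (\<integral>\<^sup>+ y. ennreal ((Min ((\<lambda>i. \<bar>y i\<bar>) ` ?I)) ^ CARD('d)) \<partial>?Q)"
  have m: "(\<integral>\<^sup>+ y. ennreal ((Min ((\<lambda>i. \<bar>y i\<bar>) ` ?I)) ^ CARD('d)) \<partial>?Q) = ennreal m"
    unfolding m_def using mom by (simp add: ennreal_enn2real_if less_top)
  have m0: "m \<ge> 0" by (simp add: m_def)
  have N0: "?N > 0" by simp
  interpret pp: product_prob_space "\<lambda>_. \<nu>" ?I
    using prob_nu by (auto simp: product_prob_space_def product_prob_space_axioms_def product_sigma_finite_def prob_space_imp_sigma_finite)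
  have "edge_tail s \<le> root ?N m * s powr (-1/2)" if s: "s > 0" for s
  proof -
    let ?A = "{x::real. \<bar>x\<bar> > s}"
    have A: "?A \<in> sets \<nu>" unfolding sets_nu by measurable
    let ?B = "{y\<in>space ?Q. \<forall>i\<in>?I. y i \<in> ?A}"
    have B: "?B \<in> sets ?Q" using A by measurable
    have "emeasure ?Q ?B = (\<Prod>i\<in>?I. emeasure \<nu> ?A)" using A by (intro pp.emeasure_PiM_Collect) auto
    also have "\<dots> = ennreal (edge_tail s ^ ?N)"
      using prob_space.finite_measure[OF prob_nu] by (simp add: edge_tail_def finite_measure.emeasure_eq_measure ennreal_power)
    finally have eq: "emeasure ?Q ?B = ennreal (edge_tail s ^ ?N)" .
    have "ennreal (s ^ CARD('d)) * emeasure ?Q ?B = (\<integral>\<^sup>+y. ennreal (s ^ CARD('d)) * indicator ?B y \<partial>?Q)"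
      using B by (simp add: nn_integral_cmult_indicator)
    also have "\<dots> \<le> (\<integral>\<^sup>+ y. ennreal ((Min ((\<lambda>i. \<bar>y i\<bar>) ` ?I)) ^ CARD('d)) \<partial>?Q)"
    proof (intro nn_integral_mono)
      fix y :: "nat \<Rightarrow> real"
      show "ennreal (s ^ CARD('d)) * indicator ?B y \<le> ennreal ((Min ((\<lambda>i. \<bar>y i\<bar>) ` ?I)) ^ CARD('d))"
      proof (cases "y \<in> ?B")
        case True
        then have "\<forall>x\<in>(\<lambda>i. \<bar>y i\<bar>) ` ?I. s \<le> x" by (auto intro: less_imp_le)
        moreover have "(\<lambda>i. \<bar>y i\<bar>) ` ?I \<noteq> {}" using N0 by blast
        ultimately have "s \<le> Min ((\<lambda>i. \<bar>y i\<bar>) ` ?I)" by (intro Min.boundedI) auto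
        then have "s ^ CARD('d) \<le> Min ((\<lambda>i. \<bar>y i\<bar>) ` ?I) ^ CARD('d)" using s by (intro power_mono) auto
        then show ?thesis using True by (simp add: ennreal_leI)
      qed simp
    qed
    finally have "ennreal (s ^ CARD('d) * edge_tail s ^ ?N) \<le> ennreal m"
      unfolding eq m using s by (simp add: ennreal_mult' edge_tail_nonneg)
    then have 1: "s ^ CARD('d) * edge_tail s ^ ?N \<le> m" using m0 by (simp add: ennreal_le_iff)
    have "(root ?N m * s powr (-1/2)) ^ ?N = m * (s powr (-1/2)) ^ ?N"
      using m0 N0 by (simp add: power_mult_distrib real_root_pow_pos2)
    also have "(s powr (-1/2)) ^ ?N = s powr (- real CARD('d))"
      using s by (simp add: powr_power)
    also have "\<dots> = 1 / s ^ CARD('d)" using s by (simp add: powr_minus powr_realpow divide_inverse)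
    finally have "(root ?N m * s powr (-1/2)) ^ ?N = m / s ^ CARD('d)" by simp
    moreover have "edge_tail s ^ ?N \<le> m / s ^ CARD('d)" using 1 s by (simp add: field_simps)
    ultimately have "edge_tail s ^ ?N \<le> (root ?N m * s powr (-1/2)) ^ ?N" by simp
    then show ?thesis by (rule power_le_imp_le_base[of _ "?N - 1", simplified Suc_diff_1[OF N0]])
       (use m0 N0 in simp)
  qed
  moreover have "root ?N m \<ge> 0" using m0 N0 by simp
  ultimately show ?thesis by blast
qed

lemma measurable_detour:
  assumes "l1_int (b - a) = 1" "l1_int d = 1"
  shows "(\<lambda>W. detour d W a b) \<in> borel_measurable P"
  using assms l1_int_diff_commute[of a b] unfolding detour_def
  by (intro borel_measurable_add borel_measurable_abs measurable_edge) (auto simp: edge_iff)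

lemma measurable_sedge:
  assumes "l1_int (b - a) = 1" "l1_int d = 1"
  shows "(\<lambda>W. sedge thick d W a b) \<in> borel_measurable P"
proof -
  have 1: "(\<lambda>W. \<bar>W {a, b}\<bar>) \<in> borel_measurable P"
    using assms l1_int_diff_commute[of a b] by (intro borel_measurable_abs measurable_edge) (auto simp: edge_iff)
  show ?thesis unfolding sedge_def using 1 measurable_detour[OF assms] measurable_detour[of b a "- d"] assms
    by (cases thick) auto
qed

lemma measurable_fam_cost [measurable]:
  assumes "l1_int d = 1"
  shows "(\<lambda>W. fam_cost thick d z z' j W) \<in> borel_measurable P"
  unfolding fam_cost_def using assms by (intro borel_measurable_sum measurable_sedge fam_step) auto

lemma detour_tail:
  assumes u: "l1_int (b - a) = 1" "l1_int d = 1"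
  shows "P.prob {W\<in>space P. detour d W a b > s} \<le> 3 * edge_tail (s / 3)"
proof -
  have e: "{a, a + d} \<in> lattice_edges" "{a + d, b + d} \<in> lattice_edges" "{b + d, b} \<in> lattice_edges"
    using u l1_int_diff_commute[of a b] by (auto simp: edge_iff)
  let ?E = "\<lambda>e. {W\<in>space P. \<bar>W e\<bar> > s / 3}"
  have m: "?E e \<in> sets P" if "e \<in> lattice_edges" for e
    using measurable_edge[OF that] by measurable
  have "P.prob {W\<in>space P. detour d W a b > s} \<le> P.prob (?E {a, a + d} \<union> ?E {a + d, b + d} \<union> ?E {b + d, b})"
    using m e by (intro P.finite_measure_mono) (auto simp: detour_def)
  also have "\<dots> \<le> P.prob (?E {a, a + d}) + P.prob (?E {a + d, b + d}) + P.prob (?E {b + d, b})"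
    using measure_Un_le[of "?E {a, a + d} \<union> ?E {a + d, b + d}" P "?E {b + d, b}"]
      measure_Un_le[of "?E {a, a + d}" P "?E {a + d, b + d}"] m e by auto
  also have "\<dots> = 3 * edge_tail (s / 3)" unfolding e[THEN prob_edge_gt] by simp
  finally show ?thesis .
qed

text \<open>The direct edge and the two detours use disjoint edge sets, so their costs are
  independent. A detour of three edges costs more than \<open>s\<close> only if one of them costs
  more than \<open>s / 3\<close>.\<close>

lemma thick_edge_tail:
  assumes u: "l1_int (b - a) = 1" "l1_int d = 1" "flat d a b" and s: "s > 0"
  shows "P.prob {W\<in>space P. sedge True d W a b > s} \<le> (3 * edge_tail (s / 3)) ^ 3"
proof -
  define Q where "Q k W \<longleftrightarrow> (if k = 0 then \<bar>W {a, b}\<bar> > s else if k = 1 then detour d W a b > s else detour (- d) W a b > s)"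
    for k :: nat and W
  define R where "R k = (if k = 0 then {{a, b}} else if k = 1 then {{a, a + d}, {a + d, b + d}, {b + d, b}}
     else {{a, a + - d}, {a + - d, b + - d}, {b + - d, b}})" for k :: nat
  have ab: "{a, b} \<in> lattice_edges" using u l1_int_diff_commute[of a b] by (simp add: edge_iff)
  obtain c t where c: "d = axis c t" "\<bar>t\<bar> = 1" using unit_int_vec_cases[OF u(2)] by blast
  then have dc: "d $ c = t" "t \<noteq> 0" by auto
  then have abc: "a $ c = b $ c" using u(3) by (auto simp: flat_def)
  \<comment> \<open>Along the axis \<open>c\<close> of \<open>d\<close> the direct edge stays at
    level \<open>a $ c\<close>, whereas every edge of a detour touches the level
    \<open>a $ c + t\<close> or \<open>a $ c - t\<close>, respectively; this separates the three
    routes.\<close>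
  have R1: "\<exists>v\<in>e. v $ c = a $ c + t" "\<forall>v\<in>e. v $ c \<in> {a $ c, a $ c + t}" if "e \<in> R 1" for e
    using that abc dc by (auto simp: R_def)
  have R2: "\<exists>v\<in>e. v $ c = a $ c - t" "\<forall>v\<in>e. v $ c \<in> {a $ c, a $ c - t}" if "e \<in> R 2" for e
    using that abc dc by (auto simp: R_def)
  have R0: "\<forall>v\<in>e. v $ c = a $ c" if "e \<in> R 0" for e using that abc by (auto simp: R_def)
  have d01: "R 0 \<inter> R 1 = {}" using R0 R1 dc by fastforce
  have d02: "R 0 \<inter> R 2 = {}" using R0 R2 dc by fastforce
  have d12: "R 1 \<inter> R 2 = {}"
  proof (rule ccontr)
    assume "R 1 \<inter> R 2 \<noteq> {}"
    then obtain e where e: "e \<in> R 1" "e \<in> R 2" by blast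
    obtain v where "v \<in> e" "v $ c = a $ c + t" using R1(1)[OF e(1)] by blast
    then show False using R2(2)[OF e(2)] dc by fastforce
  qed
  have "P.prob {W\<in>space P. sedge True d W a b > s} = P.prob {W\<in>space P. \<forall>k\<in>{0,1,2}. Q k W}"
    by (intro arg_cong[where f=P.prob]) (auto simp: Q_def sedge_def)
  also have "\<dots> = (\<Prod>k\<in>{0,1,2}. P.prob {W\<in>space P. Q k W})"
  proof (rule prob_all_local[where E=R])
    show "R k \<subseteq> lattice_edges" if "k \<in> {0,1,2}" for k
      using u ab l1_int_diff_commute[of a b] by (auto simp: R_def edge_iff)
    show "disjoint_family_on R {0, 1, 2}"
      using d01 d02 d12 by (auto simp: disjoint_family_on_def)
    show "Measurable.pred P (Q k)" for k
      unfolding Q_def using measurable_edge[OF ab] measurable_detour[OF u(1,2)] measurable_detour[of b a "- d"] u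
      by (cases "k = 0"; cases "k = 1") simp_all
    show "local_on (R k) (Q k)" for k
      unfolding local_on_def Q_def R_def detour_def by simp
  qed simp
  also have "\<dots> = P.prob {W\<in>space P. Q 0 W} * (P.prob {W\<in>space P. Q 1 W} * P.prob {W\<in>space P. Q 2 W})" by simp
  also have "\<dots> \<le> (3 * edge_tail (s / 3)) * ((3 * edge_tail (s / 3)) * (3 * edge_tail (s / 3)))"
  proof (intro mult_mono)
    have "edge_tail s \<le> edge_tail (s / 3)" unfolding edge_tail_def
      using s prob_space.finite_measure[OF prob_nu]
      by (intro finite_measure.finite_measure_mono) (auto simp: sets_nu)
    then show "P.prob {W\<in>space P. Q 0 W} \<le> 3 * edge_tail (s / 3)"
      using prob_edge_gt[OF ab, of s] edge_tail_nonneg[of "s / 3"] by (simp add: Q_def)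
    show "P.prob {W\<in>space P. Q 1 W} \<le> 3 * edge_tail (s / 3)" using detour_tail[OF u(1,2)] by (simp add: Q_def)
    show "P.prob {W\<in>space P. Q 2 W} \<le> 3 * edge_tail (s / 3)" using detour_tail[of b a "- d"] u by (simp add: Q_def)
  qed (auto simp: edge_tail_nonneg)
  finally show ?thesis by (simp add: power3_eq_cube)
qed

lemma thick_edge_tail_powr:
  "\<exists>K\<ge>0. \<forall>a b d s. l1_int (b - a :: int^'d) = 1 \<longrightarrow> l1_int d = 1 \<longrightarrow> flat d a b \<longrightarrow> s > 0 \<longrightarrow>
     P.prob {W\<in>space P. sedge True d W a b > s} \<le> K * s powr (-3/2)"
proof -
  obtain K where K: "K \<ge> 0" "\<And>s. s > 0 \<Longrightarrow> edge_tail s \<le> K * s powr (-1/2)" using edge_tail_le by blast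
  define K' where "K' = (3 * K * (1/3) powr (-1/2)) ^ 3"
  have "P.prob {W\<in>space P. sedge True d W a b > s} \<le> K' * s powr (-3/2)"
    if "l1_int (b - a :: int^'d) = 1" "l1_int d = 1" "flat d a b" "s > 0" for a b d s
  proof -
    have "P.prob {W\<in>space P. sedge True d W a b > s} \<le> (3 * edge_tail (s / 3)) ^ 3" by (rule thick_edge_tail[OF that])
    also have "\<dots> \<le> (3 * (K * (s / 3) powr (-1/2))) ^ 3"
      using K(2)[of "s / 3"] that(4) by (intro power_mono mult_left_mono) (auto simp: edge_tail_nonneg)
    also have "(s / 3) powr (-1/2) = (1/3) powr (-1/2) * s powr (-1/2)"
      using that(4) powr_mult[of "1/3" s "-1/2"] by simp
    also have "(3 * (K * ((1/3) powr (-1/2) * s powr (-1/2)))) ^ 3 = K' * (s powr (-1/2)) ^ 3"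
      unfolding K'_def by (simp only: power_mult_distrib mult.assoc)
    also have "(s powr (-1/2)) ^ 3 = s powr (-3/2)" using that(4) by (simp add: powr_power)
    finally show ?thesis .
  qed
  moreover have "K' \<ge> 0" using K by (simp add: K'_def)
  ultimately show ?thesis by blast
qed

text \<open>Truncation at \<open>L = l\<close>. A moment of order \<open>5/4\<close> bounds the
  second moment of a truncated cost by \<open>m * L powr (3/4)\<close>; Chebyshev's inequality, with
  only neighbouring steps dependent, then fails with probability \<open>O(L powr (-1/4))\<close>,
  and by the union bound some cost is truncated with at most such a probability.\<close>

lemma thick_chain_tail:
  "\<exists>C K. C > 0 \<and> K \<ge> 0 \<and> (\<forall>d z z' j l. l1_int (d::int^'d) = 1 \<longrightarrow> flat d z z' \<longrightarrow> l \<ge> 1 \<longrightarrow> dst z z' \<le> l \<longrightarrow>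
     P.prob {W\<in>space P. fam_cost True d z z' j W \<ge> C * real l} \<le> K * real l powr (-1/4))"
proof -
  obtain K where K: "K \<ge> 0" "\<And>a b d s. l1_int (b - a :: int^'d) = 1 \<Longrightarrow> l1_int d = 1 \<Longrightarrow> flat d a b \<Longrightarrow> s > 0 \<Longrightarrow>
     P.prob {W\<in>space P. sedge True d W a b > s} \<le> K * s powr (-3/2)"
    using thick_edge_tail_powr by blast
  define m where "m = 1 + K * (\<Sum>n. real n powr (-6/5))"
  have m1: "m \<ge> 1" using K(1) by (auto simp: m_def summable_real_powr_iff intro!: mult_nonneg_nonneg suminf_nonneg)
  have main: "P.prob {W\<in>space P. fam_cost True d z z' j W \<ge> (m + 2) * real l} \<le> (K + 3 * m) * real l powr (-1/4)"
    if d: "l1_int d = 1" and fl: "flat d z z'" and l: "l \<ge> 1" and dl: "dst z z' \<le> l" for d z z' :: "int^'d" and j l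
  proof -
    let ?I = "{..<dst z z'}"
    define L where "L = real l"
    have L: "L \<ge> 1" using l by (simp add: L_def)
    define X where "X i W = sedge True d W (fam_pt d z z' j i) (fam_pt d z z' j (Suc i))" for i W
    define Y where "Y i W = min (X i W) L" for i W
    have Xm[measurable]: "X i \<in> borel_measurable P" if "i \<in> ?I" for i
      unfolding X_def using that by (intro measurable_sedge fam_step d) auto
    have Ym: "Y i \<in> borel_measurable P" if "i \<in> ?I" for i
      unfolding Y_def using Xm[OF that] by measurable
    have X0: "0 \<le> X i W" for i W by (simp add: X_def sedge_nonneg)
    have Y0: "0 \<le> Y i W" "Y i W \<le> L" "Y i W \<le> X i W" for i W using X0 L by (auto simp: Y_def)
    have flp: "flat d (fam_pt d z z' j i) (fam_pt d z z' j (Suc i))" if "i \<in> ?I" for i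
      using that fam_coord[OF fl, of _ i j] fam_coord[OF fl, of _ "Suc i" j] by (auto simp: flat_def)
    have tail: "P.prob {W\<in>space P. X i W > s} \<le> K * s powr (-3/2)" if "i \<in> ?I" "s > 0" for i s
      unfolding X_def using that by (intro K(2) fam_step flp d) auto
    have nn: "(\<integral>\<^sup>+W. ennreal (X i W powr (5/4)) \<partial>P) \<le> ennreal m" if i: "i \<in> ?I" for i
      unfolding m_def by (rule P.nn_integral_powr_le_tail[OF Xm[OF i] X0 tail[OF i] K(1)])
    have Xi: "integrable P (\<lambda>W. X i W powr (5/4))" if i: "i \<in> ?I" for i
      using Xm[OF i] nn[OF i] by (intro integrableI_bounded) (auto simp: less_top[symmetric] top_unique)
    have Xe: "P.expectation (\<lambda>W. X i W powr (5/4)) \<le> m" if i: "i \<in> ?I" for i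
      using nn[OF i] Xi[OF i] m1 by (simp add: nn_integral_eq_integral)
    have Yb: "integrable P (Y i)" if i: "i \<in> ?I" for i
      using Ym[OF i] Y0 L by (intro P.integrable_const_bound[where B=L]) auto
    have Y2: "integrable P (\<lambda>W. (Y i W)\<^sup>2)" if i: "i \<in> ?I" for i
    proof (intro P.integrable_const_bound[where B="L\<^sup>2"] AE_I2)
      show "norm ((Y i W)\<^sup>2) \<le> L\<^sup>2" for W using Y0[of i W] by (simp add: power_mono)
      show "(\<lambda>W. (Y i W)\<^sup>2) \<in> borel_measurable P" using Ym[OF i] by measurable
    qed
    have Ye: "P.expectation (Y i) \<le> m + 1" if i: "i \<in> ?I" for i
    proof -
      have "P.expectation (Y i) \<le> P.expectation (\<lambda>W. X i W powr (5/4) + 1)"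
      proof (rule integral_mono)
        fix W
        show "Y i W \<le> X i W powr (5/4) + 1"
        proof (cases "X i W \<le> 1")
          case False
          then have "X i W powr 1 \<le> X i W powr (5/4)" by (intro powr_mono) auto
          then show ?thesis using Y0(3)[of i W] X0[of i W] False by simp
        qed (use Y0(3)[of i W] in \<open>smt (verit) powr_ge_zero\<close>)
      qed (use Yb Xi i in auto)
      also have "\<dots> \<le> m + 1" using Xi[OF i] Xe[OF i] by (simp add: P.prob_space)
      finally show ?thesis .
    qed
    \<comment> \<open>One splits \<open>Y^2 = Y powr (3/4) * Y powr (5/4)\<close> and uses
      \<open>Y \<le> L\<close> in the first factor, \<open>Y \<le> X\<close> in the second.\<close>
    have Ys: "P.expectation (\<lambda>W. (Y i W)\<^sup>2) \<le> L powr (3/4) * m" if i: "i \<in> ?I" for i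
    proof -
      have "P.expectation (\<lambda>W. (Y i W)\<^sup>2) \<le> P.expectation (\<lambda>W. L powr (3/4) * X i W powr (5/4))"
      proof (rule integral_mono)
        fix W
        have "(Y i W)\<^sup>2 = Y i W powr 2" using Y0(1)[of i W] by simp
        also have "\<dots> = Y i W powr (3/4 + 5/4)" by simp
        also have "\<dots> = Y i W powr (3/4) * Y i W powr (5/4)" by (rule powr_add)
        also have "\<dots> \<le> L powr (3/4) * X i W powr (5/4)"
          using Y0[of i W] by (intro mult_mono powr_mono2) auto
        finally show "(Y i W)\<^sup>2 \<le> L powr (3/4) * X i W powr (5/4)" .
      qed (use Y2 Xi i in auto)
      also have "\<dots> \<le> L powr (3/4) * m" using Xi[OF i] Xe[OF i] by (auto intro!: mult_left_mono)
      finally show ?thesis .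
    qed
    let ?A = "{W\<in>space P. (\<Sum>i\<in>?I. Y i W) \<ge> (\<Sum>i\<in>?I. P.expectation (Y i)) + L}"
    \<comment> \<open>At \<open>i = 0\<close> the truncated subtraction \<open>i - 1\<close> gives
      \<open>0\<close>, so the neighbourhood is \<open>{0, 1}\<close>; in every case it has at most
      three elements.\<close>
    have "P.prob ?A \<le> real (card ?I) * real 3 * (L powr (3/4) * m) / L\<^sup>2"
    proof (rule P.local_dependence_chebyshev[where N="\<lambda>i. {i - 1, i, i + 1}"])
      fix i i' assume i: "i \<in> ?I" "i' \<in> ?I" "i' \<notin> {i - 1, i, i + 1}"
      show "P.expectation (\<lambda>x. Y i x * Y i' x) = P.expectation (Y i) * P.expectation (Y i')"
      proof (rule expectation_mult_local)
        let ?S = "\<lambda>i. sedge_edges d (fam_pt d z z' j i) (fam_pt d z z' j (Suc i))"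
        show "?S i \<subseteq> lattice_edges" "?S i' \<subseteq> lattice_edges"
          using i by (intro sedge_edges_lattice fam_step d; simp)+
        show "?S i \<inter> ?S i' = {}" using i by (intro fam_disjoint_steps d fl) auto
        show "local_on (?S i) (Y i)" "local_on (?S i') (Y i')"
          using local_on_sedge unfolding Y_def X_def local_on_def by metis+
      qed (use Yb i in auto)
    next
      fix i
      have "card ({i - 1, i, i + 1} \<inter> ?I) \<le> card {i - 1, i, i + 1}" by (intro card_mono) auto
      also have "\<dots> \<le> 3" by (simp add: card_insert_if)
      finally show "card ({i - 1, i, i + 1} \<inter> ?I) \<le> 3" .
    qed (use Ym Y2 Ys L in auto)
    also have "\<dots> \<le> L * 3 * (L powr (3/4) * m) / L\<^sup>2"
      using dl m1 L by (intro divide_right_mono mult_right_mono) (auto simp: L_def)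
    also have "\<dots> = 3 * m * L powr (-1/4)"
    proof -
      have "L * L powr (3/4) / L\<^sup>2 = L powr (1 + 3/4 - 2)"
        using L by (simp only: powr_diff powr_add) simp
      moreover have "L * 3 * (L powr (3/4) * m) / L\<^sup>2 = 3 * m * (L * L powr (3/4) / L\<^sup>2)" by simp
      ultimately show ?thesis by simp
    qed
    finally have A: "P.prob ?A \<le> 3 * m * L powr (-1/4)" .
    let ?B = "\<Union>i\<in>?I. {W\<in>space P. X i W > L}"
    have "P.prob ?B \<le> (\<Sum>i\<in>?I. P.prob {W\<in>space P. X i W > L})"
      by (intro measure_UNION_le) (auto intro!: measurable_sets_Collect simp: Xm)
    also have "\<dots> \<le> (\<Sum>i\<in>?I. K * L powr (-3/2))" using L by (intro sum_mono tail) auto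
    also have "\<dots> \<le> L * (K * L powr (-3/2))" using dl K by (auto simp: L_def intro!: mult_right_mono)
    also have "\<dots> = K * L powr (1 - 3/2)" using L by (simp only: powr_add powr_diff) (simp add: powr_minus field_simps)
    also have "\<dots> \<le> K * L powr (-1/4)" using K L by (intro mult_left_mono powr_mono) auto
    finally have B: "P.prob ?B \<le> K * L powr (-1/4)" .
    \<comment> \<open>Off both events nothing is truncated and the total is below
      \<open>(m + 1) L + L\<close>, the means plus the deviation; hence the constant
      \<open>m + 2\<close>.\<close>
    have "{W\<in>space P. fam_cost True d z z' j W \<ge> (m + 2) * L} \<subseteq> ?A \<union> ?B"
    proof safe
      fix W assume W: "W \<in> space P" "(m + 2) * L \<le> fam_cost True d z z' j W" "W \<notin> ?B"
      then have "Y i W = X i W" if "i \<in> ?I" for i using that by (auto simp: Y_def not_less)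
      then have "(\<Sum>i\<in>?I. Y i W) = fam_cost True d z z' j W"
        unfolding fam_cost_def X_def by (intro sum.cong) auto
      moreover have "(\<Sum>i\<in>?I. P.expectation (Y i)) \<le> (\<Sum>i\<in>?I. m + 1)" using Ye by (intro sum_mono) auto
      moreover have "(\<Sum>i\<in>?I. m + 1) \<le> (m + 1) * L" using dl m1 by (simp add: L_def mult.commute)
      ultimately show "(\<Sum>i\<in>?I. P.expectation (Y i)) + L \<le> (\<Sum>i\<in>?I. Y i W)"
        using W(2) by (simp add: algebra_simps)
    qed
    moreover have AS: "?A \<in> sets P" "?B \<in> sets P"
    proof -
      have "(\<lambda>W. \<Sum>i\<in>?I. Y i W) \<in> borel_measurable P" using Ym by (intro borel_measurable_sum) auto
      then show "?A \<in> sets P" by measurable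
      have "{W\<in>space P. X i W > L} \<in> sets P" if "i \<in> ?I" for i using Xm[OF that] by measurable
      then show "?B \<in> sets P" by (intro sets.finite_UN) auto
    qed
    ultimately have "P.prob {W\<in>space P. fam_cost True d z z' j W \<ge> (m + 2) * L} \<le> P.prob (?A \<union> ?B)"
      by (intro P.finite_measure_mono sets.Un)
    also have "\<dots> \<le> P.prob ?A + P.prob ?B" using AS by (rule measure_Un_le)
    also have "\<dots> \<le> (K + 3 * m) * L powr (-1/4)" using A B by (simp add: algebra_simps)
    finally show ?thesis by (simp add: L_def)
  qed
  show ?thesis
    by (rule exI[of _ "m + 2"], rule exI[of _ "K + 3 * m"]) (use main m1 K(1) in auto)
qed

definition bad_family :: "bool \<Rightarrow> nat \<Rightarrow> real \<Rightarrow> int^'d \<Rightarrow> int^'d \<Rightarrow> int^'d \<Rightarrow> ((int^'d) set \<Rightarrow> real) \<Rightarrow> bool" where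
  "bad_family thick J B d z z' W \<longleftrightarrow> (\<forall>j\<in>{1..J}. fam_cost thick d z z' j W \<ge> B)"

text \<open>The \<open>J\<close> parallel copies use disjoint edges, so their failures are
  independent and the bound for one copy is raised to the power \<open>J\<close>.\<close>

lemma thick_family_tail:
  "\<exists>C K. C > 0 \<and> K \<ge> 0 \<and> (\<forall>d z z' l J. l1_int (d::int^'d) = 1 \<longrightarrow> flat d z z' \<longrightarrow> l \<ge> 1 \<longrightarrow> dst z z' \<le> l \<longrightarrow>
     P.prob {W\<in>space P. bad_family True J (C * real l) d z z' W} \<le> (K * real l powr (-1/4)) ^ J)"
proof -
  obtain C K where CK: "C > 0" "K \<ge> 0" "\<And>d z z' j l. l1_int (d::int^'d) = 1 \<Longrightarrow> flat d z z' \<Longrightarrow> l \<ge> 1 \<Longrightarrow> dst z z' \<le> l \<Longrightarrow>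
     P.prob {W\<in>space P. fam_cost True d z z' j W \<ge> C * real l} \<le> K * real l powr (-1/4)"
    using thick_chain_tail by blast
  have "P.prob {W\<in>space P. bad_family True J (C * real l) d z z' W} \<le> (K * real l powr (-1/4)) ^ J"
    if d: "l1_int d = 1" and fl: "flat d z z'" and l: "l \<ge> 1" and dl: "dst z z' \<le> l" for d z z' :: "int^'d" and l J
  proof -
    have "P.prob {W\<in>space P. bad_family True J (C * real l) d z z' W}
      = (\<Prod>j\<in>{1..J}. P.prob {W\<in>space P. fam_cost True d z z' j W \<ge> C * real l})"
      unfolding bad_family_def
    proof (rule prob_all_local[where E="fam_edges d z z'"])
      show "disjoint_family_on (fam_edges d z z') {1..J}"
        using fam_edges_disjoint[OF d fl] by (auto simp: disjoint_family_on_def)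
      show "Measurable.pred P (\<lambda>W. C * real l \<le> fam_cost True d z z' j W)" for j
        using measurable_fam_cost[OF d, of True z z' j] by measurable
      show "local_on (fam_edges d z z' j) (\<lambda>W. C * real l \<le> fam_cost True d z z' j W)" for j
        using local_on_fam_cost[of d z z' j True] unfolding local_on_def by metis
    qed (use fam_edges_lattice[OF d] in auto)
    also have "\<dots> \<le> (\<Prod>j\<in>{1..J}. K * real l powr (-1/4))" using CK(3)[OF d fl l dl] by (intro prod_mono) auto
    finally show ?thesis by simp
  qed
  then show ?thesis using CK(1,2) by blast
qed

text \<open>In each of the \<open>2d\<close> groups pick the largest weight, with index
  \<open>f i\<close>; the sum over the group is at most \<open>n\<close> times it. The selected
  edges are distinct, so the moment hypothesis applies to each selection, and there are only
  finitely many selections \<open>f\<close>. In this way the moment of order \<open>d\<close> passes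
  from edges to finite sums.\<close>

lemma min_sum_moment:
  fixes \<phi> :: "nat \<Rightarrow> nat \<Rightarrow> (int^'d) set"
  assumes e: "\<And>i r. i < 2 * CARD('d) \<Longrightarrow> r < n \<Longrightarrow> \<phi> i r \<in> lattice_edges"
    and ne: "\<And>i i' r r'. i < 2 * CARD('d) \<Longrightarrow> i' < 2 * CARD('d) \<Longrightarrow> i \<noteq> i' \<Longrightarrow> r < n \<Longrightarrow> r' < n \<Longrightarrow> \<phi> i r \<noteq> \<phi> i' r'"
  shows "(\<integral>\<^sup>+W. ennreal ((Min ((\<lambda>i. \<Sum>r<n. \<bar>W (\<phi> i r)\<bar>) ` {..<2 * CARD('d)})) ^ CARD('d)) \<partial>P) < \<infinity>"
proof -
  let ?I = "{..<2 * CARD('d)}"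
  have I: "finite ?I" "?I \<noteq> {}" by (auto simp: lessThan_empty_iff)
  show ?thesis
  proof (cases "n = 0")
    case True
    then have "Min ((\<lambda>i. \<Sum>r<n. \<bar>W (\<phi> i r)\<bar>) ` ?I) = 0" for W :: "(int^'d) set \<Rightarrow> real"
      using I by (simp add: image_constant_conv)
    then show ?thesis by (simp add: P.emeasure_space_1)
  next
    case False
    let ?F = "PiE ?I (\<lambda>_. {..<n})"
    have F: "finite ?F" by (intro finite_PiE) auto
    let ?m = "\<lambda>f W. ennreal ((Min ((\<lambda>i. \<bar>W (\<phi> i (f i))\<bar>) ` ?I)) ^ CARD('d))"
    have mm: "(\<lambda>W. ?m f W) \<in> borel_measurable P" if "f \<in> ?F" for f
    proof -
      have "(\<lambda>W. Min ((\<lambda>i. \<bar>W (\<phi> i (f i))\<bar>) ` ?I)) \<in> borel_measurable P"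
        using that e by (intro borel_measurable_Min borel_measurable_abs measurable_edge) (auto simp: PiE_def Pi_def)
      then show ?thesis by measurable
    qed
    have le: "ennreal ((Min ((\<lambda>i. \<Sum>r<n. \<bar>W (\<phi> i r)\<bar>) ` ?I)) ^ CARD('d)) \<le> ennreal (real n ^ CARD('d)) * (\<Sum>f\<in>?F. ?m f W)" for W
    proof -
      have "\<exists>r<n. \<forall>r'<n. \<bar>W (\<phi> i r')\<bar> \<le> \<bar>W (\<phi> i r)\<bar>" for i
      proof -
        have "Max ((\<lambda>r. \<bar>W (\<phi> i r)\<bar>) ` {..<n}) \<in> (\<lambda>r. \<bar>W (\<phi> i r)\<bar>) ` {..<n}" using False by (intro Max_in) auto
        then obtain r where "r < n" "Max ((\<lambda>r. \<bar>W (\<phi> i r)\<bar>) ` {..<n}) = \<bar>W (\<phi> i r)\<bar>" by auto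
        then show ?thesis by (intro exI[of _ r]) (auto intro!: Max_ge simp flip: \<open>Max _ = _\<close>)
      qed
      then obtain g where g: "\<And>i. g i < n" "\<And>i r'. r' < n \<Longrightarrow> \<bar>W (\<phi> i r')\<bar> \<le> \<bar>W (\<phi> i (g i))\<bar>" by metis
      define f where "f = restrict g ?I"
      have f: "f \<in> ?F" using g by (auto simp: f_def)
      have fg: "f i = g i" if "i \<in> ?I" for i using that by (simp add: f_def)
      have 1: "Min ((\<lambda>i. \<Sum>r<n. \<bar>W (\<phi> i r)\<bar>) ` ?I) \<le> real n * Min ((\<lambda>i. \<bar>W (\<phi> i (f i))\<bar>) ` ?I)"
      proof -
        have "Min ((\<lambda>i. \<bar>W (\<phi> i (f i))\<bar>) ` ?I) \<in> (\<lambda>i. \<bar>W (\<phi> i (f i))\<bar>) ` ?I" using I by (intro Min_in) auto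
        then obtain i where i: "i \<in> ?I" "Min ((\<lambda>i. \<bar>W (\<phi> i (f i))\<bar>) ` ?I) = \<bar>W (\<phi> i (f i))\<bar>" by blast
        have "Min ((\<lambda>i. \<Sum>r<n. \<bar>W (\<phi> i r)\<bar>) ` ?I) \<le> (\<Sum>r<n. \<bar>W (\<phi> i r)\<bar>)" using I i by (intro Min_le) auto
        also have "\<dots> \<le> (\<Sum>r<n. \<bar>W (\<phi> i (f i))\<bar>)" using g(2) fg[OF i(1)] by (intro sum_mono) auto
        finally show ?thesis using i by simp
      qed
      have 0: "0 \<le> Min ((\<lambda>i. \<Sum>r<n. \<bar>W (\<phi> i r)\<bar>) ` ?I)" using I by (intro Min.boundedI) (auto simp: sum_nonneg)
      have "ennreal ((Min ((\<lambda>i. \<Sum>r<n. \<bar>W (\<phi> i r)\<bar>) ` ?I)) ^ CARD('d)) \<le> ennreal ((real n * Min ((\<lambda>i. \<bar>W (\<phi> i (f i))\<bar>) ` ?I)) ^ CARD('d))"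
        by (intro ennreal_leI power_mono 0 1)
      also have "\<dots> = ennreal (real n ^ CARD('d)) * ?m f W"
        by (simp add: power_mult_distrib ennreal_mult')
      also have "\<dots> \<le> ennreal (real n ^ CARD('d)) * (\<Sum>f\<in>?F. ?m f W)"
        using f F by (intro mult_left_mono member_le_sum) auto
      finally show ?thesis .
    qed
    have fin: "(\<integral>\<^sup>+W. ?m f W \<partial>P) < \<infinity>" if f: "f \<in> ?F" for f
    proof (subst nn_integral_distinct_edges)
      show "inj_on (\<lambda>i. \<phi> i (f i)) ?I"
      proof (rule inj_onI, rule ccontr)
        fix i i' assume "i \<in> ?I" "i' \<in> ?I" "\<phi> i (f i) = \<phi> i' (f i')" "i \<noteq> i'"
        then show False using f ne[of i i' "f i" "f i'"] by (auto simp: PiE_def Pi_def)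
      qed
      show "\<phi> i (f i) \<in> lattice_edges" if "i < 2 * CARD('d)" for i using that f e by (auto simp: PiE_def Pi_def)
    qed (rule mom)
    have "(\<integral>\<^sup>+W. ennreal ((Min ((\<lambda>i. \<Sum>r<n. \<bar>W (\<phi> i r)\<bar>) ` ?I)) ^ CARD('d)) \<partial>P)
      \<le> (\<integral>\<^sup>+W. ennreal (real n ^ CARD('d)) * (\<Sum>f\<in>?F. ?m f W) \<partial>P)"
      by (intro nn_integral_mono le)
    also have "\<dots> = ennreal (real n ^ CARD('d)) * (\<Sum>f\<in>?F. \<integral>\<^sup>+W. ?m f W \<partial>P)"
      using mm by (simp add: nn_integral_cmult nn_integral_sum)
    also have "\<dots> < \<infinity>" using fin F by (simp add: ennreal_mult_less_top less_top)
    finally show ?thesis .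
  qed
qed

text \<open>Borel-Cantelli over all sites: by stationarity the sum of the probabilities is the
  expected number of \<open>z\<close> with \<open>l1_int z < \<Lambda> * A 0 W\<close>, a number of
  order \<open>A^d\<close>. Here the exponent of the moment hypothesis is matched to the
  dimension.\<close>

lemma AE_finite_exceptional_sites:
  fixes A :: "int^'d \<Rightarrow> ((int^'d) set \<Rightarrow> real) \<Rightarrow> real"
  assumes A: "\<And>z. A z \<in> borel_measurable P" "\<And>z W. A z W \<ge> 0"
    and sh: "\<And>z W. A z W = A 0 (shiftW z W)"
    and momA: "(\<integral>\<^sup>+W. ennreal (A 0 W ^ CARD('d)) \<partial>P) < \<infinity>"
  shows "AE W in P. finite {z. \<Lambda> * A z W > real_of_int (l1_int z)}"
proof (cases "\<Lambda> > 0")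
  case False
  have "{z. \<Lambda> * A z W > real_of_int (l1_int z)} = {}" for W
  proof -
    have "\<Lambda> * A z W \<le> 0" for z using False A(2)[of z W] by (simp add: mult_nonpos_nonneg)
    then show ?thesis using l1_int_nonneg by (smt (verit, best) Collect_empty_eq of_int_0_le_iff)
  qed
  then show ?thesis by simp
next
  case \<Lambda>: True
  have inf: "infinite (UNIV :: (int^'d) set)"
  proof
    assume "finite (UNIV :: (int^'d) set)"
    then have "finite (range (\<lambda>n::int. axis (undefined::'d) n))" by (rule finite_subset[OF subset_UNIV])
    moreover have "inj (\<lambda>n::int. axis (undefined::'d) n)" by (auto intro!: injI dest: arg_cong[where f="\<lambda>v. v $ undefined"])
    ultimately show False using finite_imageD infinite_UNIV_int by blast
  qed
  \<comment> \<open>The sites are enumerated because the Borel-Cantelli lemma is about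
    sequences.\<close>
  obtain e where e: "bij_betw e (UNIV :: nat set) (UNIV :: (int^'d) set)"
    using countableE_infinite[OF countableI_type inf] by (metis bij_betw_inv_into)
  let ?E = "\<lambda>z. {W\<in>space P. \<Lambda> * A z W > real_of_int (l1_int z)}"
  have Em: "?E z \<in> sets P" for z using A(1)[of z] by measurable
  let ?G = "\<lambda>z::int^'d. {W\<in>space P. \<Lambda> * A 0 W > real_of_int (l1_int z)}"
  have E0m: "?G z \<in> sets P" for z using A(1)[of 0] by measurable
  have pe: "P.prob (?E z) = P.prob (?G z)" for z
  proof -
    have "Measurable.pred P (\<lambda>W. \<Lambda> * A 0 W > real_of_int (l1_int z))" using A(1)[of 0] by measurable
    from prob_shift[OF this, of z] show ?thesis by (simp add: sh[of z, symmetric])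
  qed
  \<comment> \<open>The indicators count lattice points in a box of radius
    \<open>\<Lambda> * A 0 W\<close>; the summand \<open>1\<close> on the right covers the case that
    \<open>A 0 W\<close> is below \<open>1\<close>.\<close>
  have cnt: "(\<Sum>n. indicator (?G (e n)) W) \<le> ennreal ((2 * \<Lambda> + 1) ^ CARD('d) * (A 0 W ^ CARD('d) + 1))" for W
  proof -
    let ?r = "\<lfloor>\<Lambda> * A 0 W\<rfloor>"
    let ?B = "{z::int^'d. \<forall>i. \<bar>z $ i\<bar> \<le> ?r}"
    have r: "?r \<ge> 0" using \<Lambda> A(2)[of 0 W] by simp
    let ?N = "e -` ?B"
    have N: "finite ?N" using finite_int_box[of ?r] e by (intro finite_vimageI) (auto simp: bij_betw_def)
    have "(\<Sum>n. indicator (?G (e n)) W :: ennreal) \<le> (\<Sum>n. indicator ?N n)"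
    proof (intro suminf_le allI)
      fix n
      show "(indicator (?G (e n)) W :: ennreal) \<le> indicator ?N n"
      proof (cases "W \<in> ?G (e n)")
        case True
        then have "real_of_int (l1_int (e n)) < \<Lambda> * A 0 W" by simp
        then have "l1_int (e n) \<le> ?r" by linarith
        then have "e n \<in> ?B" using abs_nth_le_l1_int[of "e n"] by (auto intro: order_trans)
        then show ?thesis by (auto simp: indicator_def)
      qed auto
    qed auto
    also have "(\<Sum>n. indicator ?N n :: ennreal) = (\<Sum>n\<in>?N. indicator ?N n)" by (intro suminf_finite N) auto
    also have "\<dots> = of_nat (card ?N)" by simp
    also have "\<dots> = ennreal (real (card ?N))" by (simp add: ennreal_of_nat_eq_real_of_nat)
    also have "\<dots> \<le> ennreal ((2 * \<Lambda> + 1) ^ CARD('d) * (A 0 W ^ CARD('d) + 1))"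
    proof (intro ennreal_leI)
      have "inj e" using e by (simp add: bij_betw_def)
      then have "card ?N = card (e ` ?N)" 
        using card_image[OF inj_on_subset[OF _ subset_UNIV], of e ?N] by simp
      also have "\<dots> \<le> card ?B" by (rule card_mono[OF finite_int_box]) blast
      finally have "real (card ?N) \<le> real (card ?B)" by simp
      also have "\<dots> \<le> (2 * real_of_int ?r + 1) ^ CARD('d)" by (rule card_int_box[OF r])
      also have "\<dots> \<le> ((2 * \<Lambda> + 1) * max (A 0 W) 1) ^ CARD('d)"
      proof (intro power_mono)
        have "2 * real_of_int ?r + 1 \<le> 2 * (\<Lambda> * A 0 W) + 1" by linarith
        also have "\<dots> \<le> 2 * \<Lambda> * max (A 0 W) 1 + max (A 0 W) 1"
          using \<Lambda> by (intro add_mono) auto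
        finally show "2 * real_of_int ?r + 1 \<le> (2 * \<Lambda> + 1) * max (A 0 W) 1" by (simp add: algebra_simps)
      qed (use r in simp)
      also have "\<dots> = (2 * \<Lambda> + 1) ^ CARD('d) * (max (A 0 W) 1) ^ CARD('d)" by (rule power_mult_distrib)
      also have "\<dots> \<le> (2 * \<Lambda> + 1) ^ CARD('d) * (A 0 W ^ CARD('d) + 1)"
        using \<Lambda> A(2)[of 0 W] by (intro mult_left_mono) (auto simp: max_def)
      finally show "real (card ?N) \<le> (2 * \<Lambda> + 1) ^ CARD('d) * (A 0 W ^ CARD('d) + 1)" .
    qed
    finally show ?thesis .
  qed
  have "(\<Sum>n. ennreal (P.prob (?E (e n)))) = (\<Sum>n. \<integral>\<^sup>+W. indicator (?G (e n)) W \<partial>P)"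
    by (intro arg_cong[where f=suminf] ext) (simp only: pe P.emeasure_eq_measure[symmetric] nn_integral_indicator[OF E0m])
  also have "\<dots> = (\<integral>\<^sup>+W. (\<Sum>n. indicator (?G (e n)) W) \<partial>P)"
    by (rule nn_integral_suminf[symmetric]) (rule borel_measurable_indicator[OF E0m])
  also have "\<dots> \<le> (\<integral>\<^sup>+W. ennreal ((2 * \<Lambda> + 1) ^ CARD('d) * (A 0 W ^ CARD('d) + 1)) \<partial>P)"
    by (intro nn_integral_mono cnt)
  also have "\<dots> = (\<integral>\<^sup>+W. ennreal ((2 * \<Lambda> + 1) ^ CARD('d)) * (ennreal (A 0 W ^ CARD('d)) + 1) \<partial>P)"
    using \<Lambda> A(2) by (intro nn_integral_cong) (simp add: ennreal_mult' ennreal_plus flip: ennreal_1)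
  also have "\<dots> = ennreal ((2 * \<Lambda> + 1) ^ CARD('d)) * ((\<integral>\<^sup>+W. ennreal (A 0 W ^ CARD('d)) \<partial>P) + 1)"
    using A(1)[of 0] by (simp add: nn_integral_cmult nn_integral_add P.emeasure_space_1)
  also have "\<dots> < \<infinity>" using momA by (simp add: ennreal_mult_less_top less_top)
  finally have "(\<Sum>n. ennreal (P.prob (?E (e n)))) \<noteq> top" by (simp add: less_top)
  then have sm: "summable (\<lambda>n. P.prob (?E (e n)))" by (intro summable_suminf_not_top) auto
  have "AE W in P. eventually (\<lambda>n. W \<notin> ?E (e n)) sequentially"
    by (rule P.borel_cantelli_bound[OF Em _ sm, of 0]) simp
  then show ?thesis
  proof (rule AE_mp, intro AE_I2 impI)
    fix W assume W: "W \<in> space P" "eventually (\<lambda>n. W \<notin> ?E (e n)) sequentially"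
    then obtain n0 where n0: "\<And>n. n \<ge> n0 \<Longrightarrow> W \<notin> ?E (e n)" by (auto simp: eventually_sequentially)
    have "{z. \<Lambda> * A z W > real_of_int (l1_int z)} \<subseteq> e ` {..<n0}"
    proof
      fix z assume z: "z \<in> {z. \<Lambda> * A z W > real_of_int (l1_int z)}"
      have "z \<in> range e" using e by (simp add: bij_betw_def)
      then obtain n where "z = e n" by blast
      then show "z \<in> e ` {..<n0}" using n0[of n] z W(1) by (cases "n < n0") auto
    qed
    then show "finite {z. \<Lambda> * A z W > real_of_int (l1_int z)}" by (rule finite_subset) simp
  qed
qed

end

section \<open>Connecting lattice points\<close>

lemma l1_int_add_axis: "v $ a = 0 \<Longrightarrow> l1_int (v + axis a r) = l1_int v + \<bar>r\<bar>"
proof -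
  assume v: "v $ a = 0"
  have "l1_int (v + axis a r) = \<bar>(v + axis a r) $ a\<bar> + (\<Sum>i\<in>UNIV - {a}. \<bar>(v + axis a r) $ i\<bar>)"
    unfolding l1_int_def by (rule sum.remove) auto
  also have "(\<Sum>i\<in>UNIV - {a}. \<bar>(v + axis a r) $ i\<bar>) = (\<Sum>i\<in>UNIV - {a}. \<bar>v $ i\<bar>)"
    by (intro sum.cong) (auto simp: axis_def)
  also have "(\<Sum>i\<in>UNIV - {a}. \<bar>v $ i\<bar>) = l1_int v"
  proof -
    have "l1_int v = \<bar>v $ a\<bar> + (\<Sum>i\<in>UNIV - {a}. \<bar>v $ i\<bar>)" unfolding l1_int_def by (rule sum.remove) auto
    then show ?thesis using v by simp
  qed
  finally show ?thesis using v by (simp add: axis_def)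
qed

lemma dst_straight: "l1_int v = 1 \<Longrightarrow> dst z (z + int n *s v) = n"
  by (simp add: dst_def l1_int_scale)

text \<open>Between two points of a coordinate line a geodesic has no choice: the other coordinates
  are frozen and the distances to both ends are prescribed. The arbitrary choice made by
  \<open>geo\<close> is thus explicit on lines.\<close>

lemma geo_straight:
  assumes v: "l1_int v = 1" and i: "i \<le> n"
  shows "geo z (z + int n *s v) i = z + int i *s v"
proof -
  let ?z = "z + int n *s v"
  have d: "dst z ?z = n" by (rule dst_straight[OF v])
  obtain a s where s: "v = axis a s" "\<bar>s\<bar> = 1" using unit_int_vec_cases[OF v] by blast
  have vb: "v $ b = 0" if "b \<noteq> a" for b using that s by (simp add: axis_def)
  have "geo z ?z i $ b = z $ b" if "b \<noteq> a" for b
    by (rule geo_const) (use vb[OF that] i d in auto)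
  then have eq: "geo z ?z i - z = axis a (geo z ?z i $ a - z $ a)"
    "geo z ?z i - ?z = axis a (geo z ?z i $ a - ?z $ a)"
    using vb by (auto simp: vec_eq_iff axis_def)
  have "l1_int (geo z ?z i - z) = int i" using geo_dist[of 0 i z ?z] i d by simp
  moreover have "l1_int (?z - geo z ?z i) = int (n - i)" using geo_dist[of i n z ?z] i d geo_end[of z ?z] by simp
  ultimately have "\<bar>geo z ?z i $ a - z $ a\<bar> = int i" "\<bar>geo z ?z i $ a - ?z $ a\<bar> = int (n - i)"
    using arg_cong[OF eq(1), of l1_int] arg_cong[OF eq(2), of l1_int] l1_int_diff_commute[of ?z "geo z ?z i"] by simp_all
  moreover have "?z $ a = z $ a + int n * s" using s by simp
  ultimately have "geo z ?z i $ a - z $ a = int i * s" using s i by (auto simp: abs_if split: if_splits)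
  then have "geo z ?z i - z = axis a (int i * s)" using eq(1) by argo
  also have "axis a (int i * s) = int i *s v" using s(1) by (simp add: vec_eq_iff axis_def)
  finally show "geo z ?z i = z + int i *s v" by (simp add: algebra_simps)
qed

text \<open>The number of steps is only bounded from above, since detours have varying lengths;
  exact length and parity are restored once, in \<open>connect\<close>.\<close>

definition linked :: "bool \<Rightarrow> real \<Rightarrow> ((int^'d) set \<Rightarrow> real) \<Rightarrow> nat \<Rightarrow> real \<Rightarrow> int^'d \<Rightarrow> int^'d \<Rightarrow> bool" where
  "linked lazy c W s \<beta> x y \<longleftrightarrow> (\<exists>n\<le>s. pcost lazy c W n x y \<le> ennreal \<beta>)"

lemma linked_refl: "linked lazy c W s \<beta> x x"
  unfolding linked_def by (intro exI[of _ 0]) simp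

lemma linked_mono:
  assumes "linked lazy c W s \<beta> x y" "s \<le> s'" "\<beta> \<le> \<beta>'"
  shows "linked lazy c W s' \<beta>' x y"
proof -
  obtain n where "n \<le> s" "pcost lazy c W n x y \<le> ennreal \<beta>" using assms(1) unfolding linked_def by blast
  then have "n \<le> s'" "pcost lazy c W n x y \<le> ennreal \<beta>'" using assms(2,3) order_trans[OF _ ennreal_leI] by auto
  then show ?thesis unfolding linked_def by blast
qed

lemma linked_sym: "linked lazy c W s \<beta> x y \<Longrightarrow> linked lazy c W s \<beta> y x"
  unfolding linked_def pcost_commute[of lazy c W _ y x] .

lemma linked_trans:
  assumes "linked lazy c W s \<beta> x y" "linked lazy c W s' \<beta>' y z" "\<beta> \<ge> 0" "\<beta>' \<ge> 0"
  shows "linked lazy c W (s + s') (\<beta> + \<beta>') x z"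
proof -
  obtain n m where n: "n \<le> s" "pcost lazy c W n x y \<le> ennreal \<beta>" and m: "m \<le> s'" "pcost lazy c W m y z \<le> ennreal \<beta>'"
    using assms unfolding linked_def by blast
  have "pcost lazy c W (n + m) x z \<le> pcost lazy c W n x y + pcost lazy c W m y z" by (rule pcost_triangle)
  also have "\<dots> \<le> ennreal \<beta> + ennreal \<beta>'" by (intro add_mono n m)
  also have "\<dots> = ennreal (\<beta> + \<beta>')" using assms by (simp add: ennreal_plus)
  finally show ?thesis using n m unfolding linked_def by (intro exI[of _ "n + m"]) simp
qed

lemma linked_edge:
  assumes "l1_int (b - a) = 1"
  shows "linked lazy c W 1 \<bar>W {a, b}\<bar> a b"
proof -
  have "a \<noteq> b" using assms by auto
  then show ?thesis using pcost_1[of b a lazy c W] assms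
    unfolding linked_def by (intro exI[of _ 1]) (simp add: steps_def ecost_def)
qed

section \<open>Lines, arms and their concatenation\<close>

abbreviation thickness :: "bool \<Rightarrow> nat" where "thickness thick \<equiv> (if thick then 3 else 1)"

lemma linked_detour:
  assumes "l1_int (b - a) = 1" "l1_int d = 1"
  shows "linked lazy c W 3 (detour d W a b) a b"
proof -
  have 1: "linked lazy c W 1 \<bar>W {a, a + d}\<bar> a (a + d)" using assms by (intro linked_edge) simp
  have 2: "linked lazy c W 1 \<bar>W {a + d, b + d}\<bar> (a + d) (b + d)" using assms by (intro linked_edge) simp
  have 3: "linked lazy c W 1 \<bar>W {b + d, b}\<bar> (b + d) b" using assms by (intro linked_edge) simp
  show ?thesis using linked_trans[OF linked_trans[OF 1 2] 3] by (simp add: detour_def numeral_3_eq_3)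
qed

lemma linked_sedge:
  assumes "l1_int (b - a) = 1" "l1_int d = 1"
  shows "linked lazy c W (thickness thick) (sedge thick d W a b) a b"
proof -
  have 1: "linked lazy c W 1 \<bar>W {a, b}\<bar> a b" by (rule linked_edge[OF assms(1)])
  then have 2: "linked lazy c W 3 \<bar>W {a, b}\<bar> a b" by (rule linked_mono) simp_all
  have 3: "linked lazy c W 3 (detour d W a b) a b" by (rule linked_detour[OF assms])
  have 4: "linked lazy c W 3 (detour (- d) W a b) a b" by (rule linked_detour) (use assms in simp_all)
  show ?thesis using 1 2 3 4 unfolding sedge_def min_def by (simp split: if_split)
qed

text \<open>Whichever route realises the minimum, its first edge starts at \<open>a\<close> and
  costs no more than the route; such an edge is used later for going back and forth.\<close>

lemma sedge_edge:
  assumes "l1_int (b - a) = 1" "l1_int d = 1"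
  shows "\<exists>v. l1_int v = 1 \<and> \<bar>W {a, a + v}\<bar> \<le> sedge thick d W a b"
proof -
  have "\<bar>W {a, a + (b - a)}\<bar> \<le> sedge thick d W a b \<or> \<bar>W {a, a + d}\<bar> \<le> sedge thick d W a b \<or> \<bar>W {a, a + - d}\<bar> \<le> sedge thick d W a b"
    unfolding sedge_def detour_def by (simp add: min_def)
  moreover have "l1_int (- d) = 1" using assms by simp
  ultimately show ?thesis using assms by metis
qed

text \<open>Every stretch is charged the total cost of the chain, so that later bounds do not depend
  on where a line is entered or left.\<close>

lemma linked_chain:
  assumes "\<And>i. i < n \<Longrightarrow> linked lazy c W k (\<tau> i) (p i) (p (Suc i))" "\<And>i. \<tau> i \<ge> 0" "i \<le> i'" "i' \<le> n"
  shows "linked lazy c W (k * (i' - i)) (\<Sum>j<n. \<tau> j) (p i) (p i')"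
proof -
  have "linked lazy c W (k * (i' - i)) (\<Sum>j\<in>{i..<i'}. \<tau> j) (p i) (p i')"
    using assms(3,4)
  proof (induction i' rule: dec_induct)
    case (step m)
    have "linked lazy c W (k * (m - i) + k) ((\<Sum>j\<in>{i..<m}. \<tau> j) + \<tau> m) (p i) (p (Suc m))"
      using step assms by (intro linked_trans[of lazy c W _ _ _ "p m"]) (auto intro: sum_nonneg)
    then show ?case using step by (simp add: Suc_diff_le add.commute)
  qed (simp add: linked_refl)
  moreover have "(\<Sum>j\<in>{i..<i'}. \<tau> j) \<le> (\<Sum>j<n. \<tau> j)" using assms by (intro sum_mono2) auto
  ultimately show ?thesis by (rule linked_mono[OF _ order_refl])
qed

text \<open>A usable line of \<open>l\<close> segments in the direction \<open>v\<close>: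
  \<open>\<tau> i\<close> bounds the cost of advancing from site \<open>i\<close> to the next one
  and also the weight of some edge at site \<open>i\<close>, on which surplus steps can be
  spent.\<close>

definition line_at :: "bool \<Rightarrow> real \<Rightarrow> ((int^'d) set \<Rightarrow> real) \<Rightarrow> nat \<Rightarrow> nat \<Rightarrow> real \<Rightarrow> int^'d \<Rightarrow> int^'d \<Rightarrow> (nat \<Rightarrow> real) \<Rightarrow> bool" where
  "line_at lazy c W \<kappa> l B v x \<tau> \<longleftrightarrow> (\<forall>i. \<tau> i \<ge> 0) \<and> (\<Sum>i<l. \<tau> i) \<le> B \<and>
     (\<forall>i<l. linked lazy c W \<kappa> (\<tau> i) (x + int i *s v) (x + int (Suc i) *s v) \<and>
        (\<exists>w. l1_int w = 1 \<and> \<bar>W {x + int i *s v, x + int i *s v + w}\<bar> \<le> \<tau> i))"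

lemma line_at_nonneg: "line_at lazy c W \<kappa> l B v x \<tau> \<Longrightarrow> 0 \<le> B"
  unfolding line_at_def using sum_nonneg[of "{..<l}" \<tau>] by force

lemma line_at_linked:
  assumes "line_at lazy c W \<kappa> l B v x \<tau>" "i \<le> i'" "i' \<le> l"
  shows "linked lazy c W (\<kappa> * (i' - i)) B (x + int i *s v) (x + int i' *s v)"
proof -
  have "linked lazy c W (\<kappa> * (i' - i)) (\<Sum>j<l. \<tau> j) (x + int i *s v) (x + int i' *s v)"
    by (rule linked_chain[where p="\<lambda>i. x + int i *s v"]) (use assms in \<open>simp_all add: line_at_def\<close>)
  then show ?thesis by (rule linked_mono) (use assms in \<open>simp_all add: line_at_def\<close>)
qed

lemma linked_fam:
  assumes "l1_int d = 1"
  shows "linked lazy c W (thickness thick * dst z z') (fam_cost thick d z z' j W) (z + (4 * int j) *s d) (z' + (4 * int j) *s d)"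
proof -
  have "linked lazy c W (thickness thick * (dst z z' - 0))
    (\<Sum>i<dst z z'. sedge thick d W (fam_pt d z z' j i) (fam_pt d z z' j (Suc i))) (fam_pt d z z' j 0) (fam_pt d z z' j (dst z z'))"
  proof (rule linked_chain)
    fix i assume "i < dst z z'"
    then show "linked lazy c W (thickness thick) (sedge thick d W (fam_pt d z z' j i) (fam_pt d z z' j (Suc i))) (fam_pt d z z' j i) (fam_pt d z z' j (Suc i))"
      by (intro linked_sedge fam_step assms)
  qed (simp_all add: sedge_nonneg)
  then show ?thesis by (simp add: fam_cost_def fam_pt_def)
qed

lemma fam_line:
  assumes d: "l1_int d = 1" and v: "l1_int v = 1" and B: "fam_cost thick d z (z + int l *s v) j W \<le> B"
  shows "\<exists>\<tau>. line_at lazy c W (thickness thick) l B v (z + (4 * int j) *s d) \<tau>"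
proof -
  let ?z = "z + int l *s v" let ?x = "z + (4 * int j) *s d"
  let ?p = "fam_pt d z ?z j"
  have p: "?p i = ?x + int i *s v" if "i \<le> l" for i
    using geo_straight[OF v that, of z] by (simp add: fam_pt_def algebra_simps)
  have dl: "dst z ?z = l" by (rule dst_straight[OF v])
  show ?thesis
  proof (rule exI[of _ "\<lambda>i. sedge thick d W (?p i) (?p (Suc i))"], unfold line_at_def, intro conjI allI impI)
    show "0 \<le> sedge thick d W (?p i) (?p (Suc i))" for i by (rule sedge_nonneg)
    show "(\<Sum>i<l. sedge thick d W (?p i) (?p (Suc i))) \<le> B" using B unfolding fam_cost_def dl .
  next
    fix i assume i: "i < l"
    have s: "l1_int (?p (Suc i) - ?p i) = 1" using i dl by (intro fam_step) simp
    show "linked lazy c W (thickness thick) (sedge thick d W (?p i) (?p (Suc i))) (?x + int i *s v) (?x + int (Suc i) *s v)"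
      using linked_sedge[OF s d, of lazy c W thick] p[of i] p[of "Suc i"] i by simp
    show "\<exists>w. l1_int w = 1 \<and> \<bar>W {?x + int i *s v, ?x + int i *s v + w}\<bar> \<le> sedge thick d W (?p i) (?p (Suc i))"
      using sedge_edge[OF s d, of W thick] p[of i] p[of "Suc i"] i by simp
  qed
qed

definition arm_cost :: "nat \<Rightarrow> int^'d \<Rightarrow> int^'d \<Rightarrow> ((int^'d) set \<Rightarrow> real) \<Rightarrow> real" where
  "arm_cost n u x W = (\<Sum>r<n. \<bar>W {x + int r *s u, x + int (Suc r) *s u}\<bar>)"

lemma linked_arm:
  assumes u: "l1_int u = 1" and r: "r \<le> n"
  shows "linked lazy c W r (arm_cost n u x W) x (x + int r *s u)"
proof -
  have "linked lazy c W (1 * (r - 0)) (\<Sum>r<n. \<bar>W {x + int r *s u, x + int (Suc r) *s u}\<bar>) (x + int 0 *s u) (x + int r *s u)"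
  proof (rule linked_chain)
    fix i
    have "x + int (Suc i) *s u - (x + int i *s u) = u" by (simp add: vec_eq_iff algebra_simps)
    then show "linked lazy c W 1 \<bar>W {x + int i *s u, x + int (Suc i) *s u}\<bar> (x + int i *s u) (x + int (Suc i) *s u)"
      using u by (intro linked_edge) simp
  qed (use r in auto)
  then show ?thesis by (simp add: arm_cost_def)
qed

text \<open>Uniform over directions and endpoints near \<open>x\<close>, so that the geometric
  constructions that follow are deterministic.\<close>

definition good_families :: "bool \<Rightarrow> nat \<Rightarrow> real \<Rightarrow> nat \<Rightarrow> int^'d \<Rightarrow> nat \<Rightarrow> ((int^'d) set \<Rightarrow> real) \<Rightarrow> bool" where
  "good_families thick J B l x R W \<longleftrightarrow> (\<forall>d z z'. l1_int d = 1 \<longrightarrow> flat d z z' \<longrightarrow> dst z z' \<le> l \<longrightarrow> l1_int (z - x) \<le> int R \<longrightarrow>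
     (\<exists>j\<in>{1..J}. fam_cost thick d z z' j W \<le> B))"

text \<open>From an arm at \<open>x\<close> one reaches a line in the direction \<open>axis a 1\<close>: some parallel line of
  a family perpendicular to the arm is good, and if the arm itself has the direction of
  the axis \<open>a\<close>, a line in a second direction \<open>b\<close> serves as an intermediate stage.\<close>

lemma reach_line:
  fixes x :: "int^'d"
  assumes u: "l1_int u = 1" and A: "arm_cost (4 * J) u x W \<le> A"
    and gf: "good_families thick J B l x (4 * J) W" and l: "4 * J \<le> l" and ab: "a \<noteq> b"
  obtains x' \<tau> where "l1_int (x' - x) \<le> 8 * int J" "linked lazy c W ((4 + 4 * thickness thick) * J) (A + B) x x'"
    "line_at lazy c W (thickness thick) l B (axis a 1) x' \<tau>"
proof -
  let ?\<kappa> = "thickness thick"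
  have A0: "0 \<le> arm_cost (4 * J) u x W" by (simp add: arm_cost_def sum_nonneg)
  obtain c0 s where s: "u = axis c0 s" "\<bar>s\<bar> = 1" using unit_int_vec_cases[OF u] by blast
  \<comment> \<open>The degenerate family from \<open>x\<close> to \<open>x\<close> already yields
    this, because costs are nonnegative and one member is at most \<open>B\<close>.\<close>
  have B: "B \<ge> 0"
  proof -
    obtain j where "fam_cost thick u x x j W \<le> B"
      using gf[unfolded good_families_def, rule_format, of u x x] u by (auto simp: flat_def dst_def)
    then show ?thesis using fam_cost_nonneg[of thick u x x j W] by linarith
  qed
  have first: "\<exists>j\<in>{1..J}. fam_cost thick u x (x + int l *s axis e 1) j W \<le> B" if "e \<noteq> c0" for e
  proof (rule gf[unfolded good_families_def, rule_format, OF u])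
    show "flat u x (x + int l *s axis e 1)" using that s by (auto simp: flat_def axis_def)
    show "dst x (x + int l *s axis e 1) \<le> l" by (simp add: dst_straight)
  qed simp
  have arm: "linked lazy c W (4 * j) A x (x + (4 * int j) *s u)" if "j \<le> J" for j
  proof -
    have "linked lazy c W (4 * j) (arm_cost (4 * J) u x W) x (x + int (4 * j) *s u)"
      by (rule linked_arm[OF u]) (use that in simp)
    from linked_mono[OF this order_refl A] show ?thesis by simp
  qed
  show ?thesis
  proof (cases "c0 = a")
    case False
    from first[of a] False obtain j where j: "j \<in> {1..J}" "fam_cost thick u x (x + int l *s axis a 1) j W \<le> B" by auto
    from fam_line[OF u _ this(2)] obtain \<tau> where \<tau>: "line_at lazy c W ?\<kappa> l B (axis a 1) (x + (4 * int j) *s u) \<tau>" by auto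
    show ?thesis
    proof (rule that[OF _ _ \<tau>])
      show "l1_int (x + (4 * int j) *s u - x) \<le> 8 * int J" using j u by (simp add: l1_int_scale)
      show "linked lazy c W ((4 + 4 * ?\<kappa>) * J) (A + B) x (x + (4 * int j) *s u)"
        using j B by (intro linked_mono[OF arm[of j]]) (auto intro: trans_le_add1)
    qed
  next
    case True
    from first[of b] True ab obtain j where j: "j \<in> {1..J}" "fam_cost thick u x (x + int l *s axis b 1) j W \<le> B" by auto
    let ?y = "x + (4 * int j) *s u"
    from fam_line[OF u _ j(2)] obtain \<tau>1 where \<tau>1: "line_at lazy c W ?\<kappa> l B (axis b 1) ?y \<tau>1" by auto
    have "\<exists>i\<in>{1..J}. fam_cost thick (axis b 1) ?y (?y + int l *s axis a 1) i W \<le> B"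
    proof (rule gf[unfolded good_families_def, rule_format])
      show "flat (axis b 1) ?y (?y + int l *s axis a 1)" using ab by (auto simp: flat_def axis_def)
      show "dst ?y (?y + int l *s axis a 1) \<le> l" by (simp add: dst_straight)
      show "l1_int (?y - x) \<le> int (4 * J)" using j u by (simp add: l1_int_scale)
    qed simp
    then obtain i where i: "i \<in> {1..J}" "fam_cost thick (axis b 1) ?y (?y + int l *s axis a 1) i W \<le> B" by blast
    let ?x' = "?y + (4 * int i) *s axis b 1"
    from fam_line[OF _ _ i(2)] obtain \<tau> where \<tau>: "line_at lazy c W ?\<kappa> l B (axis a 1) ?x' \<tau>" by auto
    show ?thesis
    proof (rule that[OF _ _ \<tau>])
      have "l1_int (?x' - x) \<le> l1_int ((4 * int j) *s u) + l1_int ((4 * int i) *s axis b 1)"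
        using l1_int_triangle[of "(4 * int j) *s u" "(4 * int i) *s axis b 1"] by (simp add: algebra_simps)
      then show "l1_int (?x' - x) \<le> 8 * int J" using i j u by (simp add: l1_int_scale)
      \<comment> \<open>The line in the direction \<open>b\<close> is followed up to its site
        \<open>4 i\<close>, where the chosen copy of the second family starts.\<close>
      have 2: "linked lazy c W (?\<kappa> * (4 * i - 0)) B (?y + int 0 *s axis b 1) (?y + int (4 * i) *s axis b 1)"
        by (rule line_at_linked[OF \<tau>1]) (use i l in auto)
      have "linked lazy c W (4 * j + ?\<kappa> * (4 * i)) (A + B) x ?x'"
        using 2 A A0 B j by (intro linked_trans[OF arm]) auto
      then show "linked lazy c W ((4 + 4 * ?\<kappa>) * J) (A + B) x ?x'"
      proof (rule linked_mono)
        show "4 * j + ?\<kappa> * (4 * i) \<le> (4 + 4 * ?\<kappa>) * J" using i j by auto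
      qed simp
    qed
  qed
qed

text \<open>Both lines run along the axis \<open>a\<close>, so this coordinate is first equalised by
  moving along one of them. A family orthogonal to the axis then joins the two points, and since its
  copies are translates along the axis, their ends lie on the two lines again.\<close>

lemma join_lines:
  fixes x y :: "int^'d"
  assumes lx: "line_at lazy c W (thickness thick) l B (axis a 1) x \<tau>"
    and ly: "line_at lazy c W (thickness thick) l B (axis a 1) y \<sigma>"
    and gf: "good_families thick J B l o' R W" and R: "l1_int (x - o') + int l \<le> int R"
    and l: "dst x y + 4 * J \<le> l"
  shows "linked lazy c W (thickness thick * (dst x y + 8 * J)) (3 * B) x y"
proof -
  let ?\<kappa> = "thickness thick" and ?e = "axis a 1 :: int^'d"
  have B: "B \<ge> 0" using lx by (rule line_at_nonneg)
  \<comment> \<open>At least one of \<open>p\<close> and \<open>p'\<close> is zero; together they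
    make up the difference in the coordinate \<open>a\<close>.\<close>
  define p where "p = nat (y $ a - x $ a)"
  define p' where "p' = nat (x $ a - y $ a)"
  let ?X = "x + int p *s ?e" and ?Y = "y + int p' *s ?e"
  have XY: "?X $ a = ?Y $ a" by (simp add: p_def p'_def)
  have "y - x = (?Y - ?X) + axis a (y $ a - x $ a)"
    by (auto simp: vec_eq_iff axis_def p_def p'_def)
  then have "l1_int (y - x) = l1_int ((?Y - ?X) + axis a (y $ a - x $ a))" by (rule arg_cong)
  also have "\<dots> = l1_int (?Y - ?X) + \<bar>y $ a - x $ a\<bar>"
    by (rule l1_int_add_axis) (use XY in simp)
  finally have "l1_int (y - x) = l1_int (?Y - ?X) + \<bar>y $ a - x $ a\<bar>" .

  moreover have "\<bar>y $ a - x $ a\<bar> = int p + int p'" by (simp add: p_def p'_def)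
  ultimately have dd: "dst x y = dst ?X ?Y + p + p'" using int_dst[of x y] int_dst[of ?X ?Y] by linarith
  have "\<exists>j\<in>{1..J}. fam_cost thick ?e ?X ?Y j W \<le> B"
  proof (rule gf[unfolded good_families_def, rule_format])
    show "flat ?e ?X ?Y" using XY by (auto simp: flat_def axis_def)
    show "dst ?X ?Y \<le> l" using l dd by simp
    have "l1_int (?X - o') \<le> l1_int (x - o') + l1_int (int p *s ?e)"
      using l1_int_triangle[of "x - o'" "int p *s ?e"] by (simp add: algebra_simps)
    then show "l1_int (?X - o') \<le> int R" using R dd l by (simp add: l1_int_scale)
  qed simp
  then obtain j where j: "j \<in> {1..J}" "fam_cost thick ?e ?X ?Y j W \<le> B" by blast
  have X: "?X + (4 * int j) *s ?e = x + int (p + 4 * j) *s ?e" and Y: "?Y + (4 * int j) *s ?e = y + int (p' + 4 * j) *s ?e"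
    by (simp_all add: vec_eq_iff algebra_simps)
  have pl: "p + 4 * j \<le> l" "p' + 4 * j \<le> l" using j(1) l dd by auto
  have 1: "linked lazy c W (?\<kappa> * (p + 4 * j)) B x (?X + (4 * int j) *s ?e)"
    using line_at_linked[OF lx le0 pl(1)] unfolding X by simp
  have 2: "linked lazy c W (?\<kappa> * dst ?X ?Y) B (?X + (4 * int j) *s ?e) (?Y + (4 * int j) *s ?e)"
    by (rule linked_mono[OF linked_fam order_refl j(2)]) simp
  have 3: "linked lazy c W (?\<kappa> * (p' + 4 * j)) B (?Y + (4 * int j) *s ?e) y"
    using linked_sym[OF line_at_linked[OF ly le0 pl(2)]] unfolding Y by simp
  from linked_trans[OF linked_trans[OF 1 2 B B] 3] B
  have "linked lazy c W (?\<kappa> * (p + 4 * j) + ?\<kappa> * dst ?X ?Y + ?\<kappa> * (p' + 4 * j)) (B + B + B) x y" by simp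
  then show ?thesis
  proof (rule linked_mono)
    have "?\<kappa> * (p + 4 * j) + ?\<kappa> * dst ?X ?Y + ?\<kappa> * (p' + 4 * j) = ?\<kappa> * (dst x y + 8 * j)"
      unfolding dd by (simp add: algebra_simps)
    also have "\<dots> \<le> ?\<kappa> * (dst x y + 8 * J)" using j by (intro mult_left_mono) auto
    finally show "?\<kappa> * (p + 4 * j) + ?\<kappa> * dst ?X ?Y + ?\<kappa> * (p' + 4 * j) \<le> ?\<kappa> * (dst x y + 8 * J)" .
  qed simp
qed

text \<open>Only the parity obstruction is recorded; that the distance is small compared with
  \<open>n\<close> is required separately wherever it matters.\<close>

definition admissible :: "bool \<Rightarrow> nat \<Rightarrow> int^'d \<Rightarrow> int^'d \<Rightarrow> bool" where
  "admissible lazy n x y \<longleftrightarrow> lazy \<or> even (int n + (\<Sum>i\<in>UNIV. (y - x) $ i))"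

lemma pcost_finite_admissible: "pcost lazy c W n x y < \<infinity> \<Longrightarrow> admissible lazy n x y"
  unfolding admissible_def using pcost_finite_parity[of c W n x y] by (cases lazy) simp_all

text \<open>Zero steps are used if they are allowed; otherwise the edge \<open>{z, z + w}\<close> is
  crossed to and fro, which needs an even number of steps. The price \<open>\<tau> + c\<close> per
  step covers both cases.\<close>

lemma pcost_loop:
  assumes w: "l1_int w = 1" "\<bar>W {z, z + w}\<bar> \<le> \<tau>" and c: "c \<ge> 0" and n: "lazy \<or> even n"
  shows "pcost lazy c W n z z \<le> ennreal (real n * (\<tau> + c))"
proof -
  have t0: "0 \<le> \<tau>" using w(2) by linarith
  have 2: "pcost lazy c W (1 + 1) z z \<le> ennreal (2 * \<tau>)"
  proof -
    have "pcost lazy c W (1 + 1) z z \<le> pcost lazy c W 1 z (z + w) + pcost lazy c W 1 (z + w) z" by (rule pcost_triangle)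
    also have "\<dots> = pcost lazy c W 1 z (z + w) + pcost lazy c W 1 z (z + w)" by (subst pcost_commute) simp
    also have "\<dots> \<le> ennreal \<tau> + ennreal \<tau>"
    proof -
      have "w \<noteq> 0" using w by auto
      have "pcost lazy c W 1 z (z + w) \<le> ecost c W z (z + w)" using w by (intro pcost_1) (auto simp: steps_def)
      also have "\<dots> \<le> ennreal \<tau>" using w \<open>w \<noteq> 0\<close> by (simp add: ecost_def ennreal_leI)
      finally show ?thesis by (intro add_mono)
    qed
    finally show ?thesis using t0 by (simp add: ennreal_plus[symmetric] del: ennreal_plus)
  qed
  have ev: "pcost lazy c W (2 * m) z z \<le> ennreal (real (2 * m) * \<tau>)" for m
  proof (induction m)
    case (Suc m)
    have "pcost lazy c W ((1 + 1) + 2 * m) z z \<le> pcost lazy c W (1 + 1) z z + pcost lazy c W (2 * m) z z" by (rule pcost_triangle)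
    also have "\<dots> \<le> ennreal (2 * \<tau>) + ennreal (real (2 * m) * \<tau>)" by (intro add_mono 2 Suc)
    also have "\<dots> = ennreal (real (2 * Suc m) * \<tau>)" using t0 by (simp add: ennreal_plus[symmetric] algebra_simps del: ennreal_plus)
    finally show ?case by simp
  qed simp
  have lz: "pcost True c W m z z \<le> ennreal (real m * c)" for m
  proof (induction m)
    case (Suc m)
    have "pcost True c W (Suc m) z z \<le> ecost c W z (z + 0) + pcost True c W m (z + 0) z"
      by (rule pcost_Suc_le) (simp add: steps_def)
    also have "\<dots> \<le> ennreal c + ennreal (real m * c)" using Suc by (intro add_mono) (auto simp: ecost_def)
    also have "\<dots> = ennreal (real (Suc m) * c)" using c by (simp add: ennreal_plus[symmetric] algebra_simps del: ennreal_plus)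
    finally show ?case .
  qed simp
  show ?thesis
  proof (cases lazy)
    case True
    have "real n * c \<le> real n * (\<tau> + c)" using t0 by (intro mult_left_mono) auto
    then show ?thesis using order_trans[OF lz[of n] ennreal_leI] True by simp
  next
    case False
    then obtain m where m: "n = 2 * m" using n by blast
    have "real n * \<tau> \<le> real n * (\<tau> + c)" using c by (intro mult_left_mono) auto
    then show ?thesis using order_trans[OF ev[of m] ennreal_leI] m by simp
  qed
qed

text \<open>From \<open>x\<close> an arm leads to a line, a family joins it to a parallel line near
  \<open>y\<close>, and an arm leads to \<open>y\<close>. An excursion to site \<open>i\<close> of
  the first line is inserted, where the surplus steps are spent. The index \<open>i\<close> stays
  free, so that a site with small \<open>\<tau> i\<close> can be chosen afterwards. The costs add up
  to \<open>2 A + 7 B\<close> because the excursion runs along the line twice and the middle part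
  uses three pieces.\<close>

lemma connect:
  fixes x y :: "int^'d"
  assumes c: "c \<ge> 0" and ab: "a \<noteq> (b::'d)"
    and ux: "l1_int ux = 1" "arm_cost (4 * J) ux x W \<le> A"
    and uy: "l1_int uy = 1" "arm_cost (4 * J) uy y W \<le> A"
    and gf: "good_families thick J B l x (4 * l) W" and l: "dst x y + 20 * J \<le> l"
  shows "\<exists>\<tau>. (\<forall>i. 0 \<le> \<tau> i) \<and> (\<Sum>i<l. \<tau> i) \<le> B \<and> (\<forall>i<l. \<forall>n. admissible lazy n x y \<longrightarrow>
     thickness thick * (dst x y + 40 * J + 2 * i) \<le> n \<longrightarrow>
     pcost lazy c W n x y \<le> ennreal (2 * A + 7 * B + real n * (\<tau> i + c)))"
proof -
  let ?\<kappa> = "thickness thick"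
  have gx: "good_families thick J B l x (4 * J) W"
    unfolding good_families_def
  proof (intro allI impI)
    fix d z z' assume h: "l1_int d = 1" "flat d z z'" "dst z z' \<le> l" "l1_int (z - x) \<le> int (4 * J)"
    have "l1_int (z - x) \<le> int (4 * l)" using h(4) l by simp
    then show "\<exists>j\<in>{1..J}. fam_cost thick d z z' j W \<le> B" using gf h unfolding good_families_def by blast
  qed
  have dxy: "l1_int (y - x) = int (dst x y)" by (simp add: int_dst)
  have gy: "good_families thick J B l y (4 * J) W"
    unfolding good_families_def
  proof (intro allI impI)
    fix d z z' assume h: "l1_int d = 1" "flat d z z'" "dst z z' \<le> l" "l1_int (z - y) \<le> int (4 * J)"
    have "l1_int (z - x) \<le> int (4 * l)" using l1_int_triangle_diff[of z x y] h(4) dxy l by simp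
    then show "\<exists>j\<in>{1..J}. fam_cost thick d z z' j W \<le> B" using gf h unfolding good_families_def by blast
  qed
  have l4: "4 * J \<le> l" using l by simp
  obtain x' \<tau> where x': "l1_int (x' - x) \<le> 8 * int J" "linked lazy c W ((4 + 4 * ?\<kappa>) * J) (A + B) x x'"
    "line_at lazy c W ?\<kappa> l B (axis a 1) x' \<tau>"
    by (rule reach_line[OF ux gx l4 ab])
  obtain y' \<sigma> where y': "l1_int (y' - y) \<le> 8 * int J" "linked lazy c W ((4 + 4 * ?\<kappa>) * J) (A + B) y y'"
    "line_at lazy c W ?\<kappa> l B (axis a 1) y' \<sigma>"
    by (rule reach_line[OF uy gy l4 ab])
  have d': "dst x' y' \<le> dst x y + 16 * J"
    using l1_int_triangle_diff[of y' x' y] l1_int_triangle_diff[of y x' x] l1_int_diff_commute[of x x'] x'(1) y'(1)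
    by (simp add: int_dst[symmetric] l1_int_diff_commute)
  have A0: "A \<ge> 0" using ux(2) by (smt (verit) arm_cost_def sum_nonneg abs_ge_zero)
  have B0: "B \<ge> 0" using x'(3) by (rule line_at_nonneg)
  have mid: "linked lazy c W (?\<kappa> * (dst x' y' + 8 * J)) (3 * B) x' y'"
  proof (rule join_lines[OF x'(3) y'(3) gf])
    show "l1_int (x' - x) + int l \<le> int (4 * l)" using x'(1) l by simp
    show "dst x' y' + 4 * J \<le> l" using d' l by simp
  qed
  have main: "pcost lazy c W n x y \<le> ennreal (2 * A + 7 * B + real n * (\<tau> i + c))"
    if i: "i < l" and n: "admissible lazy n x y" "?\<kappa> * (dst x y + 40 * J + 2 * i) \<le> n" for i n
  proof -
    let ?q = "x' + int i *s axis a 1"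
    have xq: "linked lazy c W (?\<kappa> * i) B x' ?q"
      using line_at_linked[OF x'(3), of 0 i] i by simp
    have 1: "linked lazy c W ((4 + 4 * ?\<kappa>) * J + ?\<kappa> * i) (A + B + B) x ?q"
      using linked_trans[OF x'(2) xq] A0 B0 by simp
    have 2: "linked lazy c W (?\<kappa> * i + ?\<kappa> * (dst x' y' + 8 * J) + (4 + 4 * ?\<kappa>) * J) (B + 3 * B + (A + B)) ?q y"
      using linked_trans[OF linked_trans[OF linked_sym[OF xq] mid] linked_sym[OF y'(2)]] A0 B0 by simp
    obtain n1 n2 where n1: "n1 \<le> (4 + 4 * ?\<kappa>) * J + ?\<kappa> * i" "pcost lazy c W n1 x ?q \<le> ennreal (A + B + B)"
      and n2: "n2 \<le> ?\<kappa> * i + ?\<kappa> * (dst x' y' + 8 * J) + (4 + 4 * ?\<kappa>) * J" "pcost lazy c W n2 ?q y \<le> ennreal (B + 3 * B + (A + B))"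
      using 1 2 unfolding linked_def by blast
    \<comment> \<open>Two approaches of \<open>(4 + 4 * ?\<kappa>) * J\<close> steps, an excursion
      of \<open>?\<kappa> * 2 * i\<close>, and \<open>?\<kappa> * (dst x y + 16 * J + 8 * J)\<close>
      for the middle; as \<open>?\<kappa> \<ge> 1\<close>, the terms in \<open>J\<close> are at most
      \<open>40 * ?\<kappa> * J\<close>.\<close>
    have le: "n1 + n2 \<le> n"
    proof -
      have "n1 + n2 \<le> 2 * ((4 + 4 * ?\<kappa>) * J) + ?\<kappa> * (2 * i) + ?\<kappa> * (dst x' y' + 8 * J)" using n1(1) n2(1) by simp
      also have "\<dots> \<le> ?\<kappa> * (dst x y + 40 * J + 2 * i)" using d' by (cases thick) auto
      finally show ?thesis using n(2) by simp
    qed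
    have "pcost lazy c W (n1 + n2) x y \<le> pcost lazy c W n1 x ?q + pcost lazy c W n2 ?q y" by (rule pcost_triangle)
    also have "\<dots> < \<infinity>" using n1(2) n2(2) by (simp add: ennreal_add_less_top le_less_trans[OF _ ennreal_less_top])
    \<comment> \<open>The constructed route exists, so its length has the right parity, and the
      surplus is even unless zero steps are allowed.\<close>
    finally have "admissible lazy (n1 + n2) x y" by (rule pcost_finite_admissible)
    then have ev: "lazy \<or> even (n - (n1 + n2))" using n(1) le unfolding admissible_def by auto
    obtain w where w: "l1_int w = 1" "\<bar>W {?q, ?q + w}\<bar> \<le> \<tau> i" using x'(3) i unfolding line_at_def by blast
    have t0: "0 \<le> \<tau> i" using x'(3) unfolding line_at_def by blast
    have "pcost lazy c W (n1 + ((n - (n1 + n2)) + n2)) x y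
      \<le> pcost lazy c W n1 x ?q + (pcost lazy c W (n - (n1 + n2)) ?q ?q + pcost lazy c W n2 ?q y)"
      by (rule order_trans[OF pcost_triangle add_left_mono[OF pcost_triangle]])
    also have "\<dots> \<le> ennreal (A + B + B) + (ennreal (real (n - (n1 + n2)) * (\<tau> i + c)) + ennreal (B + 3 * B + (A + B)))"
      by (intro add_mono n1(2) n2(2) pcost_loop[where W=W and z="?q", OF w c ev])
    also have "\<dots> = ennreal ((A + B + B) + (real (n - (n1 + n2)) * (\<tau> i + c) + (B + 3 * B + (A + B))))"
    proof -
      have "ennreal u + (ennreal v + ennreal w) = ennreal (u + (v + w))" if "0 \<le> u" "0 \<le> v" "0 \<le> w" for u v w
        using that by simp
      then show ?thesis using A0 B0 t0 c by (metis add_nonneg_nonneg mult_nonneg_nonneg of_nat_0_le_iff zero_le_numeral)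
    qed
    also have "\<dots> \<le> ennreal (2 * A + 7 * B + real n * (\<tau> i + c))"
    proof -
      have "real (n - (n1 + n2)) * (\<tau> i + c) \<le> real n * (\<tau> i + c)" using t0 c by (intro mult_right_mono) auto
      then show ?thesis by (intro ennreal_leI) simp
    qed
    finally show ?thesis using le by simp
  qed
  show ?thesis
    by (rule exI[of _ \<tau>], intro conjI allI impI main) (use x'(3) in \<open>simp_all add: line_at_def\<close>)
qed

section \<open>Moments and almost sure connection costs\<close>

definition units :: "(int^'d) set" where "units = {u. l1_int u = 1}"

lemma finite_units: "finite units"
  unfolding units_def by (rule finite_subset[OF _ finite_l1_ball[of 1]]) auto

lemma card_units: "card (units :: (int^'d) set) \<ge> 2 * CARD('d)"
proof -
  let ?f = "\<lambda>(i, s). axis i s :: int^'d"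
  have "inj_on ?f (UNIV \<times> {1, -1})"
    by (auto simp: inj_on_def axis_eq_axis)
  then have "card (?f ` (UNIV \<times> {1, -1})) = card (UNIV \<times> {1, -1 :: int} :: ('d \<times> int) set)" by (rule card_image)
  also have "\<dots> = 2 * CARD('d)" by (simp add: card_cartesian_product)
  finally have "card (?f ` (UNIV \<times> {1, -1})) = 2 * CARD('d)" .
  moreover have "card (?f ` (UNIV \<times> {1, -1})) \<le> card (units :: (int^'d) set)"
    by (rule card_mono[OF finite_units]) (auto simp: units_def)
  ultimately show ?thesis by simp
qed

definition arm_min :: "nat \<Rightarrow> int^'d \<Rightarrow> ((int^'d) set \<Rightarrow> real) \<Rightarrow> real" where
  "arm_min n x W = Min ((\<lambda>u. arm_cost n u x W) ` units)"

lemma units_ne: "units \<noteq> {}"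
proof -
  have "axis undefined 1 \<in> units" by (simp add: units_def)
  then show ?thesis by blast
qed

lemma arm_cost_nonneg: "0 \<le> arm_cost n u x W"
  by (simp add: arm_cost_def sum_nonneg)

lemma arm_min_nonneg: "0 \<le> arm_min n x W"
  unfolding arm_min_def using finite_units units_ne by (intro Min.boundedI) (auto simp: arm_cost_nonneg)

lemma arm_min_attained: "\<exists>u. l1_int u = 1 \<and> arm_cost n u x W = arm_min n x W"
proof -
  have "arm_min n x W \<in> (\<lambda>u. arm_cost n u x W) ` units"
    unfolding arm_min_def using finite_units units_ne by (intro Min_in) auto
  then show ?thesis by (auto simp: units_def)
qed

lemma arm_edge: "l1_int u = 1 \<Longrightarrow> {x + int r *s u, x + int (Suc r) *s u} \<in> lattice_edges"
proof -
  assume u: "l1_int u = 1"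
  have "x + int r *s u - (x + int (Suc r) *s u) = - u" by (simp add: vec_eq_iff algebra_simps)
  then show ?thesis using u by (simp add: edge_iff)
qed

text \<open>The far end of an edge of an arm is \<open>x\<close> plus a positive multiple of
  \<open>u\<close>, and its distance from \<open>x\<close> gives the multiple back; so one edge
  determines the direction.\<close>

lemma arm_edges_distinct:
  assumes u: "l1_int u = 1" "l1_int u' = 1"
    and eq: "{x + int r *s u, x + int (Suc r) *s u} = {x + int r' *s u', x + int (Suc r') *s u'}"
  shows "u = u'"
proof -
  have "x + int (Suc r) *s u \<in> {x + int r' *s u', x + int (Suc r') *s u'}" using eq by blast
  then have "int (Suc r) *s u = int r' *s u' \<or> int (Suc r) *s u = int (Suc r') *s u'"
    by (metis insertE singletonD add_left_cancel)
  then obtain k where k: "int (Suc r) *s u = int k *s u'" by blast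
  then have "l1_int (int (Suc r) *s u) = l1_int (int k *s u')" by simp
  then have "Suc r = k" using u by (simp only: l1_int_scale) simp
  then show ?thesis using k by (auto simp: vec_eq_iff)
qed

lemma arm_min_shift: "arm_min n x W = arm_min n 0 (shiftW x W)"
proof -
  have "arm_cost n u x W = arm_cost n u 0 (shiftW x W)" if "u \<in> units" for u
    unfolding arm_cost_def
  proof (intro sum.cong refl)
    fix r
    have "{0 + int r *s u, 0 + int (Suc r) *s u} \<in> lattice_edges"
      by (rule arm_edge) (use that in \<open>simp add: units_def\<close>)
    then show "\<bar>W {x + int r *s u, x + int (Suc r) *s u}\<bar> = \<bar>shiftW x W {0 + int r *s u, 0 + int (Suc r) *s u}\<bar>"
      by (simp add: shiftW_def)
  qed
  then show ?thesis unfolding arm_min_def by (intro arg_cong[where f=Min] image_cong) auto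
qed

text \<open>Single edges (\<open>False\<close>) in \<open>2d\<close> parallel copies: this minimum
  inherits a moment of order \<open>d\<close> from the hypothesis. The copies are numbered from
  \<open>1\<close>, as in \<open>good_families\<close>.\<close>

definition fam_min :: "nat \<Rightarrow> int^'d \<Rightarrow> int^'d \<Rightarrow> int^'d \<Rightarrow> ((int^'d) set \<Rightarrow> real) \<Rightarrow> real" where
  "fam_min n d z z' W = Min ((\<lambda>i. fam_cost False d z z' (Suc i) W) ` {..<n})"

context iid_env begin

text \<open>With \<open>J = 8d + 8\<close> parallel paths per family the failure probability \<open>O(l powr (-J/4))\<close> beats the
  \<open>O(l ^ (2d))\<close> choices of endpoints and remains summable in \<open>l\<close>.\<close>

definition JJ :: nat where "JJ = 8 * CARD('d) + 8"

lemma arm_min_measurable: "arm_min n x \<in> borel_measurable P"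
  unfolding arm_min_def[abs_def] arm_cost_def[abs_def]
proof (rule borel_measurable_Min[OF finite_units])
  fix u :: "int^'d" assume "u \<in> units"
  then show "(\<lambda>W. \<Sum>r<n. \<bar>W {x + int r *s u, x + int (Suc r) *s u}\<bar>) \<in> borel_measurable P"
    by (intro borel_measurable_sum borel_measurable_abs measurable_edge arm_edge) (simp add: units_def)
qed

text \<open>Arms in \<open>2d\<close> distinct unit directions share no edge, so
  \<open>min_sum_moment\<close> applies to them.\<close>

lemma arm_min_moment: "(\<integral>\<^sup>+W. ennreal (arm_min n x W ^ CARD('d)) \<partial>P) < \<infinity>"
proof -
  let ?I = "{..<2 * CARD('d)}"
  have "card ?I \<le> card (units :: (int^'d) set)" using card_units[where 'd='d] by simp
  then obtain f where f: "f ` ?I \<subseteq> (units :: (int^'d) set)" "inj_on f ?I"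
    using card_le_inj[of ?I "units :: (int^'d) set"] finite_units by auto
  let ?\<phi> = "\<lambda>i r. {x + int r *s f i, x + int (Suc r) *s f i}"
  have "(\<integral>\<^sup>+W. ennreal (arm_min n x W ^ CARD('d)) \<partial>P)
    \<le> (\<integral>\<^sup>+W. ennreal ((Min ((\<lambda>i. \<Sum>r<n. \<bar>W (?\<phi> i r)\<bar>) ` ?I)) ^ CARD('d)) \<partial>P)"
  proof (intro nn_integral_mono ennreal_leI power_mono)
    fix W :: "(int^'d) set \<Rightarrow> real"
    have "(\<lambda>i. \<Sum>r<n. \<bar>W (?\<phi> i r)\<bar>) ` ?I \<subseteq> (\<lambda>u. arm_cost n u x W) ` units"
      using f(1) by (auto simp: arm_cost_def)
    then show "arm_min n x W \<le> Min ((\<lambda>i. \<Sum>r<n. \<bar>W (?\<phi> i r)\<bar>) ` ?I)"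
      unfolding arm_min_def using finite_units by (intro Min_antimono) (auto simp: lessThan_empty_iff)
  qed (rule arm_min_nonneg)
  also have "\<dots> < \<infinity>"
  proof (rule min_sum_moment)
    have u: "l1_int (f i) = 1" if "i < 2 * CARD('d)" for i using f(1) that by (auto simp: units_def)
    show "?\<phi> i r \<in> lattice_edges" if "i < 2 * CARD('d)" for i r by (rule arm_edge[OF u[OF that]])
    show "?\<phi> i r \<noteq> ?\<phi> i' r'" if "i < 2 * CARD('d)" "i' < 2 * CARD('d)" "i \<noteq> i'" for i i' r r'
      using arm_edges_distinct[OF u[OF that(1)] u[OF that(2)], of x r r'] inj_onD[OF f(2), of i i'] that by blast
  qed
  finally show ?thesis .
qed

lemma fam_min_moment:
  assumes d: "l1_int d = 1" and fl: "flat d z z'"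
  shows "(\<integral>\<^sup>+W. ennreal (fam_min (2 * CARD('d)) d z z' W ^ CARD('d)) \<partial>P) < \<infinity>"
  unfolding fam_min_def fam_cost_def sedge_def if_False
proof (rule min_sum_moment)
  fix i i' r r'
  let ?e = "\<lambda>i r. {fam_pt d z z' (Suc i) r, fam_pt d z z' (Suc i) (Suc r)}"
  assume r: "r < dst z z'"
  show "?e i r \<in> lattice_edges"
    using fam_step[OF r, of d "Suc i"] by (simp add: edge_iff l1_int_diff_commute)
  assume r': "r' < dst z z'" and i: "i \<noteq> i'"
  show "?e i r \<noteq> ?e i' r'"
  proof
    assume eq: "?e i r = ?e i' r'"
    have "?e i r \<in> sedge_edges d (fam_pt d z z' (Suc i) r) (fam_pt d z z' (Suc i) (Suc r))"
      "?e i' r' \<in> sedge_edges d (fam_pt d z z' (Suc i') r') (fam_pt d z z' (Suc i') (Suc r'))"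
      by (simp_all add: sedge_edges_def)
    moreover have "sedge_edges d (fam_pt d z z' (Suc i) r) (fam_pt d z z' (Suc i) (Suc r)) \<inter>
      sedge_edges d (fam_pt d z z' (Suc i') r') (fam_pt d z z' (Suc i') (Suc r')) = {}"
      by (rule fam_disjoint_members[OF d fl _ r r']) (use i in simp)
    ultimately show False unfolding eq by (metis IntI empty_iff)
  qed
qed

section \<open>Second moments of passage costs\<close>

definition sq_int :: "(((int^'d) set \<Rightarrow> real) \<Rightarrow> real) \<Rightarrow> bool" where
  "sq_int X \<longleftrightarrow> X \<in> borel_measurable P \<and> (\<integral>\<^sup>+W. ennreal ((X W)\<^sup>2) \<partial>P) < \<infinity>"

lemma sq_int_const: "sq_int (\<lambda>_. r)"
  by (simp add: sq_int_def P.emeasure_space_1)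

lemma sq_int_cmult: "sq_int X \<Longrightarrow> sq_int (\<lambda>W. r * X W)"
proof -
  assume X: "sq_int X"
  then have m: "(\<lambda>W. ennreal ((X W)\<^sup>2)) \<in> borel_measurable P" by (auto simp: sq_int_def)
  have "(\<integral>\<^sup>+W. ennreal ((r * X W)\<^sup>2) \<partial>P) = (\<integral>\<^sup>+W. ennreal (r\<^sup>2) * ennreal ((X W)\<^sup>2) \<partial>P)"
    by (intro nn_integral_cong) (simp only: power_mult_distrib ennreal_mult' zero_le_power2)
  also have "\<dots> = ennreal (r\<^sup>2) * (\<integral>\<^sup>+W. ennreal ((X W)\<^sup>2) \<partial>P)" by (rule nn_integral_cmult[OF m])
  also have "\<dots> < \<infinity>" using X by (simp add: sq_int_def ennreal_mult_less_top)
  finally show ?thesis using X borel_measurable_times[of "\<lambda>_. r" P X] unfolding sq_int_def by simp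
qed

lemma sq_int_add:
  assumes "sq_int X" "sq_int Y" shows "sq_int (\<lambda>W. X W + Y W)"
proof -
  have m: "X \<in> borel_measurable P" "Y \<in> borel_measurable P" using assms by (auto simp: sq_int_def)
  have "(\<integral>\<^sup>+W. ennreal ((X W + Y W)\<^sup>2) \<partial>P) \<le> (\<integral>\<^sup>+W. 2 * (ennreal ((X W)\<^sup>2) + ennreal ((Y W)\<^sup>2)) \<partial>P)"
  proof (intro nn_integral_mono)
    fix W
    have "(X W + Y W)\<^sup>2 \<le> 2 * ((X W)\<^sup>2 + (Y W)\<^sup>2)"
      using sum_squares_bound[of "X W" "Y W"] by (simp add: power2_sum)
    then have "ennreal ((X W + Y W)\<^sup>2) \<le> ennreal (2 * ((X W)\<^sup>2 + (Y W)\<^sup>2))" by (rule ennreal_leI)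
    also have "\<dots> = 2 * (ennreal ((X W)\<^sup>2) + ennreal ((Y W)\<^sup>2))" by (simp add: ennreal_mult')
    finally show "ennreal ((X W + Y W)\<^sup>2) \<le> 2 * (ennreal ((X W)\<^sup>2) + ennreal ((Y W)\<^sup>2))" .
  qed
  also have "\<dots> = 2 * ((\<integral>\<^sup>+W. ennreal ((X W)\<^sup>2) \<partial>P) + (\<integral>\<^sup>+W. ennreal ((Y W)\<^sup>2) \<partial>P))"
    using m by (simp add: nn_integral_cmult nn_integral_add)
  also have "\<dots> < \<infinity>" using assms by (simp add: sq_int_def ennreal_mult_less_top)
  finally show ?thesis using m by (simp add: sq_int_def)
qed

lemma sq_int_sum: "finite S \<Longrightarrow> (\<And>k. k \<in> S \<Longrightarrow> sq_int (X k)) \<Longrightarrow> sq_int (\<lambda>W. \<Sum>k\<in>S. X k W)"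
proof (induction S rule: finite_induct)
  case empty
  then show ?case by (simp add: sq_int_const)
next
  case (insert k S)
  then have "sq_int (\<lambda>W. X k W + (\<Sum>k\<in>S. X k W))" by (intro sq_int_add) auto
  then show ?case using insert(1,2) by simp
qed

text \<open>The dimension is at least two, so a moment of order \<open>d\<close> controls the second
  moment.\<close>

lemma sq_int_of_moment:
  assumes "X \<in> borel_measurable P" "\<And>W. 0 \<le> X W" "(\<integral>\<^sup>+W. ennreal (X W ^ CARD('d)) \<partial>P) < \<infinity>"
  shows "sq_int X"
proof -
  have "(\<integral>\<^sup>+W. ennreal ((X W)\<^sup>2) \<partial>P) \<le> (\<integral>\<^sup>+W. 1 + ennreal (X W ^ CARD('d)) \<partial>P)"
  proof (intro nn_integral_mono)
    fix W
    have "(X W)\<^sup>2 \<le> 1 + X W ^ CARD('d)"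
    proof (cases "X W \<le> 1")
      case True
      then have "(X W)\<^sup>2 \<le> 1" using assms(2)[of W] by (simp add: power_le_one)
      then show ?thesis using assms(2)[of W] by (smt (verit) zero_le_power)
    next
      case False
      then have "(X W)\<^sup>2 \<le> X W ^ CARD('d)" using dim2 by (intro power_increasing) auto
      then show ?thesis by simp
    qed
    then have "ennreal ((X W)\<^sup>2) \<le> ennreal (1 + X W ^ CARD('d))" by (rule ennreal_leI)
    then show "ennreal ((X W)\<^sup>2) \<le> 1 + ennreal (X W ^ CARD('d))" using assms(2)[of W] by simp
  qed
  also have "\<dots> = 1 + (\<integral>\<^sup>+W. ennreal (X W ^ CARD('d)) \<partial>P)"
    using assms(1) by (simp add: nn_integral_add P.emeasure_space_1)
  also have "\<dots> < \<infinity>" using assms(3) by simp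
  finally show ?thesis using assms(1) by (simp add: sq_int_def)
qed

lemma two_axes: "\<exists>a b :: 'd. a \<noteq> b"
proof (rule ccontr)
  assume "\<nexists>a b :: 'd. a \<noteq> b"
  then have "(UNIV :: 'd set) \<subseteq> {undefined}" by blast
  then have "CARD('d) \<le> card {undefined :: 'd}" by (intro card_mono) auto
  then show False using dim2 by simp
qed

text \<open>For a fixed endpoint only finitely many families can occur, so with the sum
  \<open>B\<close> of their minima as bound \<open>good_families\<close> holds for every
  configuration; this sum and the arm costs are square integrable. Second moments are what
  Chebyshev's inequality on rays asks for.\<close>

lemma pcost_square_integrable:
  fixes x :: "int^'d"
  assumes c: "c \<ge> 0" and adm: "admissible lazy n 0 x" and n: "dst 0 x + 40 * JJ \<le> n"
  shows "(\<integral>\<^sup>+W. (pcost lazy c W n 0 x)\<^sup>2 \<partial>P) < \<infinity>"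
proof -
  obtain a b :: 'd where ab: "a \<noteq> b" using two_axes by blast
  define l where "l = dst 0 x + 20 * JJ"
  define S where "S = {(d, z, z'). l1_int (d::int^'d) = 1 \<and> flat d z z' \<and> dst z z' \<le> l \<and> l1_int z \<le> int (4 * l)}"
  have S: "finite S"
  proof (rule finite_subset)
    show "S \<subseteq> {d. l1_int d \<le> 1} \<times> {z. l1_int z \<le> int (4 * l)} \<times> {z. l1_int z \<le> int (5 * l)}"
    proof (clarsimp simp: S_def)
      fix z z' :: "int^'d" assume "dst z z' \<le> l" "l1_int z \<le> 4 * int l"
      then show "l1_int z' \<le> 5 * int l" using l1_int_triangle[of z "z' - z"] by (simp add: int_dst[symmetric])
    qed
  qed (intro finite_cartesian_product finite_l1_ball)
  let ?N = "2 * CARD('d)"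
  define A where "A W = arm_min (4 * JJ) 0 W + arm_min (4 * JJ) x W" for W
  define B where "B W = (\<Sum>(d, z, z')\<in>S. fam_min ?N d z z' W)" for W
  have fam0: "0 \<le> fam_min ?N d z z' W" for d z z' W
    unfolding fam_min_def by (intro Min.boundedI) (auto simp: fam_cost_nonneg lessThan_empty_iff)
  have sqA: "sq_int A"
    unfolding A_def by (intro sq_int_add sq_int_of_moment arm_min_measurable arm_min_nonneg arm_min_moment)
  have "sq_int (\<lambda>W. \<Sum>k\<in>S. (case k of (d, z, z') \<Rightarrow> fam_min ?N d z z' W))"
  proof (rule sq_int_sum[OF S], clarify)
    fix d z z' assume k: "(d, z, z') \<in> S"
    then have d: "l1_int d = 1" "flat d z z'" by (auto simp: S_def)
    have "fam_min ?N d z z' \<in> borel_measurable P"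
      unfolding fam_min_def[abs_def] by (rule borel_measurable_Min) (auto intro: measurable_fam_cost d)
    then show "sq_int (\<lambda>W. fam_min ?N d z z' W)"
      by (intro sq_int_of_moment fam0 fam_min_moment d)
  qed
  then have sqB: "sq_int B" by (simp add: B_def[abs_def] case_prod_unfold)
  have le: "pcost lazy c W n 0 x \<le> ennreal (2 * A W + (7 + real n) * B W + real n * c)" for W
  proof -
    obtain u where u: "l1_int u = 1" "arm_cost (4 * JJ) u 0 W = arm_min (4 * JJ) 0 W" using arm_min_attained by blast
    obtain u' where u': "l1_int u' = 1" "arm_cost (4 * JJ) u' x W = arm_min (4 * JJ) x W" using arm_min_attained by blast
    have gf: "good_families False JJ (B W) l 0 (4 * l) W"
      unfolding good_families_def
    proof (intro allI impI)
      fix d z z' :: "int^'d" assume h: "l1_int d = 1" "flat d z z'" "dst z z' \<le> l" "l1_int (z - 0) \<le> int (4 * l)"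
      then have k: "(d, z, z') \<in> S" by (simp add: S_def)
      have "fam_min ?N d z z' W \<in> (\<lambda>i. fam_cost False d z z' (Suc i) W) ` {..<?N}"
        unfolding fam_min_def by (intro Min_in) (auto simp: lessThan_empty_iff)
      then obtain i where i: "i < ?N" "fam_cost False d z z' (Suc i) W = fam_min ?N d z z' W" by auto
      have "fam_min ?N d z z' W \<le> B W"
        unfolding B_def using member_le_sum[OF k _ S, of "\<lambda>(d, z, z'). fam_min ?N d z z' W"] fam0 by auto
      \<comment> \<open>Here \<open>2d \<le> JJ\<close> is used: the minimising copy is among the
        first \<open>JJ\<close>.\<close>
      then show "\<exists>j\<in>{1..JJ}. fam_cost False d z z' j W \<le> B W"
        using i by (intro bexI[of _ "Suc i"]) (auto simp: JJ_def)
    qed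
    have a: "arm_cost (4 * JJ) u 0 W \<le> A W" "arm_cost (4 * JJ) u' x W \<le> A W"
      using u u' arm_min_nonneg[of "4 * JJ" 0 W] arm_min_nonneg[of "4 * JJ" x W] by (simp_all add: A_def)
    obtain \<tau> where \<tau>: "\<forall>i. 0 \<le> \<tau> i" "(\<Sum>i<l. \<tau> i) \<le> B W"
      "\<forall>i<l. \<forall>n. admissible lazy n 0 x \<longrightarrow> thickness False * (dst 0 x + 40 * JJ + 2 * i) \<le> n \<longrightarrow>
         pcost lazy c W n 0 x \<le> ennreal (2 * A W + 7 * B W + real n * (\<tau> i + c))"
      using connect[OF c ab u(1) a(1) u'(1) a(2) gf, of lazy] by (auto simp: l_def)
    have l0: "0 < l" by (simp add: l_def JJ_def)
    \<comment> \<open>With \<open>n\<close> fixed, the crude bound of \<open>\<tau> 0\<close> by the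
      total cost of the line is enough.\<close>
    have "\<tau> 0 \<le> (\<Sum>i<l. \<tau> i)" using l0 \<tau>(1) by (intro member_le_sum) auto
    then have t0: "\<tau> 0 \<le> B W" using \<tau>(2) by linarith
    have "pcost lazy c W n 0 x \<le> ennreal (2 * A W + 7 * B W + real n * (\<tau> 0 + c))"
      using \<tau>(3)[rule_format, OF l0 adm] n by simp
    also have "\<dots> \<le> ennreal (2 * A W + (7 + real n) * B W + real n * c)"
    proof (rule ennreal_leI)
      have "real n * \<tau> 0 \<le> real n * B W" using t0 by (intro mult_left_mono) auto
      then show "2 * A W + 7 * B W + real n * (\<tau> 0 + c) \<le> 2 * A W + (7 + real n) * B W + real n * c"
        by (simp add: algebra_simps)
    qed
    finally show ?thesis .
  qed
  have pos: "0 \<le> 2 * A W + (7 + real n) * B W + real n * c" for W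
    using c fam0 by (auto simp: A_def B_def intro!: add_nonneg_nonneg mult_nonneg_nonneg arm_min_nonneg sum_nonneg)
  have "sq_int (\<lambda>W. 2 * A W + (7 + real n) * B W + real n * c)"
    by (intro sq_int_add sq_int_cmult sq_int_const sqA sqB)
  then have fin: "(\<integral>\<^sup>+W. ennreal ((2 * A W + (7 + real n) * B W + real n * c)\<^sup>2) \<partial>P) < \<infinity>" by (simp add: sq_int_def)
  have "(\<integral>\<^sup>+W. (pcost lazy c W n 0 x)\<^sup>2 \<partial>P) \<le> (\<integral>\<^sup>+W. ennreal ((2 * A W + (7 + real n) * B W + real n * c)\<^sup>2) \<partial>P)"
  proof (intro nn_integral_mono)
    fix W
    have "(pcost lazy c W n 0 x)\<^sup>2 \<le> (ennreal (2 * A W + (7 + real n) * B W + real n * c))\<^sup>2"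
      by (intro power_mono le) simp
    then show "(pcost lazy c W n 0 x)\<^sup>2 \<le> ennreal ((2 * A W + (7 + real n) * B W + real n * c)\<^sup>2)"
      using pos[of W] by (simp add: ennreal_power)
  qed
  then show ?thesis using fin by (rule le_less_trans)
qed

text \<open>A union bound over directions and endpoints at scale \<open>l\<close>, followed by
  Borel-Cantelli. The constant \<open>C\<close> comes before \<open>\<Lambda>\<close> in the
  quantifiers: later \<open>\<Lambda>\<close> depends on \<open>\<eta>\<close>, and
  \<open>\<eta>\<close> depends on \<open>C\<close>.\<close>

lemma families_AE:
  "\<exists>C>0. \<forall>\<Lambda>::nat. AE W in P. \<forall>\<^sub>F l in sequentially. \<forall>x::int^'d. l1_int x \<le> int (\<Lambda> * l) \<longrightarrow>
     good_families True JJ (C * real l) l x (4 * l) W"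
proof -
  obtain C K where CK: "C > 0" "K \<ge> 0" "\<And>d z z' l J. l1_int (d::int^'d) = 1 \<Longrightarrow> flat d z z' \<Longrightarrow> l \<ge> 1 \<Longrightarrow> dst z z' \<le> l \<Longrightarrow>
     P.prob {W\<in>space P. bad_family True J (C * real l) d z z' W} \<le> (K * real l powr (-1/4)) ^ J"
    using thick_family_tail by blast
  have main: "AE W in P. \<forall>\<^sub>F l in sequentially. \<forall>x::int^'d. l1_int x \<le> int (\<Lambda> * l) \<longrightarrow>
     good_families True JJ (C * real l) l x (4 * l) W" for \<Lambda> :: nat
  proof -
    \<comment> \<open>A start lies within \<open>4 l\<close> of a point of norm at most
      \<open>\<Lambda> l\<close>, and the end within a further \<open>l\<close>.\<close>
    define m where "m = \<Lambda> + 5"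
    define Bx where "Bx l = {z::int^'d. \<forall>i. \<bar>z $ i\<bar> \<le> int (m * l)}" for l :: nat
    define S where "S l = {(d, z, z'). l1_int (d::int^'d) = 1 \<and> flat d z z' \<and> dst z z' \<le> l \<and> z \<in> Bx l \<and> z' \<in> Bx l}" for l
    have sub: "S l \<subseteq> units \<times> Bx l \<times> Bx l" for l by (auto simp: S_def units_def)
    have fB: "finite (Bx l)" for l unfolding Bx_def by (rule finite_int_box)
    have fS: "finite (S l)" for l using sub by (rule finite_subset) (intro finite_cartesian_product finite_units fB)
    define U where "U = real (card (units :: (int^'d) set))"
    have cS: "real (card (S l)) \<le> U * (real (3 * m) * real l) ^ (2 * CARD('d))" if l: "l \<ge> 1" for l
    proof -
      have cB: "real (card (Bx l)) \<le> (real (3 * m) * real l) ^ CARD('d)"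
      proof -
        have "real (card (Bx l)) \<le> (2 * real_of_int (int (m * l)) + 1) ^ CARD('d)"
          unfolding Bx_def by (rule card_int_box) simp
        also have "\<dots> \<le> (real (3 * m) * real l) ^ CARD('d)"
        proof (intro power_mono)
          have "1 \<le> m * l" using l by (simp add: m_def)
          then have "2 * (m * l) + 1 \<le> 3 * m * l" by simp
          then show "2 * real_of_int (int (m * l)) + 1 \<le> real (3 * m) * real l"
            by (metis (mono_tags, lifting) of_int_of_nat_eq of_nat_1 of_nat_add of_nat_le_iff of_nat_mult of_nat_numeral)
        qed simp
        finally show ?thesis .
      qed
      have "card (S l) \<le> card ((units :: (int^'d) set) \<times> Bx l \<times> Bx l)"
        by (intro card_mono sub finite_cartesian_product finite_units fB)
      then have "real (card (S l)) \<le> U * (real (card (Bx l)) * real (card (Bx l)))"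
        unfolding U_def by (simp add: card_cartesian_product flip: of_nat_mult)
      also have "\<dots> \<le> U * ((real (3 * m) * real l) ^ CARD('d) * (real (3 * m) * real l) ^ CARD('d))"
        using cB by (intro mult_left_mono mult_mono) (auto simp: U_def)
      also have "\<dots> = U * (real (3 * m) * real l) ^ (2 * CARD('d))" by (simp add: mult_2 power_add)
      finally show ?thesis .
    qed
    let ?bad = "\<lambda>l. \<Union>(d, z, z')\<in>S l. {W\<in>space P. bad_family True JJ (C * real l) d z z' W}"
    have bm: "{W\<in>space P. bad_family True JJ (C * real l) d z z' W} \<in> sets P" if "(d, z, z') \<in> S l" for l d z z'
    proof -
      have d: "l1_int d = 1" using that by (simp add: S_def)
      have "{W\<in>space P. C * real l \<le> fam_cost True d z z' j W} \<in> sets P" for j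
        using measurable_fam_cost[OF d, of True z z' j] by measurable
      then show ?thesis unfolding bad_family_def by (intro sets.sets_Collect_finite_All) auto
    qed
    have badm: "?bad l \<in> sets P" for l
      using fS bm by (intro sets.finite_UN) (auto simp: case_prod_unfold)
    define KK where "KK = U * real (3 * m) ^ (2 * CARD('d)) * K ^ JJ"
    have pb: "P.prob (?bad l) \<le> KK * real l powr (-2)" if l: "l \<ge> 1" for l
    proof -
      have "P.prob (?bad l) \<le> (\<Sum>k\<in>S l. P.prob (case k of (d, z, z') \<Rightarrow> {W\<in>space P. bad_family True JJ (C * real l) d z z' W}))"
        using bm by (intro measure_UNION_le fS) (auto split: prod.split)
      also have "\<dots> \<le> (\<Sum>k\<in>S l. (K * real l powr (-1/4)) ^ JJ)"
      proof (intro sum_mono, clarify)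
        fix d z z' assume "(d, z, z') \<in> S l"
        then show "P.prob {W\<in>space P. bad_family True JJ (C * real l) d z z' W} \<le> (K * real l powr (-1/4)) ^ JJ"
          using l by (intro CK(3)) (auto simp: S_def)
      qed
      also have "\<dots> = real (card (S l)) * (K ^ JJ * (real l powr (-1/4)) ^ JJ)" by (simp add: power_mult_distrib)
      also have "\<dots> \<le> (U * (real (3 * m) * real l) ^ (2 * CARD('d))) * (K ^ JJ * (real l powr (-1/4)) ^ JJ)"
        using cS[OF l] CK(2) by (intro mult_right_mono) auto
      also have "\<dots> = KK * (real l ^ (2 * CARD('d)) * (real l powr (-1/4)) ^ JJ)"
        unfolding KK_def power_mult_distrib by simp
      also have "real l ^ (2 * CARD('d)) * (real l powr (-1/4)) ^ JJ = real l powr (-2)"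
      proof -
        have "real l ^ (2 * CARD('d)) = real l powr (real (2 * CARD('d)))" using l by (subst powr_realpow) auto
        moreover have "(real l powr (-1/4)) ^ JJ = real l powr (- real JJ / 4)" using l by (simp add: powr_power)
        \<comment> \<open>Since \<open>JJ / 4 = 2d + 2\<close>, the summable power \<open>-2\<close>
          remains.\<close>
        moreover have "real (2 * CARD('d)) + (- real JJ / 4) = -2" by (simp add: JJ_def field_simps)
        ultimately show ?thesis by (simp only: powr_add[symmetric])
      qed
      finally show ?thesis .
    qed
    have "summable (\<lambda>l. KK * real l powr (-2))" by (intro summable_mult) (subst summable_real_powr_iff, simp)
    from P.borel_cantelli_bound[OF badm pb this]
    have "AE W in P. \<forall>\<^sub>F l in sequentially. W \<notin> ?bad l" by simp
    then show ?thesis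
    proof (rule AE_mp, intro AE_I2 impI)
      fix W assume W: "W \<in> space P" and ev: "\<forall>\<^sub>F l in sequentially. W \<notin> ?bad l"
      from ev show "\<forall>\<^sub>F l in sequentially. \<forall>x::int^'d. l1_int x \<le> int (\<Lambda> * l) \<longrightarrow> good_families True JJ (C * real l) l x (4 * l) W"
      proof (rule eventually_mono, unfold good_families_def, intro allI impI)
        fix l x d z z' assume nb: "W \<notin> ?bad l" and x: "l1_int (x::int^'d) \<le> int (\<Lambda> * l)"
          and h: "l1_int d = 1" "flat d z z'" "dst z z' \<le> l" "l1_int (z - x) \<le> int (4 * l)"
        have zz: "l1_int z \<le> int (m * l)" "l1_int z' \<le> int (m * l)"
          using l1_int_triangle[of x "z - x"] l1_int_triangle[of z "z' - z"] x h(3,4)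
          by (simp_all add: m_def int_dst[symmetric] algebra_simps)
        then have "z \<in> Bx l" "z' \<in> Bx l"
          unfolding Bx_def using abs_nth_le_l1_int by (auto intro: order_trans)
        then have "(d, z, z') \<in> S l" using h by (simp add: S_def)
        then have "\<not> bad_family True JJ (C * real l) d z z' W" using nb W by blast
        then show "\<exists>j\<in>{1..JJ}. fam_cost True d z z' j W \<le> C * real l"
          unfolding bad_family_def by (meson not_le less_imp_le)
      qed
    qed
  qed
  show ?thesis using CK(1) main by blast
qed

text \<open>Off a finite set of sites \<open>arm_min\<close> is at most
  \<open>l1_int x / (\<Lambda> + 1)\<close>, hence at most \<open>l\<close> in the region
  considered; on that set it is bounded by a random constant, which \<open>l\<close> eventually
  exceeds.\<close>

lemma arms_AE:
  "AE W in P. \<forall>\<^sub>F l in sequentially. \<forall>x::int^'d. l1_int x \<le> int (\<Lambda> * l) \<longrightarrow> arm_min n x W \<le> real l"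
proof -
  let ?Z = "\<lambda>W. {z::int^'d. real (\<Lambda> + 1) * arm_min n z W > real_of_int (l1_int z)}"
  have "AE W in P. finite (?Z W)"
    by (rule AE_finite_exceptional_sites[OF arm_min_measurable arm_min_nonneg arm_min_shift arm_min_moment])
  then show ?thesis
  proof (rule AE_mp, intro AE_I2 impI)
    fix W assume Z: "finite (?Z W)"
    define M where "M = (\<Sum>z\<in>?Z W. arm_min n z W)"
    have M: "arm_min n z W \<le> M" if "z \<in> ?Z W" for z
      unfolding M_def using Z that by (intro member_le_sum) (auto simp: arm_min_nonneg)
    show "\<forall>\<^sub>F l in sequentially. \<forall>x::int^'d. l1_int x \<le> int (\<Lambda> * l) \<longrightarrow> arm_min n x W \<le> real l"
    proof (rule eventually_sequentiallyI[of "nat \<lceil>M\<rceil>"], intro allI impI)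
      fix l and x :: "int^'d" assume l: "nat \<lceil>M\<rceil> \<le> l" and x: "l1_int x \<le> int (\<Lambda> * l)"
      show "arm_min n x W \<le> real l"
      proof (cases "x \<in> ?Z W")
        case True
        then show ?thesis using M[OF True] l by linarith
      next
        case False
        then have "real (\<Lambda> + 1) * arm_min n x W \<le> real_of_int (l1_int x)" by simp
        also have "\<dots> \<le> real (\<Lambda> * l)" using x by (metis of_int_le_iff of_int_of_nat_eq)
        also have "\<dots> \<le> real (\<Lambda> + 1) * real l" by (simp add: algebra_simps)
        finally show ?thesis by (rule mult_left_le_imp_le) simp
      qed
    qed
  qed
qed

text \<open>At scale \<open>l\<close> arms and families cost \<open>O(l)\<close>, and each surplus
  step costs \<open>O(1)\<close>, so the bound is linear in \<open>n\<close>. The factor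
  \<open>12\<close> comes from the thick steps: \<open>3 * (dst x y + 40 * JJ + 2 * i)\<close> is at
  most \<open>3 * (2 * l + 2 * l)\<close>.\<close>

lemma connection_AE:
  assumes c: "c \<ge> 0"
  shows "\<exists>C>0. \<forall>\<Lambda>::nat. AE W in P. \<forall>\<^sub>F l in sequentially. \<forall>(x::int^'d) y n.
     l1_int x \<le> int (\<Lambda> * l) \<longrightarrow> l1_int y \<le> int (\<Lambda> * l) \<longrightarrow> dst x y + 20 * JJ \<le> l \<longrightarrow> 12 * l \<le> n \<longrightarrow>
     admissible lazy n x y \<longrightarrow> pcost lazy c W n x y \<le> ennreal (C * real n)"
proof -
  obtain C where C: "C > 0" "\<And>\<Lambda>::nat. AE W in P. \<forall>\<^sub>F l in sequentially. \<forall>x::int^'d. l1_int x \<le> int (\<Lambda> * l) \<longrightarrow>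
     good_families True JJ (C * real l) l x (4 * l) W" using families_AE by blast
  obtain a b :: 'd where ab: "a \<noteq> b" using two_axes by blast
  have "AE W in P. \<forall>\<^sub>F l in sequentially. \<forall>(x::int^'d) y n.
     l1_int x \<le> int (\<Lambda> * l) \<longrightarrow> l1_int y \<le> int (\<Lambda> * l) \<longrightarrow> dst x y + 20 * JJ \<le> l \<longrightarrow> 12 * l \<le> n \<longrightarrow>
     admissible lazy n x y \<longrightarrow> pcost lazy c W n x y \<le> ennreal ((2 + 8 * C + c) * real n)" for \<Lambda> :: nat
    using C(2)[of \<Lambda>] arms_AE[of \<Lambda> "4 * JJ"]
  proof (rule AE_mp[OF _ AE_mp], intro AE_I2 impI)
    fix W
    assume ev1: "\<forall>\<^sub>F l in sequentially. \<forall>x::int^'d. l1_int x \<le> int (\<Lambda> * l) \<longrightarrow> arm_min (4 * JJ) x W \<le> real l"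
      and ev2: "\<forall>\<^sub>F l in sequentially. \<forall>x::int^'d. l1_int x \<le> int (\<Lambda> * l) \<longrightarrow> good_families True JJ (C * real l) l x (4 * l) W"
    from ev1 ev2 show "\<forall>\<^sub>F l in sequentially. \<forall>(x::int^'d) y n.
     l1_int x \<le> int (\<Lambda> * l) \<longrightarrow> l1_int y \<le> int (\<Lambda> * l) \<longrightarrow> dst x y + 20 * JJ \<le> l \<longrightarrow> 12 * l \<le> n \<longrightarrow>
     admissible lazy n x y \<longrightarrow> pcost lazy c W n x y \<le> ennreal ((2 + 8 * C + c) * real n)"
    proof (rule eventually_elim2, intro allI impI)
      fix l n and x y :: "int^'d"
      assume 1: "\<forall>x::int^'d. l1_int x \<le> int (\<Lambda> * l) \<longrightarrow> arm_min (4 * JJ) x W \<le> real l"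
        and 2: "\<forall>x::int^'d. l1_int x \<le> int (\<Lambda> * l) \<longrightarrow> good_families True JJ (C * real l) l x (4 * l) W"
        and x: "l1_int x \<le> int (\<Lambda> * l)" and y: "l1_int y \<le> int (\<Lambda> * l)" and l: "dst x y + 20 * JJ \<le> l"
        and n: "12 * l \<le> n" and adm: "admissible lazy n x y"
      obtain u where u: "l1_int u = 1" "arm_cost (4 * JJ) u x W = arm_min (4 * JJ) x W" using arm_min_attained by blast
      obtain u' where u': "l1_int u' = 1" "arm_cost (4 * JJ) u' y W = arm_min (4 * JJ) y W" using arm_min_attained by blast
      have a: "arm_cost (4 * JJ) u x W \<le> real l" "arm_cost (4 * JJ) u' y W \<le> real l" using 1 x y u u' by simp_all
      have gf: "good_families True JJ (C * real l) l x (4 * l) W" using 2 x by blast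
      obtain \<tau> where \<tau>: "\<forall>i. 0 \<le> \<tau> i" "(\<Sum>i<l. \<tau> i) \<le> C * real l"
        "\<forall>i<l. \<forall>n. admissible lazy n x y \<longrightarrow> thickness True * (dst x y + 40 * JJ + 2 * i) \<le> n \<longrightarrow>
         pcost lazy c W n x y \<le> ennreal (2 * real l + 7 * (C * real l) + real n * (\<tau> i + c))"
        using connect[OF c ab u(1) a(1) u'(1) a(2) gf l, of lazy] by blast
      have l0: "0 < l" using l by (simp add: JJ_def)
      \<comment> \<open>The \<open>l\<close> numbers \<open>\<tau> i\<close> have a sum of at most
        \<open>C * l\<close>, so one of them is at most \<open>C\<close>.\<close>
      have "\<exists>i<l. \<tau> i \<le> C"
      proof (rule ccontr)
        assume "\<not> ?thesis"
        then have "(\<Sum>i<l. C) < (\<Sum>i<l. \<tau> i)" using l0 by (intro sum_strict_mono) auto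
        then show False using \<tau>(2) by (simp add: mult.commute)
      qed
      then obtain i where i: "i < l" "\<tau> i \<le> C" by blast
      have "pcost lazy c W n x y \<le> ennreal (2 * real l + 7 * (C * real l) + real n * (\<tau> i + c))"
        using \<tau>(3)[rule_format, OF i(1) adm] n l i by simp
      also have "\<dots> \<le> ennreal ((2 + 8 * C + c) * real n)"
      proof (rule ennreal_leI)
        have "real l \<le> real n" using n by simp
        then have "2 * real l + 7 * (C * real l) \<le> 2 * real n + 7 * (C * real n)" using C(1) by (intro add_mono mult_left_mono) auto
        moreover have "real n * (\<tau> i + c) \<le> real n * (C + c)" using i by (intro mult_left_mono) auto
        ultimately show "2 * real l + 7 * (C * real l) + real n * (\<tau> i + c) \<le> (2 + 8 * C + c) * real n" by (simp add: algebra_simps)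
      qed
      finally show "pcost lazy c W n x y \<le> ennreal ((2 + 8 * C + c) * real n)" .
    qed
  qed
  moreover have "0 < 2 + 8 * C + c" using C c by simp
  ultimately show ?thesis by blast
qed

end

section \<open>A subadditive ergodic theorem\<close>

lemma ennreal_lin:
  fixes u d s t :: real
  assumes "0 \<le> u" "0 \<le> d" "0 \<le> s" "0 \<le> t"
  shows "ennreal (real E * (u + d) + s + t) = ennreal (real E) * (ennreal u + ennreal d) + ennreal s + ennreal t"
  using assms by (simp add: ennreal_mult')

context prob_space begin

text \<open>The lower half of Kingman's subadditive ergodic theorem, by the covering argument of
  Katznelson and Weiss. The upper half is a hypothesis (it follows from a law of large numbers
  here), and it spares us ergodicity: the limit inferior \<open>f\<close> satisfies \<open>f \<le> \<gamma>\<close> almost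
  surely and \<open>\<gamma> \<le> E f\<close>.\<close>

lemma subadditive_ergodic_lower:
  fixes x :: "nat \<Rightarrow> nat \<Rightarrow> 'a \<Rightarrow> real"
  assumes nonneg: "\<And>i j W. 0 \<le> x i j W" and zero: "\<And>i W. x i 0 W = 0"
    and sub: "\<And>i j k W. x i (j + k) W \<le> x i j W + x (i + j) k W"
    and T[measurable]: "T \<in> measurable M M" and pres: "distr M M T = M"
    and stat: "\<And>i j W. x (Suc i) j W = x i j (T W)"
    and meas[measurable]: "\<And>i j. x i j \<in> borel_measurable M"
    and int: "\<And>j. integrable M (x 0 j)"
    and upper: "\<And>L e. L \<ge> 1 \<Longrightarrow> e > 0 \<Longrightarrow> AE W in M. \<exists>\<^sub>F j in sequentially. x 0 j W \<le> real j * (expectation (x 0 L) / real L + e)"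
    and gam: "\<And>L. L \<ge> 1 \<Longrightarrow> real L * \<gamma> \<le> expectation (x 0 L)" and e: "e > 0"
  shows "AE W in M. \<forall>\<^sub>F j in sequentially. real j * (\<gamma> - e) \<le> x 0 j W"
proof -
  \<comment> \<open>The limit inferior of the averages started at \<open>i\<close>; as an
    \<open>ennreal\<close> it exists before anything is known about convergence or
    finiteness.\<close>
  define f where "f i W = liminf (\<lambda>j. ennreal (x i j W / real j))" for i W
  have fm[measurable]: "f i \<in> borel_measurable M" for i unfolding f_def[abs_def] by measurable
  have fT: "f (Suc i) W = f i (T W)" for i W by (simp add: f_def stat)
  have freq: "f i W \<le> ennreal a" if "\<exists>\<^sub>F j in sequentially. x i j W \<le> real j * a" "a \<ge> 0" for i W a
  proof (rule ccontr)
    assume "\<not> f i W \<le> ennreal a"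
    then have "\<forall>\<^sub>F j in sequentially. ennreal a < ennreal (x i j W / real j)"
      unfolding f_def by (intro less_LiminfD) simp
    with eventually_gt_at_top[of 0] have "\<forall>\<^sub>F j in sequentially. \<not> x i j W \<le> real j * a"
    proof eventually_elim
      case (elim j)
      then have "a < x i j W / real j" using that(2) by (simp add: ennreal_less_iff)
      then show ?case using elim(1) by (simp add: field_simps)
    qed
    then show False using that(1) by (simp add: frequently_def)
  qed
  have freq': "\<exists>\<^sub>F j in sequentially. x i j W < real j * a" if "f i W < ennreal a" for i W a
  proof (rule ccontr)
    assume "\<not> ?thesis"
    then have "\<forall>\<^sub>F j in sequentially. \<not> x i j W < real j * a" by (simp add: frequently_def)
    with eventually_gt_at_top[of 0] have "\<forall>\<^sub>F j in sequentially. ennreal a \<le> ennreal (x i j W / real j)"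
      by eventually_elim (auto intro!: ennreal_leI simp: field_simps)
    then have "ennreal a \<le> f i W" unfolding f_def by (rule Liminf_bounded)
    then show False using that by simp
  qed
  \<comment> \<open>Putting one more block in front adds a fixed amount, which is negligible after
    division by \<open>j\<close>.\<close>
  have mono: "f i W \<le> f (Suc i) W" for i W
  proof (rule ccontr)
    assume "\<not> ?thesis"
    then have "f (Suc i) W < f i W" by simp
    then obtain b' where b': "f (Suc i) W < b'" "b' < f i W" using dense by blast
    then obtain a' where a': "f (Suc i) W < a'" "a' < b'" using dense by blast
    define a where "a = enn2real a'"
    define b where "b = enn2real b'"
    have "b' < top" by (rule less_le_trans[OF b'(2) top_greatest])
    then have b: "b' = ennreal b" "b \<ge> 0" by (simp_all add: b_def ennreal_enn2real)
    have "a' < top" by (rule less_le_trans[OF a'(2) top_greatest])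
    then have a: "a' = ennreal a" "a \<ge> 0" by (simp_all add: a_def ennreal_enn2real)
    have ab: "a < b" using a'(2) a b by (simp add: ennreal_less_iff)
    have "\<exists>\<^sub>F j in sequentially. x (Suc i) j W < real j * a" using a' a by (intro freq') simp
    moreover
    have "\<forall>\<^sub>F j in sequentially. x i 1 W \<le> real j * (b - a)"
    proof -
      have "filterlim (\<lambda>j. real j * (b - a)) at_top sequentially"
        using ab by (intro filterlim_at_top_mult_tendsto_pos[OF tendsto_const _ filterlim_real_sequentially]) simp
      then show ?thesis by (simp add: filterlim_at_top)
    qed
    ultimately have "\<exists>\<^sub>F j in sequentially. x (Suc i) j W < real j * a \<and> x i 1 W \<le> real j * (b - a)"
      by (rule frequently_eventually_frequently)
    then have "\<exists>\<^sub>F j in sequentially. x i (j + 1) W \<le> real (j + 1) * b"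
    proof (rule frequently_elim1)
      fix j assume j: "x (Suc i) j W < real j * a \<and> x i 1 W \<le> real j * (b - a)" 
      have "x i (j + 1) W \<le> x i 1 W + x (Suc i) j W" using sub[of i 1 j W] by simp
      also have "\<dots> \<le> real j * b" using j by (simp add: algebra_simps)
      also have "\<dots> \<le> real (j + 1) * b" using b by (intro mult_right_mono) auto
      finally show "x i (j + 1) W \<le> real (j + 1) * b" .
    qed
    then have "\<exists>\<^sub>F j in sequentially. x i j W \<le> real j * b"
      unfolding frequently_def using eventually_sequentially_Suc[of "\<lambda>j. \<not> x i j W \<le> real j * b"] by simp
    then have "f i W \<le> ennreal b" using b by (intro freq) auto
    then show False using b'(2) b by simp
  qed
  define H where "H L = expectation (x 0 L)" for L
  have H0: "0 \<le> H L" for L unfolding H_def by (simp add: nonneg)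
  have f_le: "AE W in M. f 0 W \<le> ennreal (H L / real L)" if L: "L \<ge> 1" for L
  proof -
    have "AE W in M. \<forall>k::nat. f 0 W \<le> ennreal (H L / real L + 1 / real (Suc k))"
    proof (subst AE_all_countable, intro allI)
      fix k
      have "AE W in M. \<exists>\<^sub>F j in sequentially. x 0 j W \<le> real j * (H L / real L + 1 / real (Suc k))"
        unfolding H_def by (rule upper[OF L]) simp
      then show "AE W in M. f 0 W \<le> ennreal (H L / real L + 1 / real (Suc k))"
      proof eventually_elim
        case (elim W)
        then show ?case using H0[of L] by (intro freq) (simp_all add: add_nonneg_nonneg del: of_nat_Suc)
      qed
    qed
    then show ?thesis
    proof eventually_elim
      case (elim W)
      have "(\<lambda>k. ennreal (H L / real L + 1 / real (Suc k))) \<longlonglongrightarrow> ennreal (H L / real L + 0)"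
        by (intro tendsto_ennrealI tendsto_add tendsto_const lim_1_over_n[THEN LIMSEQ_Suc])
      then show ?case using elim by (intro LIMSEQ_le_const) auto
    qed
  qed
  have f_fin: "AE W in M. f 0 W < \<infinity>" using f_le[of 1] by (auto elim!: eventually_mono simp: le_less_trans)
  have intf: "(\<integral>\<^sup>+W. f i W \<partial>M) = (\<integral>\<^sup>+W. f 0 W \<partial>M)" for i
  proof (induction i)
    case (Suc i)
    have "(\<integral>\<^sup>+W. f (Suc i) W \<partial>M) = (\<integral>\<^sup>+W. f i (T W) \<partial>M)" by (simp add: fT)
    also have "\<dots> = (\<integral>\<^sup>+W. f i W \<partial>distr M M T)" by (subst nn_integral_distr) auto
    finally show ?case using Suc by (simp add: pres)
  qed simp
  have intf_fin: "(\<integral>\<^sup>+W. f 0 W \<partial>M) < \<infinity>"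
  proof -
    have "(\<integral>\<^sup>+W. f 0 W \<partial>M) \<le> (\<integral>\<^sup>+W. ennreal (H 1) \<partial>M)" using f_le[of 1] by (intro nn_integral_mono_AE) simp
    also have "\<dots> < \<infinity>" by (simp add: emeasure_space_1)
    finally show ?thesis .
  qed
  \<comment> \<open>\<open>f i \<le> f (Suc i)\<close> holds everywhere, and both have the same
    finite integral by stationarity, so they agree almost surely: \<open>f\<close> is
    invariant.\<close>
  have "AE W in M. f (Suc i) W \<le> f i W" for i
  proof -
    have "(\<integral>\<^sup>+W. f (Suc i) W - f i W \<partial>M) = (\<integral>\<^sup>+W. f (Suc i) W \<partial>M) - (\<integral>\<^sup>+W. f i W \<partial>M)"
      using intf[of i] intf_fin mono by (intro nn_integral_diff) auto
    also have "\<dots> = 0" using intf[of i] intf[of "Suc i"] intf_fin by simp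
    finally have "AE W in M. f (Suc i) W - f i W = 0" by (subst (asm) nn_integral_0_iff_AE) auto
    then have "AE W in M. f (Suc i) W - f i W = 0 \<and> f i W < \<infinity>"
    proof (rule AE_conjI)
      have "(\<integral>\<^sup>+W. f i W \<partial>M) \<noteq> \<infinity>" using intf[of i] intf_fin by simp
      from nn_integral_PInf_AE[OF fm this] show "AE W in M. f i W < \<infinity>" by (simp add: less_top)
    qed
    then show ?thesis by eventually_elim (auto simp: diff_eq_0_iff_ennreal)
  qed
  then have "AE W in M. \<forall>i. f (Suc i) W \<le> f i W" by (simp add: AE_all_countable)
  with f_fin have inv: "AE W in M. f 0 W < \<infinity> \<and> (\<forall>i. f i W = f 0 W)"
  proof eventually_elim
    case (elim W)
    have "f i W = f 0 W" for i
    proof (induction i)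
      case (Suc i)
      then show ?case using elim mono[of i W] by (metis antisym)
    qed simp
    then show ?case using elim by simp
  qed
  define F where "F = enn2real (\<integral>\<^sup>+W. f 0 W \<partial>M)"
  have F: "(\<integral>\<^sup>+W. f 0 W \<partial>M) = ennreal F" "F \<ge> 0" unfolding F_def using intf_fin by (simp_all add: ennreal_enn2real)
  \<comment> \<open>A start \<open>i\<close> is bad if none of the next \<open>N\<close> times
    brings the average down to \<open>f + d\<close>; by the definition of the limit inferior this
    becomes rare as \<open>N\<close> grows.\<close>
  define bad where "bad N d i W \<longleftrightarrow> (\<forall>n\<in>{1..N}. real n * (enn2real (f i W) + d) < x i n W)" for N :: nat and d i W
  have bad_meas[measurable]: "Measurable.pred M (bad N d i)" for N d i
    unfolding bad_def by measurable
  define b where "b N d i W = (if bad N d i W then x i 1 W else 0)" for N :: nat and d i W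
  have bm[measurable]: "b N d i \<in> borel_measurable M" for N d i unfolding b_def[abs_def] by measurable
  have b0: "0 \<le> b N d i W" for N d i W by (simp add: b_def nonneg)
  have stat_int: "(\<integral>\<^sup>+W. ennreal (x i j W) \<partial>M) = ennreal (H j)" for i j
  proof (induction i)
    case 0
    show ?case unfolding H_def by (intro nn_integral_eq_integral int) (simp add: nonneg)
  next
    case (Suc i)
    have "(\<integral>\<^sup>+W. ennreal (x (Suc i) j W) \<partial>M) = (\<integral>\<^sup>+W. ennreal (x i j (T W)) \<partial>M)" by (simp add: stat)
    also have "\<dots> = (\<integral>\<^sup>+W. ennreal (x i j W) \<partial>distr M M T)" by (subst nn_integral_distr) auto
    finally show ?case using Suc by (simp add: pres)
  qed
  have b_int: "(\<integral>\<^sup>+W. ennreal (b N d i W) \<partial>M) = (\<integral>\<^sup>+W. ennreal (b N d 0 W) \<partial>M)" for N d i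
  proof (induction i)
    case (Suc i)
    have "(\<integral>\<^sup>+W. ennreal (b N d (Suc i) W) \<partial>M) = (\<integral>\<^sup>+W. ennreal (b N d i (T W)) \<partial>M)"
      unfolding b_def bad_def by (simp only: stat fT)
    also have "\<dots> = (\<integral>\<^sup>+W. ennreal (b N d i W) \<partial>distr M M T)" by (subst nn_integral_distr) auto
    finally show ?case using Suc by (simp add: pres)
  qed simp
  \<comment> \<open>Covering of \<open>{i..<E}\<close>: a good start allows a jump over a block of
    average at most \<open>f + d\<close>, a bad one pays for a single step through \<open>b\<close>.
    Once at most \<open>N\<close> places remain, a jump could overshoot \<open>E\<close>, so these
    are paid for one by one in the last sum.\<close>
  have cover: "x i (E - i) W \<le> real (E - i) * (enn2real (f 0 W) + d) + (\<Sum>k\<in>{i..<E}. b N d k W) + (\<Sum>k\<in>{E - N..<E}. x k 1 W)"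
    if W: "\<forall>i. f i W = f 0 W" and d: "d > 0" and iE: "i \<le> E" for i E d N W
    using iE
  proof (induction "E - i" arbitrary: i rule: less_induct)
    case less
    have triv: "x i (E - i) W \<le> (\<Sum>k\<in>{i..<E}. x k 1 W)" if "i \<le> E" for i
      using that
    proof (induction "E - i" arbitrary: i)
      case 0
      then show ?case by (simp add: zero)
    next
      case (Suc n)
      then have "x i (1 + (E - Suc i)) W \<le> x i 1 W + x (Suc i) (E - Suc i) W" using sub[of i 1 "E - Suc i" W] by simp
      moreover have "x (Suc i) (E - Suc i) W \<le> (\<Sum>k\<in>{Suc i..<E}. x k 1 W)" using Suc by (intro Suc(1)) auto
      moreover have "1 + (E - Suc i) = E - i" "i < E" using Suc(2) by auto
      ultimately show ?case by (simp only: sum.atLeast_Suc_lessThan)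
    qed
    have c0: "0 \<le> enn2real (f 0 W) + d" using d by (simp add: add_nonneg_pos less_imp_le)
    show ?case
    proof (cases "E - i \<le> N")
      case True
      have "(\<Sum>k\<in>{i..<E}. x k 1 W) \<le> (\<Sum>k\<in>{E - N..<E}. x k 1 W)"
        using True by (intro sum_mono2) (auto simp: nonneg)
      moreover have "0 \<le> real (E - i) * (enn2real (f 0 W) + d)" using c0 by simp
      moreover have "0 \<le> (\<Sum>k\<in>{i..<E}. b N d k W)" by (intro sum_nonneg b0)
      ultimately show ?thesis using triv[OF less(2)] by linarith
    next
      case False
      have "\<exists>n\<in>{1..E-i}. x i n W \<le> real n * (enn2real (f 0 W) + d) + (\<Sum>k\<in>{i..<i+n}. b N d k W)"
      proof (cases "bad N d i W")
        case True
        have "x i 1 W = b N d i W" using True by (simp add: b_def)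
        then show ?thesis using False c0 by (intro bexI[of _ 1]) auto
      next
        case nb: False
        then obtain n where n: "n \<in> {1..N}" "x i n W \<le> real n * (enn2real (f 0 W) + d)"
          unfolding bad_def W[rule_format, of i] by (meson not_less)
        have "0 \<le> (\<Sum>k\<in>{i..<i+n}. b N d k W)" by (intro sum_nonneg b0)
        then show ?thesis using n False by (intro bexI[of _ n]) auto
      qed
      then obtain n where n: "n \<in> {1..E-i}" "x i n W \<le> real n * (enn2real (f 0 W) + d) + (\<Sum>k\<in>{i..<i+n}. b N d k W)" by blast
      have "x i (n + (E - (i + n))) W \<le> x i n W + x (i + n) (E - (i + n)) W" by (rule sub)
      also have "x (i + n) (E - (i + n)) W \<le> real (E - (i + n)) * (enn2real (f 0 W) + d) + (\<Sum>k\<in>{i+n..<E}. b N d k W) + (\<Sum>k\<in>{E - N..<E}. x k 1 W)"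
        using n less(2) by (intro less(1)) auto
      finally have "x i (n + (E - (i + n))) W \<le> (real n + real (E - (i + n))) * (enn2real (f 0 W) + d)
         + ((\<Sum>k\<in>{i..<i+n}. b N d k W) + (\<Sum>k\<in>{i+n..<E}. b N d k W)) + (\<Sum>k\<in>{E - N..<E}. x k 1 W)"
        using n(2) by (simp add: algebra_simps)
      moreover have "(\<Sum>k\<in>{i..<i+n}. b N d k W) + (\<Sum>k\<in>{i+n..<E}. b N d k W) = (\<Sum>k\<in>{i..<E}. b N d k W)"
        using n less(2) by (intro sum.atLeastLessThan_concat) auto
      moreover have "n + (E - (i + n)) = E - i" "real n + real (E - (i + n)) = real (E - i)" using n by auto
      ultimately show ?thesis by simp
    qed
  qed
  have bint: "integrable M (b N d 0)" for N d
    by (rule Bochner_Integration.integrable_bound[OF int[of 1]]) (auto simp: b_def)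
  have b_int': "(\<integral>\<^sup>+W. ennreal (b N d k W) \<partial>M) = ennreal (expectation (b N d 0))" for N d k
    by (rule trans[OF b_int nn_integral_eq_integral[OF bint]]) (simp add: b0)
  \<comment> \<open>Expectations are taken in the covering bound; the last \<open>N\<close> places
    contribute a fixed amount, which disappears after division by \<open>E\<close>.\<close>
  have H_le: "H E \<le> real E * (F + d + expectation (b N d 0)) + real N * H 1" if d: "d > 0" for E N d
  proof -
    have "ennreal (H E) = (\<integral>\<^sup>+W. ennreal (x 0 E W) \<partial>M)" by (simp add: stat_int)
    also have "\<dots> \<le> (\<integral>\<^sup>+W. (of_nat E * (f 0 W + ennreal d) + (\<Sum>k\<in>{0..<E}. ennreal (b N d k W))) + (\<Sum>k\<in>{E - N..<E}. ennreal (x k 1 W)) \<partial>M)"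
    proof (rule nn_integral_mono_AE, use inv in eventually_elim)
      fix W assume W: "f 0 W < \<infinity> \<and> (\<forall>i. f i W = f 0 W)"
      have "x 0 E W \<le> real E * (enn2real (f 0 W) + d) + (\<Sum>k\<in>{0..<E}. b N d k W) + (\<Sum>k\<in>{E - N..<E}. x k 1 W)"
        using cover[of W d 0 E N] W d by simp
      then have "ennreal (x 0 E W) \<le> ennreal (real E * (enn2real (f 0 W) + d) + (\<Sum>k\<in>{0..<E}. b N d k W) + (\<Sum>k\<in>{E - N..<E}. x k 1 W))"
        by (rule ennreal_leI)
      also have "\<dots> = ennreal (real E) * (ennreal (enn2real (f 0 W)) + ennreal d) + (\<Sum>k\<in>{0..<E}. ennreal (b N d k W)) + (\<Sum>k\<in>{E - N..<E}. ennreal (x k 1 W))"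
        unfolding sum_ennreal[OF b0] sum_ennreal[OF nonneg]
        by (rule ennreal_lin) (use d in \<open>auto intro: sum_nonneg b0 nonneg\<close>)
      also have "ennreal (enn2real (f 0 W)) = f 0 W" using W by (simp add: less_top)
      finally show "ennreal (x 0 E W) \<le> (of_nat E * (f 0 W + ennreal d) + (\<Sum>k\<in>{0..<E}. ennreal (b N d k W))) + (\<Sum>k\<in>{E - N..<E}. ennreal (x k 1 W))"
        by (simp add: ennreal_of_nat_eq_real_of_nat)
    qed
    also have "\<dots> = of_nat E * (ennreal F + ennreal d) + (\<Sum>k\<in>{0..<E}. \<integral>\<^sup>+W. ennreal (b N d k W) \<partial>M) + (\<Sum>k\<in>{E - N..<E}. \<integral>\<^sup>+W. ennreal (x k 1 W) \<partial>M)"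
      by (simp add: nn_integral_add nn_integral_cmult nn_integral_sum F emeasure_space_1)
    also have "\<dots> \<le> of_nat E * (ennreal F + ennreal d) + of_nat E * ennreal (expectation (b N d 0)) + of_nat N * ennreal (H 1)"
    proof (intro add_mono order_refl)
      show "(\<Sum>k\<in>{0..<E}. \<integral>\<^sup>+W. ennreal (b N d k W) \<partial>M) \<le> of_nat E * ennreal (expectation (b N d 0))"
        unfolding b_int' by simp
      show "(\<Sum>k\<in>{E - N..<E}. \<integral>\<^sup>+W. ennreal (x k 1 W) \<partial>M) \<le> of_nat N * ennreal (H 1)"
        unfolding stat_int by (simp add: mult_right_mono)
    qed
    also have "of_nat E * (ennreal F + ennreal d) + of_nat E * ennreal (expectation (b N d 0)) + of_nat N * ennreal (H 1)
       = ennreal (real E * (F + d + expectation (b N d 0)) + real N * H 1)"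
    proof -
      have "0 \<le> expectation (b N d 0)" by (simp add: b0)
      then show ?thesis using d F(2) H0[of 1]
        unfolding ennreal_of_nat_eq_real_of_nat by (simp add: ennreal_mult' distrib_left)
    qed
    finally have "ennreal (H E) \<le> ennreal (real E * (F + d + expectation (b N d 0)) + real N * H 1)" by simp
    moreover have "0 \<le> real E * (F + d + expectation (b N d 0)) + real N * H 1"
      using d F(2) H0[of 1] by (auto intro!: add_nonneg_nonneg mult_nonneg_nonneg simp: b0)
    ultimately show ?thesis by (simp add: ennreal_le_iff)
  qed
  \<comment> \<open>The infimum of the averaged expectations. The covering gives
    \<open>g \<le> E f\<close>, the hypothesis \<open>upper\<close> gives \<open>f \<le> g\<close>
    almost surely, and together they force \<open>f = g\<close>.\<close>
  define g where "g = (INF L\<in>{1..}. H L / real L)"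
  have bdd: "bdd_below ((\<lambda>L. H L / real L) ` {1..})" by (rule bdd_belowI[of _ 0]) (auto simp: H0)
  have gH: "real L * g \<le> H L" if "L \<ge> 1" for L
  proof -
    have "g \<le> H L / real L" unfolding g_def using that by (intro cINF_lower bdd) auto
    then show ?thesis using that by (simp add: field_simps)
  qed
  have gamg: "\<gamma> \<le> g" unfolding g_def
    by (intro cINF_greatest) (use gam in \<open>auto simp: H_def field_simps\<close>)
  have g_le: "g \<le> F + d + expectation (b N d 0)" if d: "d > 0" for d N
  proof -
    have "g \<le> F + d + expectation (b N d 0) + real N * H 1 * (1 / real (Suc E))" for E
      using H_le[OF d, of "Suc E" N] gH[of "Suc E"] by (simp add: field_simps)
    moreover have "(\<lambda>E. F + d + expectation (b N d 0) + real N * H 1 * (1 / real (Suc E))) \<longlonglongrightarrow> F + d + expectation (b N d 0) + real N * H 1 * 0"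
      by (intro tendsto_intros lim_1_over_n[THEN LIMSEQ_Suc])
    ultimately show ?thesis by (intro LIMSEQ_le_const) auto
  qed
  have gF: "g \<le> F + d" if d: "d > 0" for d
  proof -
    have "(\<lambda>N. expectation (b N d 0)) \<longlonglongrightarrow> expectation (\<lambda>_. 0)"
    proof (rule integral_dominated_convergence)
      show "integrable M (x 0 1)" by (rule int)
      show "AE W in M. norm (b N d 0 W) \<le> x 0 1 W" for N by (auto simp: b_def nonneg)
      show "AE W in M. (\<lambda>N. b N d 0 W) \<longlonglongrightarrow> 0"
        using f_fin
      proof eventually_elim
        case (elim W)
        have "f 0 W = ennreal (enn2real (f 0 W))" using elim by (simp add: less_top)
        also have "\<dots> < ennreal (enn2real (f 0 W) + d)" using d by (intro ennreal_lessI) (auto simp: add_nonneg_pos)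
        finally have "\<exists>\<^sub>F j in sequentially. x 0 j W < real j * (enn2real (f 0 W) + d)" by (rule freq')
        then obtain j where j: "j \<ge> 1" "x 0 j W < real j * (enn2real (f 0 W) + d)"
          by (auto simp: frequently_sequentially)
        have "b N d 0 W = 0" if "N \<ge> j" for N using j that by (force simp: b_def bad_def)
        then show ?case by (intro tendsto_eventually eventually_sequentiallyI[of j])
      qed
    qed auto
    then have "(\<lambda>N. F + d + expectation (b N d 0)) \<longlonglongrightarrow> F + d + 0" by (intro tendsto_add tendsto_const) simp
    then show ?thesis using g_le[OF d] by (intro LIMSEQ_le_const) auto
  qed
  then have gF: "g \<le> F" by (rule field_le_epsilon)
  have "AE W in M. \<forall>L\<in>{1..}. f 0 W \<le> ennreal (H L / real L)"
    using f_le by (subst AE_ball_countable) auto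
  with f_fin have fg: "AE W in M. enn2real (f 0 W) \<le> g"
  proof eventually_elim
    case (elim W)
    then show ?case unfolding g_def
      by (intro cINF_greatest) (auto intro!: enn2real_leI simp: H0)
  qed
  have f_int: "integrable M (\<lambda>W. enn2real (f 0 W))" and f_exp: "expectation (\<lambda>W. enn2real (f 0 W)) = F"
  proof -
    have "(\<integral>\<^sup>+W. ennreal (enn2real (f 0 W)) \<partial>M) = (\<integral>\<^sup>+W. f 0 W \<partial>M)"
      using f_fin by (intro nn_integral_cong_AE) (auto simp: less_top)
    then have 1: "(\<integral>\<^sup>+W. ennreal (enn2real (f 0 W)) \<partial>M) = ennreal F" by (simp add: F)
    then show "integrable M (\<lambda>W. enn2real (f 0 W))" by (intro integrableI_bounded) auto
    show "expectation (\<lambda>W. enn2real (f 0 W)) = F" by (subst integral_eq_nn_integral) (auto simp: 1 F)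
  qed
  have "AE W in M. g - enn2real (f 0 W) = 0"
  proof (subst integral_nonneg_eq_0_iff_AE[symmetric])
    show "integrable M (\<lambda>W. g - enn2real (f 0 W))" using f_int by simp
    show "AE W in M. 0 \<le> g - enn2real (f 0 W)" using fg by simp
    have "expectation (\<lambda>W. g - enn2real (f 0 W)) = g - F" using f_int f_exp by (simp add: prob_space)
    moreover have "0 \<le> expectation (\<lambda>W. g - enn2real (f 0 W))" using fg by (intro integral_nonneg_AE) simp
    ultimately show "expectation (\<lambda>W. g - enn2real (f 0 W)) = 0" using gF by simp
  qed
  with f_fin show ?thesis
  proof eventually_elim
    case (elim W)
    then have g': "g = enn2real (f 0 W)" by simp
    then have fW: "f 0 W = ennreal g" "g \<ge> 0" using elim(1) by (simp_all add: ennreal_enn2real)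
    show ?case
    proof (cases "\<gamma> - e < 0")
      case True
      show ?thesis
      proof (rule always_eventually, intro allI)
        fix j show "real j * (\<gamma> - e) \<le> x 0 j W"
          using True nonneg[of 0 j W] mult_nonneg_nonpos[of "real j" "\<gamma> - e"] by linarith
      qed
    next
      case False
      then have "ennreal (\<gamma> - e) < f 0 W" using fW gamg e by (simp add: ennreal_less_iff)
      then have "\<forall>\<^sub>F j in sequentially. ennreal (\<gamma> - e) < ennreal (x 0 j W / real j)"
        unfolding f_def by (rule less_LiminfD)
      with eventually_gt_at_top[of 0] show ?thesis
      proof eventually_elim
        case (elim j)
        then have "\<gamma> - e < x 0 j W / real j" using False by (simp add: ennreal_less_iff)
        then show ?case using elim(1) by (simp add: field_simps)
      qed
    qed
  qed
qed

end

section \<open>Passage costs along rays\<close>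

text \<open>Finiteness only says that an admissible path exists, which does not depend on the
  weights.\<close>

lemma pcost_finite_transfer:
  assumes "pcost lazy c W n x y < \<infinity>"
  shows "pcost lazy c W' n x y < \<infinity>"
proof -
  obtain p where p: "adm_path lazy n p" "p 0 = x" "p n = y" using pcost_path_attained[OF assms] by metis
  have "pcost lazy c W' n x y \<le> (\<Sum>i<n. ecost c W' (p i) (p (Suc i)))" using pcost_le_path[OF p(1)] p(2,3) by metis
  also have "\<dots> < \<infinity>" by (auto simp: ecost_def less_top[symmetric])
  finally show ?thesis .
qed

lemma pcost_shift_0: "pcost lazy c W n z (z + y) = pcost lazy c (shiftW z W) n 0 y"
  by (simp add: pcost_shift)

context iid_env begin

text \<open>Marks the pairs \<open>(n, x)\<close> to which the law of large numbers applies; they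
  are closed under addition (\<open>mom2_add\<close>), unlike a condition on single weights.\<close>

definition mom2 :: "bool \<Rightarrow> real \<Rightarrow> nat \<Rightarrow> int^'d \<Rightarrow> bool" where
  "mom2 lazy c n x \<longleftrightarrow> (\<integral>\<^sup>+W. (pcost lazy c W n 0 x)\<^sup>2 \<partial>P) < \<infinity>"

definition epc :: "bool \<Rightarrow> real \<Rightarrow> nat \<Rightarrow> int^'d \<Rightarrow> real" where
  "epc lazy c n x = P.expectation (\<lambda>W. enn2real (pcost lazy c W n 0 x))"

text \<open>A second moment gives finiteness for almost every configuration, hence for one, and by
  \<open>pcost_finite_transfer\<close> for all. Real-valued costs can then be used without
  exceptional null sets.\<close>

lemma mom2_finite: "mom2 lazy c n x \<Longrightarrow> pcost lazy c W n z (z + x) < \<infinity>"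
proof -
  assume "mom2 lazy c n x"
  then have "AE W in P. (pcost lazy c W n 0 x)\<^sup>2 \<noteq> \<infinity>"
    unfolding mom2_def by (intro nn_integral_PInf_AE) auto
  then have "\<exists>W. (pcost lazy c W n 0 x)\<^sup>2 \<noteq> \<infinity>"
  proof (rule contrapos_pp)
    assume "\<not> (\<exists>W. (pcost lazy c W n 0 x)\<^sup>2 \<noteq> \<infinity>)"
    then show "\<not> (AE W in P. (pcost lazy c W n 0 x)\<^sup>2 \<noteq> \<infinity>)" by (simp add: P.AE_const)
  qed
  then obtain W' where "pcost lazy c W' n 0 x < \<infinity>" by (auto simp: less_top power_eq_top_ennreal)
  from pcost_finite_transfer[OF this] show ?thesis by (simp add: pcost_shift_0)
qed

lemma mom2_add:
  assumes "mom2 lazy c n x" "mom2 lazy c m y"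
  shows "mom2 lazy c (n + m) (x + y)"
proof -
  have "(\<integral>\<^sup>+W. (pcost lazy c W (n + m) 0 (x + y))\<^sup>2 \<partial>P)
    \<le> (\<integral>\<^sup>+W. 4 * ((pcost lazy c W n 0 x)\<^sup>2 + (pcost lazy c (shiftW x W) m 0 y)\<^sup>2) \<partial>P)"
  proof (intro nn_integral_mono)
    fix W
    let ?a = "pcost lazy c W n 0 x" and ?b = "pcost lazy c (shiftW x W) m 0 y"
    have "pcost lazy c W (n + m) 0 (x + y) \<le> ?a + ?b"
      using pcost_triangle[of lazy c W n m 0 "x + y" x] by (simp add: pcost_shift_0)
    also have "\<dots> \<le> 2 * max ?a ?b" by (simp add: mult_2 add_mono)
    finally have "(pcost lazy c W (n + m) 0 (x + y))\<^sup>2 \<le> (2 * max ?a ?b)\<^sup>2" by (intro power_mono) auto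
    also have "\<dots> = 4 * (max ?a ?b)\<^sup>2" by (simp add: power_mult_distrib)
    also have "\<dots> \<le> 4 * (?a\<^sup>2 + ?b\<^sup>2)" by (intro mult_left_mono) (auto simp: max_def)
    finally show "(pcost lazy c W (n + m) 0 (x + y))\<^sup>2 \<le> 4 * (?a\<^sup>2 + ?b\<^sup>2)" .
  qed
  also have "\<dots> = 4 * ((\<integral>\<^sup>+W. (pcost lazy c W n 0 x)\<^sup>2 \<partial>P) + (\<integral>\<^sup>+W. (pcost lazy c (shiftW x W) m 0 y)\<^sup>2 \<partial>P))"
    by (simp add: nn_integral_cmult nn_integral_add)
  also have "(\<integral>\<^sup>+W. (pcost lazy c (shiftW x W) m 0 y)\<^sup>2 \<partial>P) = (\<integral>\<^sup>+W. (pcost lazy c W m 0 y)\<^sup>2 \<partial>P)"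
    by (rule nn_integral_shift[where F="\<lambda>W. (pcost lazy c W m 0 y)\<^sup>2"]) measurable
  also have "4 * ((\<integral>\<^sup>+W. (pcost lazy c W n 0 x)\<^sup>2 \<partial>P) + (\<integral>\<^sup>+W. (pcost lazy c W m 0 y)\<^sup>2 \<partial>P)) < \<infinity>"
    using assms unfolding mom2_def by (simp add: ennreal_mult_less_top)
  finally show ?thesis unfolding mom2_def .
qed

lemma mom2_mult:
  assumes "mom2 lazy c n x" "L \<ge> 1"
  shows "mom2 lazy c (L * n) (int L *s x)"
  using assms(2)
proof (induction L rule: nat_induct_at_least)
  case base
  then show ?case using assms by simp
next
  case (Suc L)
  have "int L *s x + x = int (Suc L) *s x" by (simp add: vec_eq_iff algebra_simps)
  then show ?case using mom2_add[OF Suc(2) assms(1)] by (simp add: add.commute)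
qed

lemma mom2_square_integrable:
  assumes "mom2 lazy c n x"
  shows "integrable P (\<lambda>W. (enn2real (pcost lazy c W n 0 x))\<^sup>2)"
proof (rule integrableI_bounded)
  have "(\<integral>\<^sup>+W. ennreal (norm ((enn2real (pcost lazy c W n 0 x))\<^sup>2)) \<partial>P) = (\<integral>\<^sup>+W. (pcost lazy c W n 0 x)\<^sup>2 \<partial>P)"
  proof (intro nn_integral_cong)
    fix W
    have "pcost lazy c W n 0 x < top" using mom2_finite[OF assms, of W 0] by simp
    then show "ennreal (norm ((enn2real (pcost lazy c W n 0 x))\<^sup>2)) = (pcost lazy c W n 0 x)\<^sup>2"
      by (simp add: ennreal_power[symmetric] ennreal_enn2real)
  qed
  then show "(\<integral>\<^sup>+W. ennreal (norm ((enn2real (pcost lazy c W n 0 x))\<^sup>2)) \<partial>P) < \<infinity>"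
    using assms by (simp add: mom2_def)
qed measurable

lemma mom2_integrable:
  assumes "mom2 lazy c n x"
  shows "integrable P (\<lambda>W. enn2real (pcost lazy c W n 0 x))"
  by (rule P.square_integrable_imp_integrable[OF _ mom2_square_integrable[OF assms]]) measurable

lemma integral_shift:
  fixes F :: "((int^'d) set \<Rightarrow> real) \<Rightarrow> real"
  assumes F[measurable]: "F \<in> borel_measurable P"
  shows "P.expectation (\<lambda>W. F (shiftW z W)) = P.expectation F"
    and "integrable P (\<lambda>W. F (shiftW z W)) \<longleftrightarrow> integrable P F"
  using integral_distr[OF measurable_shift[of z] F] integrable_distr_eq[OF measurable_shift[of z] F] by (simp_all add: distr_shift)

lemma epc_nonneg: "0 \<le> epc lazy c n x"
  by (simp add: epc_def)

lemma epc_add_le: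
  assumes "mom2 lazy c n x" "mom2 lazy c m y"
  shows "epc lazy c (n + m) (x + y) \<le> epc lazy c n x + epc lazy c m y"
proof -
  have "epc lazy c (n + m) (x + y) \<le> P.expectation (\<lambda>W. enn2real (pcost lazy c W n 0 x) + enn2real (pcost lazy c (shiftW x W) m 0 y))"
    unfolding epc_def
  proof (rule integral_mono)
    show "integrable P (\<lambda>W. enn2real (pcost lazy c W (n + m) 0 (x + y)))" by (intro mom2_integrable mom2_add assms)
    show "integrable P (\<lambda>W. enn2real (pcost lazy c W n 0 x) + enn2real (pcost lazy c (shiftW x W) m 0 y))"
      using mom2_integrable[OF assms(1)] mom2_integrable[OF assms(2)] integral_shift(2)[of "\<lambda>W. enn2real (pcost lazy c W m 0 y)" x]
      by simp
    fix W
    have f: "pcost lazy c W n 0 x < top" "pcost lazy c (shiftW x W) m 0 y < top"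
      using mom2_finite[OF assms(1), of W 0] mom2_finite[OF assms(2), of "shiftW x W" 0] by simp_all
    have "pcost lazy c W (n + m) 0 (x + y) \<le> pcost lazy c W n 0 x + pcost lazy c (shiftW x W) m 0 y"
      using pcost_triangle[of lazy c W n m 0 "x + y" x] by (simp add: pcost_shift_0)
    then have "enn2real (pcost lazy c W (n + m) 0 (x + y)) \<le> enn2real (pcost lazy c W n 0 x + pcost lazy c (shiftW x W) m 0 y)"
      using f by (intro enn2real_mono) (auto simp: less_top)
    then show "enn2real (pcost lazy c W (n + m) 0 (x + y)) \<le> enn2real (pcost lazy c W n 0 x) + enn2real (pcost lazy c (shiftW x W) m 0 y)"
      using f by (simp add: enn2real_plus)
  qed
  also have "\<dots> = epc lazy c n x + epc lazy c m y"
    using mom2_integrable[OF assms(1)] mom2_integrable[OF assms(2)] integral_shift[of "\<lambda>W. enn2real (pcost lazy c W m 0 y)" x]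
    by (simp add: epc_def)
  finally show ?thesis .
qed

lemma epc_mult_le:
  assumes "mom2 lazy c n x" "L \<ge> 1"
  shows "epc lazy c (L * n) (int L *s x) \<le> real L * epc lazy c n x"
  using assms(2)
proof (induction L rule: nat_induct_at_least)
  case base
  then show ?case by simp
next
  case (Suc L)
  have eq: "int L *s x + x = int (Suc L) *s x" by (simp add: vec_eq_iff algebra_simps)
  have "epc lazy c (L * n + n) (int L *s x + x) \<le> epc lazy c (L * n) (int L *s x) + epc lazy c n x"
    using Suc(1) by (intro epc_add_le mom2_mult assms(1))
  then show ?case using Suc(2) unfolding eq by (simp add: add.commute distrib_right)
qed

text \<open>The cost to \<open>k\<close> times \<open>y\<close> is at most the sum of
  \<open>k\<close> translated blocks. Blocks whose indices differ by more than \<open>2 * m\<close>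
  are independent, since a block sees only edges within distance \<open>m\<close> of its start.
  Along the squares \<open>k = i^2\<close> Chebyshev's bound is of order \<open>1 / i^2\<close>,
  hence summable, and the squares are still dense enough for \<open>time_grid\<close>.\<close>

lemma ray_upper:
  assumes m2: "mom2 lazy c m y" and y: "y \<noteq> 0" and e: "e > 0"
  shows "AE W in P. \<forall>\<^sub>F i in sequentially. pcost lazy c W (i\<^sup>2 * m) 0 (int (i\<^sup>2) *s y) \<le> ennreal (real (i\<^sup>2) * (epc lazy c m y + e))"
proof -
  define X where "X l W = enn2real (pcost lazy c W m (int l *s y) (int l *s y + y))" for l W
  have Xs: "X l W = enn2real (pcost lazy c (shiftW (int l *s y) W) m 0 y)" for l W
    by (simp add: X_def pcost_shift_0)
  have Xm[measurable]: "X l \<in> borel_measurable P" for l unfolding X_def[abs_def] by measurable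
  have fin: "pcost lazy c W m (int l *s y) (int l *s y + y) < top" for l W using mom2_finite[OF m2] by simp
  have chain: "pcost lazy c W (k * m) 0 (int k *s y) \<le> ennreal (\<Sum>l<k. X l W)" for k W
  proof (induction k)
    case (Suc k)
    have eq: "int (Suc k) *s y = int k *s y + y" by (simp add: vec_eq_iff algebra_simps)
    have "pcost lazy c W (k * m + m) 0 (int (Suc k) *s y) \<le> pcost lazy c W (k * m) 0 (int k *s y) + pcost lazy c W m (int k *s y) (int k *s y + y)"
      unfolding eq by (rule pcost_triangle)
    also have "\<dots> \<le> ennreal (\<Sum>l<k. X l W) + ennreal (X k W)"
      using fin[of W k] by (intro add_mono Suc) (simp add: X_def ennreal_enn2real)
    also have "\<dots> = ennreal (\<Sum>l<Suc k. X l W)" by (simp add: X_def sum_nonneg)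
    finally show ?case by (simp add: add.commute)
  qed simp
  have X2: "integrable P (\<lambda>W. (X l W)\<^sup>2)" "P.expectation (\<lambda>W. (X l W)\<^sup>2) = P.expectation (\<lambda>W. (X 0 W)\<^sup>2)" for l
    using integral_shift[of "\<lambda>W. (enn2real (pcost lazy c W m 0 y))\<^sup>2"] mom2_square_integrable[OF m2] by (simp_all add: Xs)
  have X1: "integrable P (X l)" "P.expectation (X l) = epc lazy c m y" for l
    using integral_shift[of "\<lambda>W. enn2real (pcost lazy c W m 0 y)"] mom2_integrable[OF m2] by (simp_all add: Xs[abs_def] epc_def)
  define s where "s = P.expectation (\<lambda>W. (X 0 W)\<^sup>2)"
  have X2s: "P.expectation (\<lambda>W. (X l W)\<^sup>2) \<le> s" for l unfolding s_def by (rule eq_refl[OF X2(2)])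
  define A where "A i = {W\<in>space P. (\<Sum>l<i\<^sup>2. X l W) \<ge> (\<Sum>l<i\<^sup>2. P.expectation (X l)) + real (i\<^sup>2) * e}" for i
  have Am: "A i \<in> sets P" for i unfolding A_def by measurable
  have prb: "P.prob (A i) \<le> (real (4 * m + 1) * s / e\<^sup>2) * (1 / real i ^ 2)" if i: "i \<ge> 1" for i
  proof -
    have i0: "real i > 0" using i by simp
    have "P.prob (A i) \<le> real (card {..<i\<^sup>2}) * real (4 * m + 1) * s / (real (i\<^sup>2) * e)\<^sup>2"
      unfolding A_def
    proof (rule P.local_dependence_chebyshev[where N="\<lambda>l. {l - 2 * m..l + 2 * m}"])
      fix l k assume lk: "k \<notin> {l - 2 * m..l + 2 * m}"
      show "P.expectation (\<lambda>W. X l W * X k W) = P.expectation (X l) * P.expectation (X k)"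
      proof (rule expectation_mult_local)
        let ?E = "\<lambda>l. ball_edges (int l *s y) m"
        show "?E l \<subseteq> lattice_edges" "?E k \<subseteq> lattice_edges" by (auto simp: ball_edges_def)
        show "?E l \<inter> ?E k = {}"
        proof (rule ccontr)
          assume "?E l \<inter> ?E k \<noteq> {}"
          then obtain e where e: "e \<in> ?E l" "e \<in> ?E k" by blast
          then obtain v where "v \<in> e" by (auto simp: ball_edges_def lattice_edges_def)
          then have "l1_int (v - int l *s y) \<le> int m" "l1_int (v - int k *s y) \<le> int m" using e by (auto simp: ball_edges_def)
          then have "l1_int (int l *s y - int k *s y) \<le> 2 * int m"
            using l1_int_triangle_diff[of "int l *s y" "int k *s y" v] l1_int_diff_commute[of v "int l *s y"] by linarith
          moreover have "l1_int (int l *s y - int k *s y) = l1_int ((int l - int k) *s y)"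
            by (rule arg_cong[where f=l1_int]) (simp add: vec_eq_iff algebra_simps)
          ultimately have "\<bar>int l - int k\<bar> * l1_int y \<le> 2 * int m" by (simp only: l1_int_scale)
          \<comment> \<open>As \<open>y\<close> is a nonzero lattice vector, the starts of two
            blocks are at least as far apart as their indices.\<close>
          moreover have "l1_int y \<ge> 1" using y l1_int_nonneg[of y] l1_int_eq_0_iff[of y] by linarith
          then have "\<bar>int l - int k\<bar> * 1 \<le> \<bar>int l - int k\<bar> * l1_int y" by (intro mult_left_mono) auto
          ultimately have "\<bar>int l - int k\<bar> * 1 \<le> 2 * int m" by (meson order_trans)
          then have "\<bar>int l - int k\<bar> \<le> 2 * int m" by simp
          then show False using lk by auto
        qed
        show "local_on (?E l) (X l)" "local_on (?E k) (X k)"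
          unfolding local_on_def X_def using pcost_local by metis+
      qed (use X1 in auto)
    next
      fix l
      have "card ({l - 2 * m..l + 2 * m} \<inter> {..<i\<^sup>2}) \<le> card {l - 2 * m..l + 2 * m}" by (intro card_mono) auto
      also have "\<dots> \<le> 4 * m + 1" by simp
      finally show "card ({l - 2 * m..l + 2 * m} \<inter> {..<i\<^sup>2}) \<le> 4 * m + 1" .
    qed (use X2(1) X2s e i in auto)
    also have "\<dots> = (real (4 * m + 1) * s / e\<^sup>2) * (1 / real i ^ 2)"
      using i0 e by (simp add: power2_eq_square field_simps)
    finally show ?thesis .
  qed
  have sm: "summable (\<lambda>i. (real (4 * m + 1) * s / e\<^sup>2) * (1 / real i ^ 2))"
    using inverse_power_summable[of 2, where 'a=real] by (intro summable_mult) (simp add: inverse_eq_divide)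
  have "AE W in P. \<forall>\<^sub>F i in sequentially. W \<notin> A i"
    by (rule P.borel_cantelli_bound[OF Am prb sm])
  then show ?thesis
  proof (rule AE_mp, intro AE_I2 impI)
    fix W assume W: "W \<in> space P" and ev: "\<forall>\<^sub>F i in sequentially. W \<notin> A i"
    from ev show "\<forall>\<^sub>F i in sequentially. pcost lazy c W (i\<^sup>2 * m) 0 (int (i\<^sup>2) *s y) \<le> ennreal (real (i\<^sup>2) * (epc lazy c m y + e))"
    proof eventually_elim
      case (elim i)
      then have "(\<Sum>l<i\<^sup>2. X l W) \<le> real (i\<^sup>2) * (epc lazy c m y + e)"
        using W by (simp add: A_def X1 algebra_simps)
      then show ?case using chain[of W "i\<^sup>2"] ennreal_leI order_trans by blast
    qed
  qed
qed

text \<open>The general lower bound is applied to the costs along the ray, with the shift by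
  \<open>y\<close> as measure-preserving map. Its upper hypothesis asks for infinitely many good
  times, and \<open>ray_upper\<close> for blocks of \<open>L * m\<close> steps provides them at
  \<open>j = i^2 * L\<close>.\<close>

lemma ray_lower:
  assumes m2: "mom2 lazy c m y" and y: "y \<noteq> 0" and e: "e > 0"
    and gam: "\<And>L. L \<ge> 1 \<Longrightarrow> real L * \<gamma> \<le> epc lazy c (L * m) (int L *s y)"
  shows "AE W in P. \<forall>\<^sub>F j in sequentially. ennreal (real j * (\<gamma> - e)) \<le> pcost lazy c W (j * m) 0 (int j *s y)"
proof -
  define x where "x i j W = enn2real (pcost lazy c W (j * m) (int i *s y) (int i *s y + int j *s y))" for i j W
  have fin: "pcost lazy c W (j * m) z (z + int j *s y) < top" for j W z
  proof (cases "j = 0")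
    case False
    then show ?thesis using mom2_finite[OF mom2_mult[OF m2, of j]] by simp
  qed simp
  have x0: "x 0 j W = enn2real (pcost lazy c W (j * m) 0 (int j *s y))" for j W by (simp add: x_def)
  have "AE W in P. \<forall>\<^sub>F j in sequentially. real j * (\<gamma> - e) \<le> x 0 j W"
  proof (rule P.subadditive_ergodic_lower[where T="shiftW y"])
    show "0 \<le> x i j W" for i j W by (simp add: x_def)
    show "x i 0 W = 0" for i W by (simp add: x_def)
    show "x i (j + k) W \<le> x i j W + x (i + j) k W" for i j k W
    proof -
      have eq: "int i *s y + int (j + k) *s y = int (i + j) *s y + int k *s y" "int i *s y + int j *s y = int (i + j) *s y"
        by (simp_all add: vec_eq_iff algebra_simps)
      have "pcost lazy c W (j * m + k * m) (int i *s y) (int (i + j) *s y + int k *s y)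
        \<le> pcost lazy c W (j * m) (int i *s y) (int (i + j) *s y) + pcost lazy c W (k * m) (int (i + j) *s y) (int (i + j) *s y + int k *s y)"
        by (rule pcost_triangle)
      moreover have f: "pcost lazy c W (j * m) (int i *s y) (int (i + j) *s y) < top"
        "pcost lazy c W (k * m) (int (i + j) *s y) (int (i + j) *s y + int k *s y) < top"
        using fin[of W j "int i *s y", unfolded eq(2)] fin[of W k "int (i + j) *s y"] .
      ultimately have "enn2real (pcost lazy c W (j * m + k * m) (int i *s y) (int (i + j) *s y + int k *s y))
        \<le> enn2real (pcost lazy c W (j * m) (int i *s y) (int (i + j) *s y) + pcost lazy c W (k * m) (int (i + j) *s y) (int (i + j) *s y + int k *s y))"
        by (intro enn2real_mono) auto
      then show ?thesis using f unfolding x_def eq add_mult_distrib by (simp only: enn2real_plus)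
    qed
    show "shiftW y \<in> measurable P P" by (rule measurable_shift)
    show "distr P P (shiftW y) = P" by (rule distr_shift)
    show "x (Suc i) j W = x i j (shiftW y W)" for i j W
    proof -
      have "int (Suc i) *s y = y + int i *s y" "int (Suc i) *s y + int j *s y = y + (int i *s y + int j *s y)"
        by (simp_all add: vec_eq_iff algebra_simps)
      then show ?thesis unfolding x_def pcost_shift by (simp only:)
    qed
    show "x i j \<in> borel_measurable P" for i j unfolding x_def[abs_def] by measurable
    show "integrable P (x 0 j)" for j
    proof (cases "j = 0")
      case False
      then show ?thesis unfolding x0[abs_def] by (intro mom2_integrable mom2_mult m2) simp
    qed (simp add: x_def[abs_def])
    show "real L * \<gamma> \<le> P.expectation (x 0 L)" if "L \<ge> 1" for L
      using gam[OF that] unfolding epc_def x0[abs_def] .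
    show "AE W in P. \<exists>\<^sub>F j in sequentially. x 0 j W \<le> real j * (P.expectation (x 0 L) / real L + e')"
      if L: "L \<ge> 1" and e': "e' > 0" for L e'
    proof -
      have "int L *s y \<noteq> 0" using y L by (auto simp: vec_eq_iff)
      then have "AE W in P. \<forall>\<^sub>F i in sequentially. pcost lazy c W (i\<^sup>2 * (L * m)) 0 (int (i\<^sup>2) *s (int L *s y)) \<le> ennreal (real (i\<^sup>2) * (epc lazy c (L * m) (int L *s y) + real L * e'))"
        using L e' by (intro ray_upper mom2_mult m2) auto
      then show ?thesis
      proof eventually_elim
        case (elim W)
        then obtain i0 where i0: "\<And>i. i \<ge> i0 \<Longrightarrow> pcost lazy c W (i\<^sup>2 * (L * m)) 0 (int (i\<^sup>2) *s (int L *s y)) \<le> ennreal (real (i\<^sup>2) * (epc lazy c (L * m) (int L *s y) + real L * e'))"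
          by (auto simp: eventually_sequentially)
        show ?case unfolding frequently_sequentially
        proof
          fix N
          define i where "i = max (max i0 N) 1"
          have i: "i \<ge> i0" "i \<ge> N" "i \<ge> 1" by (auto simp: i_def)
          let ?j = "i\<^sup>2 * L"
          have "int (i\<^sup>2) *s (int L *s y) = int ?j *s y" by (simp add: vec_eq_iff)
          then have "pcost lazy c W (?j * m) 0 (int ?j *s y) \<le> ennreal (real (i\<^sup>2) * (epc lazy c (L * m) (int L *s y) + real L * e'))"
            using i0[OF i(1)] by (simp add: mult.assoc)
          then have "x 0 ?j W \<le> real (i\<^sup>2) * (epc lazy c (L * m) (int L *s y) + real L * e')"
            unfolding x0 using e' epc_nonneg by (intro enn2real_leI) (auto intro!: mult_nonneg_nonneg add_nonneg_nonneg)
          also have "\<dots> = real ?j * (P.expectation (x 0 L) / real L + e')"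
            using L unfolding epc_def x0[abs_def] by (simp add: field_simps)
          finally have le: "x 0 ?j W \<le> real ?j * (P.expectation (x 0 L) / real L + e')" .
          have "N \<le> i * i * L" using i L by (metis le_trans mult_le_mono mult.right_neutral nat_mult_1_right)
          then have "N \<le> ?j" by (simp add: power2_eq_square)
          then show "\<exists>j\<ge>N. x 0 j W \<le> real j * (P.expectation (x 0 L) / real L + e')" using le by blast
        qed
      qed
    qed
  qed (rule e)
  then show ?thesis
  proof eventually_elim
    case (elim W)
    then show ?case
    proof eventually_elim
      case (elim j)
      have "ennreal (real j * (\<gamma> - e)) \<le> ennreal (x 0 j W)" by (rule ennreal_leI[OF elim])
      also have "\<dots> = pcost lazy c W (j * m) 0 (int j *s y)" using fin[of W j 0] by (simp add: x0 ennreal_enn2real)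
      finally show ?case .
    qed
  qed
qed

end

section \<open>The shape function\<close>

text \<open>If a point of a segment were missing, closedness would give nearest members of the set
  on either side of it, and their midpoint would be a nearer one still.\<close>

lemma closed_midpoint_convex:
  fixes S :: "'v::real_normed_vector set"
  assumes "closed S" and mid: "\<And>x y. x \<in> S \<Longrightarrow> y \<in> S \<Longrightarrow> (1/2) *\<^sub>R (x + y) \<in> S"
  shows "convex S"
proof (rule convexI)
  fix x y and u v :: real
  assume xy: "x \<in> S" "y \<in> S" and uv: "0 \<le> u" "0 \<le> v" "u + v = 1"
  define p where "p t = x + t *\<^sub>R (y - x)" for t
  define Z where "Z = {t\<in>{0..1}. p t \<in> S}"
  have cp: "continuous_on A p" for A unfolding p_def by (intro continuous_intros)
  have Zc: "closed Z"
  proof -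
    have "Z = {0..1} \<inter> p -` S" by (auto simp: Z_def)
    then show ?thesis using continuous_closed_preimage[OF cp _ assms(1), of "{0..1}"] by simp
  qed
  have Z01: "0 \<in> Z" "1 \<in> Z" using xy by (auto simp: Z_def p_def)
  have Zm: "(s + t) / 2 \<in> Z" if "s \<in> Z" "t \<in> Z" for s t
  proof -
    have "p s + p t = 2 *\<^sub>R x + (s + t) *\<^sub>R (y - x)"
      unfolding p_def scaleR_add_left scaleR_2 by (simp only: add_ac)
    then have "(1/2) *\<^sub>R (p s + p t) = p ((s + t) / 2)"
      by (simp add: p_def scaleR_add_right)
    then show ?thesis using that mid[of "p s" "p t"] by (auto simp: Z_def)
  qed
  have "v \<in> Z"
  proof (rule ccontr)
    assume nv: "v \<notin> Z"
    define s where "s = Sup (Z \<inter> {..v})"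
    define t where "t = Inf (Z \<inter> {v..})"
    have "closed (Z \<inter> {..v})" "closed (Z \<inter> {v..})" using Zc by auto
    moreover have ne: "Z \<inter> {..v} \<noteq> {}" "Z \<inter> {v..} \<noteq> {}" using Z01 uv by auto
    moreover have bd: "bdd_above (Z \<inter> {..v})" "bdd_below (Z \<inter> {v..})" by auto
    ultimately have s: "s \<in> Z \<inter> {..v}" and t: "t \<in> Z \<inter> {v..}"
      unfolding s_def t_def using closed_contains_Sup closed_contains_Inf by metis+
    have st: "s < v" "v < t" using s t nv by (auto simp: order.order_iff_strict)
    have m: "(s + t) / 2 \<in> Z" using s t Zm by auto
    show False
    proof (cases "(s + t) / 2 \<le> v")
      case True
      then have "(s + t) / 2 \<le> s" unfolding s_def[symmetric] using cSup_upper[OF _ bd(1), of "(s + t) / 2"] m by (simp add: s_def)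
      then show False using st by simp
    next
      case False
      then have "t \<le> (s + t) / 2" using cInf_lower[OF _ bd(2), of "(s + t) / 2"] m by (simp add: t_def)
      then show False using st by simp
    qed
  qed
  then have "p v \<in> S" by (simp add: Z_def)
  moreover have "p v = u *\<^sub>R x + v *\<^sub>R y"
  proof -
    have "u = 1 - v" using uv by simp
    show ?thesis unfolding p_def \<open>u = 1 - v\<close> by (simp add: algebra_simps)
  qed
  ultimately show "u *\<^sub>R x + v *\<^sub>R y \<in> S" by simp
qed

section \<open>Normalised endpoints and the open l1 ball\<close>

definition ratv :: "nat \<Rightarrow> int^'d \<Rightarrow> real^'d" where
  "ratv n x = (\<chi> i. real_of_int (x $ i) / real n)"

lemma l1_real_triangle: "l1_real (x + y) \<le> l1_real x + l1_real y"
  unfolding l1_real_def sum.distrib[symmetric] by (intro sum_mono) (auto simp: abs_triangle_ineq)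

lemma l1_real_scale: "l1_real (r *\<^sub>R x) = \<bar>r\<bar> * l1_real x"
  by (simp add: l1_real_def abs_mult sum_distrib_left)

lemma l1_real_nonneg: "0 \<le> l1_real x"
  by (simp add: l1_real_def sum_nonneg)

lemma l1_real_minus: "l1_real (- x) = l1_real x"
  by (simp add: l1_real_def)

lemma l1_real_le_norm: "l1_real (x :: real^'d) \<le> real CARD('d) * norm x"
proof -
  have "l1_real x \<le> (\<Sum>i\<in>(UNIV::'d set). norm x)" unfolding l1_real_def by (intro sum_mono component_le_norm_cart)
  then show ?thesis by simp
qed

lemma continuous_on_l1_real: "continuous_on A l1_real"
  unfolding l1_real_def[abs_def] by (intro continuous_intros)

lemma open_intU: "open intU"
  unfolding intU_def by (intro open_Collect_less continuous_on_l1_real continuous_on_const)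

lemma convex_intU: "convex intU"
proof (rule convexI)
  fix x y :: "real^'d" and u v :: real
  assume xy: "x \<in> intU" "y \<in> intU" and uv: "0 \<le> u" "0 \<le> v" "u + v = 1"
  have "l1_real (u *\<^sub>R x + v *\<^sub>R y) \<le> u * l1_real x + v * l1_real y"
    using l1_real_triangle[of "u *\<^sub>R x" "v *\<^sub>R y"] uv by (simp add: l1_real_scale)
  also have "\<dots> < 1"
  proof (rule convex_bound_lt)
    show "l1_real x < 1" "l1_real y < 1" using xy by (auto simp: intU_def)
  qed (use uv in auto)
  finally show "u *\<^sub>R x + v *\<^sub>R y \<in> intU" by (simp add: intU_def)
qed

context iid_env begin

text \<open>The epigraph of \<open>epc lazy c n x / n\<close> over the rational points
  \<open>x / n\<close>. Only pairs with a second moment enter, so that subadditivity and the laws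
  along rays apply to them.\<close>

definition expectation_hull :: "bool \<Rightarrow> real \<Rightarrow> ((real^'d) \<times> real) set" where
  "expectation_hull lazy c = {(ratv n x, v) | n x v. n \<ge> 1 \<and> mom2 lazy c n x \<and> epc lazy c n x \<le> real n * v}"

text \<open>The closure of the set of points above the normalized expectations is convex, and its lower
  boundary is the shape function; no limit has to exist for this definition to make sense.\<close>

definition shape :: "bool \<Rightarrow> real \<Rightarrow> real^'d \<Rightarrow> real" where
  "shape lazy c \<xi> = Inf {v. (\<xi>, v) \<in> closure (expectation_hull lazy c)}"

text \<open>The first block is repeated \<open>m\<close> times and the second \<open>n\<close>
  times. Both then take the same time \<open>m * n\<close>, so their concatenation sits exactly at
  the midpoint, and subadditivity bounds its expectation.\<close>

lemma expectation_hull_midpoint: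
  assumes "p \<in> expectation_hull lazy c" "p' \<in> expectation_hull lazy c"
  shows "(1/2) *\<^sub>R (p + p') \<in> expectation_hull lazy c"
proof -
  obtain n x v where p: "p = (ratv n x, v)" "n \<ge> 1" "mom2 lazy c n x" "epc lazy c n x \<le> real n * v"
    using assms(1) by (auto simp: expectation_hull_def)
  obtain m y w where p': "p' = (ratv m y, w)" "m \<ge> 1" "mom2 lazy c m y" "epc lazy c m y \<le> real m * w"
    using assms(2) by (auto simp: expectation_hull_def)
  let ?N = "m * n + n * m" let ?z = "int m *s x + int n *s y"
  have m2: "mom2 lazy c ?N ?z" using p p' by (intro mom2_add mom2_mult)
  have "epc lazy c ?N ?z \<le> epc lazy c (m * n) (int m *s x) + epc lazy c (n * m) (int n *s y)"
    using p p' by (intro epc_add_le mom2_mult)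
  also have "\<dots> \<le> real m * epc lazy c n x + real n * epc lazy c m y" using p p' by (intro add_mono epc_mult_le)
  also have "\<dots> \<le> real m * (real n * v) + real n * (real m * w)" using p p' by (intro add_mono mult_left_mono) auto
  also have "\<dots> = real ?N * ((v + w) / 2)" by (simp add: field_simps)
  finally have le: "epc lazy c ?N ?z \<le> real ?N * ((v + w) / 2)" .
  have "ratv ?N ?z = (1/2) *\<^sub>R (ratv n x + ratv m y)"
    using p(2) p'(2) by (simp add: ratv_def vec_eq_iff field_simps)
  then have "(1/2) *\<^sub>R (p + p') = (ratv ?N ?z, (v + w) / 2)" using p p' by simp
  moreover have "?N \<ge> 1" using p(2) p'(2) by (simp add: Suc_le_eq)
  ultimately show ?thesis using m2 le unfolding expectation_hull_def by blast
qed

lemma convex_closure_expectation_hull: "convex (closure (expectation_hull lazy c))"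
proof (rule closed_midpoint_convex)
  fix p p' assume "p \<in> closure (expectation_hull lazy c)" "p' \<in> closure (expectation_hull lazy c)"
  then obtain f g where f: "\<And>n. f n \<in> expectation_hull lazy c" "f \<longlonglongrightarrow> p" and g: "\<And>n. g n \<in> expectation_hull lazy c" "g \<longlonglongrightarrow> p'"
    unfolding closure_sequential by blast
  have "(\<lambda>n. (1/2) *\<^sub>R (f n + g n)) \<longlonglongrightarrow> (1/2) *\<^sub>R (p + p')" by (intro tendsto_intros f g)
  moreover have "(1/2) *\<^sub>R (f n + g n) \<in> expectation_hull lazy c" for n by (intro expectation_hull_midpoint f g)
  ultimately show "(1/2) *\<^sub>R (p + p') \<in> closure (expectation_hull lazy c)"
    unfolding closure_sequential by (intro exI[of _ "\<lambda>n. (1/2) *\<^sub>R (f n + g n)"] conjI allI)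
qed simp

lemma closure_expectation_hull_nonneg:
  assumes "(\<xi>, v) \<in> closure (expectation_hull lazy c)" shows "0 \<le> v"
proof -
  have "expectation_hull lazy c \<subseteq> {p. 0 \<le> snd p}"
  proof
    fix p assume "p \<in> expectation_hull lazy c"
    then obtain n x v where p: "p = (ratv n x, v)" "n \<ge> 1" "epc lazy c n x \<le> real n * v" by (auto simp: expectation_hull_def)
    then have "0 \<le> real n * v" using epc_nonneg[of lazy c n x] by linarith
    then show "p \<in> {p. 0 \<le> snd p}" using p by (simp add: zero_le_mult_iff)
  qed
  moreover have "closed {p :: (real^'d) \<times> real. 0 \<le> snd p}" by (intro closed_Collect_le continuous_intros)
  ultimately have "closure (expectation_hull lazy c) \<subseteq> {p. 0 \<le> snd p}" by (rule closure_minimal)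
  then show ?thesis using assms by auto
qed

lemma shape_le: "(\<xi>, v) \<in> closure (expectation_hull lazy c) \<Longrightarrow> shape lazy c \<xi> \<le> v"
  unfolding shape_def by (rule cInf_lower) (auto intro!: bdd_belowI[of _ 0] closure_expectation_hull_nonneg)

lemma shape_attained:
  assumes "(\<xi>, v) \<in> closure (expectation_hull lazy c)"
  shows "(\<xi>, shape lazy c \<xi>) \<in> closure (expectation_hull lazy c)"
proof -
  let ?V = "{v. (\<xi>, v) \<in> closure (expectation_hull lazy c)}"
  have "?V = (\<lambda>v. (\<xi>, v)) -` closure (expectation_hull lazy c)" by auto
  then have "closed ?V" by (simp add: closed_vimage continuous_on_Pair continuous_on_const continuous_on_id)
  moreover have "bdd_below ?V" by (auto intro!: bdd_belowI[of _ 0] closure_expectation_hull_nonneg)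
  ultimately have "Inf ?V \<in> ?V" using assms by (intro closed_contains_Inf) auto
  then show ?thesis by (simp add: shape_def)
qed

lemma mom2_admissible:
  assumes "c \<ge> 0" "admissible lazy n 0 x" "dst 0 x + 40 * JJ \<le> n"
  shows "mom2 lazy c n x"
  using pcost_square_integrable[OF assms] by (simp add: mom2_def)

lemma in_closure_expectation_hull:
  assumes "n \<ge> 1" "mom2 lazy c n x"
  shows "(ratv n x, epc lazy c n x / real n) \<in> closure (expectation_hull lazy c)"
proof -
  have "(ratv n x, epc lazy c n x / real n) \<in> expectation_hull lazy c" using assms unfolding expectation_hull_def by force
  then show ?thesis using closure_subset by blast
qed

text \<open>Multiples \<open>k\<close> of signed unit vectors, with \<open>k\<close> slightly below
  the time \<open>2 * N\<close>, have second moments; after normalisation they span an l1 ball of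
  radius \<open>\<rho> \<ge> r\<close>. The point \<open>\<xi>\<close> is a convex combination of
  the origin and those with the signs of its own coordinates.\<close>

lemma closure_expectation_hull_fiber:
  assumes c: "c \<ge> 0" and xi: "\<xi> \<in> intU"
  shows "\<exists>v. (\<xi>, v) \<in> closure (expectation_hull lazy c)"
proof -
  define r where "r = l1_real \<xi>"
  have r: "0 \<le> r" "r < 1" using xi l1_real_nonneg[of \<xi>] by (auto simp: r_def intU_def)
  let ?C = "closure (expectation_hull lazy c)"
  \<comment> \<open>This size makes \<open>\<rho> = 1 - 20 JJ / N\<close> at least
    \<open>r\<close>.\<close>
  define N where "N = 20 * JJ + nat \<lceil>20 * real JJ / (1 - r)\<rceil>"
  have J0: "JJ \<ge> 1" by (simp add: JJ_def)
  have NJ: "20 * JJ \<le> N" "1 \<le> N" using J0 by (simp_all add: N_def)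
  define \<rho> where "\<rho> = (real N - 20 * real JJ) / real N"
  have "20 * real JJ / (1 - r) \<le> real N" unfolding N_def by linarith
  then have "20 * real JJ \<le> real N * (1 - r)" using r by (simp add: field_simps)
  then have \<rho>r: "r \<le> \<rho>" using NJ by (simp add: \<rho>_def field_simps)
  have m0: "mom2 lazy c (2 * N) 0"
    by (rule mom2_admissible[OF c]) (use NJ in \<open>auto simp: admissible_def dst_def\<close>)
  have z: "(0, epc lazy c (2 * N) 0 / real (2 * N)) \<in> ?C"
  proof -
    have "ratv (2 * N) (0 :: int^'d) = 0" by (simp add: ratv_def vec_eq_iff)
    then show ?thesis using in_closure_expectation_hull[OF _ m0] NJ by simp
  qed
  show ?thesis
  proof (cases "r = 0")
    case True
    then have "\<xi> = 0" unfolding r_def l1_real_def by (auto simp: sum_nonneg_eq_0_iff vec_eq_iff)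
    then show ?thesis using z by blast
  next
    case False
    then have r0: "r > 0" "\<rho> > 0" using r \<rho>r by auto
    define sg where "sg i = (if \<xi> $ i \<ge> 0 then 1 else -1 :: int)" for i
    \<comment> \<open>An even displacement at the even time \<open>2 * N\<close> has the right
      parity, and exactly the \<open>40 * JJ\<close> spare steps demanded by
      \<open>mom2_admissible\<close> are left.\<close>
    define k where "k = int (2 * (N - 20 * JJ))"
    define X where "X i = axis i (sg i * k)" for i
    have mX: "mom2 lazy c (2 * N) (X i)" for i
    proof (rule mom2_admissible[OF c])
      have "(\<Sum>j\<in>UNIV. X i $ j) = sg i * k"
        unfolding X_def axis_def by simp
      then show "admissible lazy (2 * N) 0 (X i)" by (simp add: admissible_def k_def)
      have "l1_int (X i) = k" by (simp add: X_def abs_mult sg_def k_def)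
      then show "dst 0 (X i) + 40 * JJ \<le> 2 * N" using NJ by (simp add: dst_def k_def)
    qed
    define p' where "p' i = (ratv (2 * N) (X i), epc lazy c (2 * N) (X i) / real (2 * N))" for i
    have p': "p' i \<in> ?C" for i unfolding p'_def using NJ by (intro in_closure_expectation_hull mX) simp
    define p where "p = (\<Sum>i\<in>UNIV. (\<bar>\<xi> $ i\<bar> / r) *\<^sub>R p' i)"
    have p: "p \<in> ?C" unfolding p_def
    proof (rule convex_sum[OF _ convex_closure_expectation_hull])
      show "(\<Sum>i\<in>UNIV. \<bar>\<xi> $ i\<bar> / r) = 1" using r0 by (simp add: r_def l1_real_def flip: sum_divide_distrib)
    qed (use p' r0 in auto)
    have fp: "fst p = (\<rho> / r) *\<^sub>R \<xi>"
    proof (subst vec_eq_iff, rule allI)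
      fix j
      have "fst p $ j = (\<Sum>i\<in>UNIV. (\<bar>\<xi> $ i\<bar> / r) * (ratv (2 * N) (X i) $ j))"
        by (simp add: p_def fst_sum p'_def)
      also have "\<dots> = (\<Sum>i\<in>UNIV. if i = j then (\<bar>\<xi> $ j\<bar> / r) * (real_of_int (sg j * k) / real (2 * N)) else 0)"
        by (intro sum.cong refl) (auto simp: ratv_def X_def axis_def)
      also have "\<dots> = (\<bar>\<xi> $ j\<bar> / r) * (real_of_int (sg j * k) / real (2 * N))" by simp
      also have "real_of_int (sg j * k) / real (2 * N) = real_of_int (sg j) * \<rho>"
        using NJ by (simp add: k_def \<rho>_def of_nat_diff field_simps)
      also have "(\<bar>\<xi> $ j\<bar> / r) * (real_of_int (sg j) * \<rho>) = ((\<rho> / r) *\<^sub>R \<xi>) $ j"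
        by (simp add: sg_def)
      finally show "fst p $ j = ((\<rho> / r) *\<^sub>R \<xi>) $ j" .
    qed
    let ?w = "(r / \<rho>) *\<^sub>R p + (1 - r / \<rho>) *\<^sub>R (0, epc lazy c (2 * N) 0 / real (2 * N))"
    have "?w \<in> ?C" using r0 \<rho>r by (intro convexD[OF convex_closure_expectation_hull p z]) auto
    moreover have "fst ?w = \<xi>" using fp r0 by simp
    ultimately show ?thesis by (metis prod.collapse)
  qed
qed

lemma shape_mem: "c \<ge> 0 \<Longrightarrow> \<xi> \<in> intU \<Longrightarrow> (\<xi>, shape lazy c \<xi>) \<in> closure (expectation_hull lazy c)"
  using closure_expectation_hull_fiber shape_attained by blast

lemma shape_nonneg: "c \<ge> 0 \<Longrightarrow> \<xi> \<in> intU \<Longrightarrow> 0 \<le> shape lazy c \<xi>"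
  using shape_mem closure_expectation_hull_nonneg by blast

lemma convex_shape:
  assumes c: "c \<ge> 0" shows "convex_on intU (shape lazy c)"
proof (rule convex_onI[OF _ convex_intU])
  fix t :: real and x y :: "real^'d" assume t: "0 < t" "t < 1" and xy: "x \<in> intU" "y \<in> intU"
  have "(1 - t) *\<^sub>R (x, shape lazy c x) + t *\<^sub>R (y, shape lazy c y) \<in> closure (expectation_hull lazy c)"
    using t xy c by (intro convexD[OF convex_closure_expectation_hull] shape_mem) auto
  then show "shape lazy c ((1 - t) *\<^sub>R x + t *\<^sub>R y) \<le> (1 - t) * shape lazy c x + t * shape lazy c y"
    by (intro shape_le) simp
qed

lemma continuous_shape: "c \<ge> 0 \<Longrightarrow> continuous_on intU (shape lazy c)"
  by (rule convex_on_continuous[OF open_intU convex_shape])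

lemma shape_lower: "n \<ge> 1 \<Longrightarrow> mom2 lazy c n x \<Longrightarrow> real n * shape lazy c (ratv n x) \<le> epc lazy c n x"
  using shape_le[OF in_closure_expectation_hull, of n lazy c x] by (simp add: field_simps)

text \<open>Points of the closure are replaced by an actual pair \<open>(n, x)\<close>. The
  condition \<open>x \<noteq> 0\<close> is included because \<open>ray_upper\<close> and
  \<open>ray_lower\<close> separate blocks by moving along a nonzero vector.\<close>

lemma shape_approx:
  assumes c: "c \<ge> 0" and xi: "\<xi> \<in> intU" and d: "\<delta> > 0"
  obtains n x where "n \<ge> 1" "mom2 lazy c n x" "x \<noteq> 0" "l1_real (ratv n x - \<xi>) < \<delta>"
    "epc lazy c n x \<le> real n * (shape lazy c \<xi> + \<delta>)"
proof -
  let ?d = "real CARD('d)"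
  have dd: "?d > 0" by simp
  define \<eta> where "\<eta> = min (\<delta> / 2) (\<delta> / (2 * ?d))"
  have \<eta>: "\<eta> > 0" "\<eta> \<le> \<delta> / 2" "?d * \<eta> \<le> \<delta> / 2"
  proof -
    show "\<eta> > 0" "\<eta> \<le> \<delta> / 2" using d by (simp_all add: \<eta>_def)
    have "?d * \<eta> \<le> ?d * (\<delta> / (2 * ?d))" unfolding \<eta>_def by (intro mult_left_mono) auto
    then show "?d * \<eta> \<le> \<delta> / 2" by simp
  qed
  obtain p where p: "p \<in> expectation_hull lazy c" "dist p (\<xi>, shape lazy c \<xi>) < \<eta>"
    using shape_mem[OF c xi, of lazy] \<eta>(1) unfolding closure_approachable by blast
  then obtain n x v where n: "p = (ratv n x, v)" "n \<ge> 1" "mom2 lazy c n x" "epc lazy c n x \<le> real n * v"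
    by (auto simp: expectation_hull_def)
  have "dist (ratv n x) \<xi> < \<eta>" "dist v (shape lazy c \<xi>) < \<eta>"
    using p(2) dist_fst_le[of p "(\<xi>, shape lazy c \<xi>)"] dist_snd_le[of p "(\<xi>, shape lazy c \<xi>)"] n(1) by auto
  then have v: "v < shape lazy c \<xi> + \<delta> / 2" and "norm (ratv n x - \<xi>) < \<eta>" using \<eta> by (auto simp: dist_real_def dist_norm)
  then have "?d * norm (ratv n x - \<xi>) < ?d * \<eta>" using dd by (intro mult_strict_left_mono)
  then have l: "l1_real (ratv n x - \<xi>) < \<delta> / 2" using l1_real_le_norm[of "ratv n x - \<xi>"] \<eta>(3) by linarith
  show ?thesis
  proof (cases "x = 0")
    case False
    have "real n * v \<le> real n * (shape lazy c \<xi> + \<delta>)" using v d by (intro mult_left_mono) auto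
    then have "epc lazy c n x \<le> real n * (shape lazy c \<xi> + \<delta>)" using n(4) by linarith
    moreover have "l1_real (ratv n x - \<xi>) < \<delta>" using l d by linarith
    ultimately show ?thesis using that n(2,3) False by blast
  next
    case True
    obtain a b :: 'd where "a \<noteq> b" using two_axes by blast
    \<comment> \<open>A loop \<open>x = 0\<close> is repeated \<open>R\<close> times and followed by
      one fixed move of length two in \<open>N\<close> steps. For large \<open>R\<close> this move
      changes the normalised position and the average cost by at most \<open>\<delta> / 2\<close>
      each.\<close>
    define x1 where "x1 = (axis a 2 :: int^'d)"
    define N where "N = 2 + 40 * JJ"
    have "even N" by (simp add: N_def)
    have m1: "mom2 lazy c N x1"
    proof (rule mom2_admissible[OF c])
      have "(\<Sum>j\<in>UNIV. x1 $ j) = 2" unfolding x1_def axis_def by simp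
      then show "admissible lazy N 0 x1" using \<open>even N\<close> by (simp add: admissible_def)
      show "dst 0 x1 + 40 * JJ \<le> N" by (simp add: dst_def x1_def N_def)
    qed
    define R where "R = nat \<lceil>(2 + epc lazy c N x1) * (2 / \<delta>)\<rceil> + 1"
    have R1: "R \<ge> 1" by (simp add: R_def)
    have R: "(2 + epc lazy c N x1) * (2 / \<delta>) \<le> real R" unfolding R_def by linarith
    have e0: "0 \<le> epc lazy c N x1" by (rule epc_nonneg)
    have R2: "2 + epc lazy c N x1 \<le> real R * (\<delta> / 2)" using R d by (simp add: field_simps)
    let ?n = "R * n + N"
    have Rn: "real R \<le> real ?n"
    proof -
      have "R * 1 \<le> R * n" using n(2) by (intro mult_left_mono) auto
      then have "R \<le> ?n" by linarith
      then show ?thesis by (simp only: of_nat_le_iff)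
    qed
    have Rn2: "real R * (\<delta> / 2) \<le> real ?n * (\<delta> / 2)" using Rn d by (intro mult_right_mono) auto
    have "int R *s x + x1 = x1" using True by (simp add: vec_eq_iff)
    then have m: "mom2 lazy c ?n x1" and e: "epc lazy c ?n x1 \<le> real R * epc lazy c n x + epc lazy c N x1"
      using mom2_add[OF mom2_mult[OF n(3) R1] m1] epc_add_le[OF mom2_mult[OF n(3) R1] m1] epc_mult_le[OF n(3) R1] by auto
    show ?thesis
    proof (rule that[of ?n x1])
      show "1 \<le> ?n" by (simp add: N_def)
      show "mom2 lazy c ?n x1" by (rule m)
      show "x1 \<noteq> 0" by (auto simp: x1_def vec_eq_iff axis_def)
      have "l1_real (ratv ?n x1) = 2 / real ?n"
      proof -
        have "l1_real (ratv ?n x1) = (\<Sum>j\<in>UNIV. if j = a then 2 / real ?n else 0)"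
          unfolding l1_real_def by (intro sum.cong) (auto simp: ratv_def x1_def axis_def)
        then show ?thesis by simp
      qed
      also have "\<dots> \<le> \<delta> / 2"
      proof -
        have "2 \<le> real ?n * (\<delta> / 2)" using R2 Rn2 e0 by linarith
        moreover have "0 < ?n" by (simp add: N_def)
        then have "real ?n > 0" by (simp only: of_nat_0_less_iff)
        ultimately show ?thesis by (simp add: field_simps)
      qed
      finally have 1: "l1_real (ratv ?n x1) \<le> \<delta> / 2" .
      have "ratv n x = 0" using True by (simp add: ratv_def vec_eq_iff)
      then have "l1_real (- \<xi>) < \<delta> / 2" using l by simp
      then show "l1_real (ratv ?n x1 - \<xi>) < \<delta>" using l1_real_triangle[of "ratv ?n x1" "- \<xi>"] 1 by simp
      have s0: "0 \<le> shape lazy c \<xi>" by (rule shape_nonneg[OF c xi])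
      have "real R * epc lazy c n x \<le> real R * (real n * v)" using n(4) by (intro mult_left_mono) auto
      also have "\<dots> \<le> real R * (real n * (shape lazy c \<xi> + \<delta> / 2))" using v by (intro mult_left_mono) auto
      also have "\<dots> = real (R * n) * (shape lazy c \<xi> + \<delta> / 2)" by simp
      also have "\<dots> \<le> real ?n * (shape lazy c \<xi> + \<delta> / 2)" using s0 d by (intro mult_right_mono) auto
      finally have "epc lazy c ?n x1 \<le> real ?n * (shape lazy c \<xi> + \<delta> / 2) + real ?n * (\<delta> / 2)"
        using e R2 Rn2 by linarith
      then show "epc lazy c ?n x1 \<le> real ?n * (shape lazy c \<xi> + \<delta>)" by (simp add: algebra_simps)
    qed
  qed
qed

end

section \<open>From rays to all endpoints\<close>

text \<open>Consecutive times \<open>i^2 * m\<close> near \<open>\<theta> k\<close> differ by a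
  multiple of the square root of \<open>k\<close>, so this thinned sequence still meets every
  relative window \<open>\<delta> k\<close>.\<close>

lemma time_grid:
  fixes \<theta> \<delta> :: real
  assumes m: "m \<ge> 1" and t: "\<theta> > 0" and d: "\<delta> > 0"
  shows "\<forall>\<^sub>F k in sequentially. \<exists>i\<ge>i0. \<bar>real (i\<^sup>2 * m) - \<theta> * real k\<bar> \<le> \<delta> * real k"
proof -
  define k0 where "k0 = max (9 * real m * \<theta> / \<delta>\<^sup>2) (real m * (real i0 + 1)\<^sup>2 / \<theta>)"
  have "\<exists>i\<ge>i0. \<bar>real (i\<^sup>2 * m) - \<theta> * real k\<bar> \<le> \<delta> * real k" if k: "k \<ge> nat \<lceil>k0\<rceil>" for k
  proof -
    have k0: "k0 \<le> real k" using k by linarith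
    have m0: "real m > 0" using m by simp
    \<comment> \<open>The integer part of \<open>s\<close> will be \<open>i\<close>; since
      \<open>s^2 * m = \<theta> k\<close>, the error is at most
      \<open>(2 i + 1) m \<le> 3 s m\<close>.\<close>
    define s where "s = sqrt (\<theta> * real k / real m)"
    have s2: "s\<^sup>2 = \<theta> * real k / real m" using t by (simp add: s_def)
    have k1: "9 * real m * \<theta> / \<delta>\<^sup>2 \<le> real k" "real m * (real i0 + 1)\<^sup>2 / \<theta> \<le> real k"
      using k0 by (auto simp: k0_def)
    have si: "real i0 + 1 \<le> s"
      unfolding s_def by (rule real_le_rsqrt) (use k1(2) t m0 in \<open>simp add: field_simps\<close>)
    have ms: "3 * s * real m \<le> \<delta> * real k"
    proof (rule power2_le_imp_le)
      have "(3 * s * real m)\<^sup>2 = 9 * real m * (s\<^sup>2 * real m)" by (simp add: power2_eq_square)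
      also have "\<dots> = 9 * real m * \<theta> * real k" using m0 by (simp add: s2)
      also have "\<dots> \<le> (\<delta>\<^sup>2 * real k) * real k" using k1(1) d by (intro mult_right_mono) (auto simp: field_simps)
      also have "\<dots> = (\<delta> * real k)\<^sup>2" by (simp add: power2_eq_square)
      finally show "(3 * s * real m)\<^sup>2 \<le> (\<delta> * real k)\<^sup>2" .
    qed (use d in simp)
    define i where "i = nat \<lfloor>s\<rfloor>"
    have i: "real i \<le> s" "s < real i + 1" using si by (auto simp: i_def)
    have "(real i)\<^sup>2 \<le> s\<^sup>2" using i si by (intro power_mono) auto
    then have "real (i\<^sup>2 * m) \<le> s\<^sup>2 * real m" using m0 by (simp add: mult_right_mono)
    then have 1: "real (i\<^sup>2 * m) \<le> \<theta> * real k" using m0 by (simp add: s2)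
    have "s\<^sup>2 \<le> (real i + 1)\<^sup>2" using i si by (intro power_mono) auto
    then have "s\<^sup>2 * real m \<le> (real i + 1)\<^sup>2 * real m" using m0 by (intro mult_right_mono) auto
    moreover have "s\<^sup>2 * real m = \<theta> * real k" using m0 by (simp add: s2)
    moreover have "(real i + 1)\<^sup>2 * real m = real (i\<^sup>2 * m) + (2 * real i + 1) * real m"
      by (simp add: power2_eq_square algebra_simps)
    ultimately have "\<theta> * real k \<le> real (i\<^sup>2 * m) + (2 * real i + 1) * real m" by linarith
    moreover have "(2 * real i + 1) * real m \<le> 3 * s * real m" using i si by (intro mult_right_mono) auto
    ultimately have 2: "\<theta> * real k - real (i\<^sup>2 * m) \<le> \<delta> * real k" using ms by linarith
    have "i0 \<le> i" using i si by linarith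
    moreover have "\<bar>real (i\<^sup>2 * m) - \<theta> * real k\<bar> \<le> \<delta> * real k" using 1 2 by linarith
    ultimately show ?thesis by blast
  qed
  then show ?thesis by (intro eventually_sequentiallyI)
qed

lemma ratv_scale: "real n *\<^sub>R ratv n x = (\<chi> i. real_of_int (x $ i))" if "n \<ge> 1"
  using that by (simp add: ratv_def vec_eq_iff)

lemma l1_real_of_int: "l1_real (\<chi> i. real_of_int (x $ i)) = real_of_int (l1_int x)"
  by (simp add: l1_real_def l1_int_def)

lemma l1_real_diff_commute: "l1_real (x - y) = l1_real (y - x)"
  using l1_real_minus[of "x - y"] by simp

lemma l1_real_triangle_diff: "l1_real (x - z) \<le> l1_real (x - y) + l1_real (y - z)"
  using l1_real_triangle[of "x - y" "y - z"] by simp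

text \<open>The geometry of the sandwich: a point of the ray through \<open>\<xi>' = \<xi>/\<theta>\<close> at time close to
  \<open>\<theta> k\<close>, \<open>\<theta> = 1 \<plusminus> \<eta>\<close>, can be joined to \<open>x\<close> at time \<open>k\<close> within the remaining steps.\<close>

lemma sandwich_geometry:
  fixes \<xi> \<xi>' :: "real^'d"
  assumes m: "m \<ge> 1" and eta: "0 < \<eta>" "\<eta> \<le> 1/4" and th: "\<bar>\<theta> - 1\<bar> = \<eta>"
    and xi: "l1_real \<xi> < 1" "\<xi> = \<theta> *\<^sub>R \<xi>'" and d: "0 < \<delta>" "\<delta> \<le> \<eta> / 240"
    and y: "l1_real (ratv m y - \<xi>') < \<delta>"
  shows "\<forall>\<^sub>F k in sequentially. \<exists>i\<ge>i0. \<exists>l\<ge>l0. \<bar>real (i\<^sup>2 * m) - \<theta> * real k\<bar> \<le> \<delta> * real k \<and>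
     (\<forall>x. l1_real (ratv k x - \<xi>) < \<delta> \<longrightarrow> (\<forall>n. real n = \<bar>real k - real (i\<^sup>2 * m)\<bar> \<longrightarrow>
        12 * l \<le> n \<and> dst (int (i\<^sup>2) *s y) x + J \<le> l \<and>
        l1_int x \<le> int (nat \<lceil>144 / \<eta>\<rceil> * l) \<and> l1_int (int (i\<^sup>2) *s y) \<le> int (nat \<lceil>144 / \<eta>\<rceil> * l)))"
proof -
  define k0 where "k0 = max (48 * (real J + 1) / \<eta>) (48 * (real l0 + 1) / \<eta>)"
  have th0: "\<theta> > 0" "\<theta> \<le> 2" "\<theta> \<ge> 3/4" using th eta by auto
  have "\<forall>\<^sub>F k in sequentially. \<exists>i\<ge>i0. \<bar>real (i\<^sup>2 * m) - \<theta> * real k\<bar> \<le> \<delta> * real k"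
    by (rule time_grid[OF m th0(1) d(1)])
  moreover have "\<forall>\<^sub>F k in sequentially. k \<ge> max 1 (nat \<lceil>k0\<rceil>)" by (rule eventually_ge_at_top)
  ultimately show ?thesis
  proof eventually_elim
    case (elim k)
    then obtain i where i: "i \<ge> i0" "\<bar>real (i\<^sup>2 * m) - \<theta> * real k\<bar> \<le> \<delta> * real k" by blast
    have kc: "k \<ge> nat \<lceil>k0\<rceil>" "k \<ge> 1" using elim(2) by auto
    then have kk: "k0 \<le> real k" "k \<ge> 1" by linarith+
    have kJ: "real J + 1 \<le> \<eta> * real k / 48" and kl: "real l0 + 1 \<le> \<eta> * real k / 48"
      using kk(1) eta by (auto simp: k0_def field_simps)
    \<comment> \<open>The scale \<open>l\<close> is limited from above by
      \<open>12 * l \<le> n\<close>, where \<open>n\<close> is nearly \<open>\<eta> k\<close> or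
      more, and from below by the distance to be bridged, at most \<open>\<eta> k / 48\<close>, plus
      \<open>J\<close>.\<close>
    define l where "l = nat \<lfloor>\<eta> * real k / 24\<rfloor>"
    have ek: "0 \<le> \<eta> * real k" using eta by simp
    have l: "real l \<le> \<eta> * real k / 24" "\<eta> * real k / 24 - 1 \<le> real l"
      using ek unfolding l_def by linarith+
    have l48: "\<eta> * real k / 48 \<le> real l" using l kl by linarith
    have dk: "\<delta> * real k \<le> \<eta> * real k / 240" using d mult_right_mono[of \<delta> "\<eta> / 240" "real k"] by simp
    show ?case
    proof (rule exI[of _ i], intro conjI i(1), rule exI[of _ l], intro conjI allI impI i(2))
      show "l0 \<le> l" using l48 kl by linarith
    next
      fix x :: "int^'d" and n assume x: "l1_real (ratv k x - \<xi>) < \<delta>" and n: "real n = \<bar>real k - real (i\<^sup>2 * m)\<bar>"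
      have nk: "\<eta> * real k - \<delta> * real k \<le> real n"
      proof -
        have "\<bar>\<theta> * real k - real k\<bar> = \<bar>(\<theta> - 1) * real k\<bar>" by (simp add: left_diff_distrib)
        also have "\<dots> = \<bar>\<theta> - 1\<bar> * real k" by (simp add: abs_mult)
        finally have "\<bar>\<theta> - 1\<bar> * real k = \<bar>\<theta> * real k - real k\<bar>" by (rule sym)
        then have "\<eta> * real k = \<bar>\<theta> * real k - real k\<bar>" using th by simp
        then show ?thesis using n i(2) by linarith
      qed
      show "12 * l \<le> n"
      proof -
        have "12 * real l \<le> real n" using l(1) nk dk ek by linarith
        then show ?thesis by linarith
      qed
      let ?z = "int (i\<^sup>2) *s y"
      have X: "(\<chi> i. real_of_int (x $ i)) = real k *\<^sub>R ratv k x" by (rule ratv_scale[OF kk(2), symmetric])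
      have Z: "(\<chi> j. real_of_int (?z $ j)) = real (i\<^sup>2 * m) *\<^sub>R ratv m y"
        using m by (simp add: ratv_def vec_eq_iff)
      have "real_of_int (l1_int (x - ?z)) = l1_real (real k *\<^sub>R ratv k x - real (i\<^sup>2 * m) *\<^sub>R ratv m y)"
      proof -
        have "(\<chi> j. real_of_int ((x - ?z) $ j)) = (\<chi> j. real_of_int (x $ j)) - (\<chi> j. real_of_int (?z $ j))"
          by (simp add: vec_eq_iff)
        then show ?thesis using l1_real_of_int[of "x - ?z"] X Z by simp
      qed
      also have "\<dots> \<le> l1_real (real k *\<^sub>R ratv k x - real k *\<^sub>R \<xi>) + l1_real (real k *\<^sub>R \<xi> - real (i\<^sup>2 * m) *\<^sub>R ratv m y)"
        by (rule l1_real_triangle_diff)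
      also have "l1_real (real k *\<^sub>R ratv k x - real k *\<^sub>R \<xi>) = real k * l1_real (ratv k x - \<xi>)"
        by (simp add: l1_real_scale flip: scaleR_diff_right)
      also have "l1_real (real k *\<^sub>R \<xi> - real (i\<^sup>2 * m) *\<^sub>R ratv m y)
        \<le> l1_real (real k *\<^sub>R \<xi> - (\<theta> * real k) *\<^sub>R ratv m y) + l1_real ((\<theta> * real k) *\<^sub>R ratv m y - real (i\<^sup>2 * m) *\<^sub>R ratv m y)"
        by (rule l1_real_triangle_diff)
      also have "real k *\<^sub>R \<xi> - (\<theta> * real k) *\<^sub>R ratv m y = (\<theta> * real k) *\<^sub>R (\<xi>' - ratv m y)"
        using xi(2) by (simp add: scaleR_diff_right mult.commute)
      also have "l1_real ((\<theta> * real k) *\<^sub>R (\<xi>' - ratv m y)) = \<theta> * real k * l1_real (ratv m y - \<xi>')"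
        using th0 l1_real_diff_commute[of \<xi>' "ratv m y"] by (simp add: l1_real_scale)
      also have "(\<theta> * real k) *\<^sub>R ratv m y - real (i\<^sup>2 * m) *\<^sub>R ratv m y = (\<theta> * real k - real (i\<^sup>2 * m)) *\<^sub>R ratv m y"
        by (simp add: scaleR_diff_left)
      also have "l1_real ((\<theta> * real k - real (i\<^sup>2 * m)) *\<^sub>R ratv m y) = \<bar>\<theta> * real k - real (i\<^sup>2 * m)\<bar> * l1_real (ratv m y)"
        by (rule l1_real_scale)
      finally have "real_of_int (l1_int (x - ?z)) \<le> real k * l1_real (ratv k x - \<xi>)
         + (\<theta> * real k * l1_real (ratv m y - \<xi>') + \<bar>\<theta> * real k - real (i\<^sup>2 * m)\<bar> * l1_real (ratv m y))" by simp
      \<comment> \<open>The deviations of \<open>x\<close> from \<open>k \<xi>\<close>, of the ray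
        from the direction \<open>\<xi>'\<close>, and of its time from \<open>\<theta> k\<close> add
        up to \<open>5 \<delta> k\<close>; the choice \<open>\<delta> \<le> \<eta> / 240\<close>
        turns this into \<open>\<eta> k / 48\<close>.\<close>
      also have "\<dots> \<le> real k * \<delta> + (2 * real k * \<delta> + (\<delta> * real k) * 2)"
      proof (intro add_mono mult_mono)
        have "l1_real \<xi>' = l1_real \<xi> / \<theta>" using xi(2) th0 by (simp add: l1_real_scale)
        also have "\<dots> \<le> 4 / 3" using xi(1) th0 l1_real_nonneg[of \<xi>] by (simp add: field_simps)
        finally have "l1_real \<xi>' \<le> 4 / 3" .
        moreover have "\<delta> \<le> 1/3" using d eta by simp
        ultimately show "l1_real (ratv m y) \<le> 2" using l1_real_triangle[of "ratv m y - \<xi>'" \<xi>'] y by simp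
        show "\<bar>\<theta> * real k - real (i\<^sup>2 * m)\<bar> \<le> \<delta> * real k" using i(2) by linarith
      qed (use x y th0 d l1_real_nonneg in auto)
      also have "\<dots> = 5 * (\<delta> * real k)" by simp
      finally have D: "real_of_int (l1_int (x - ?z)) \<le> \<eta> * real k / 48" using dk by linarith
      have "real (dst ?z x) = real_of_int (l1_int (x - ?z))" by (metis int_dst of_int_of_nat_eq)
      then have D': "real (dst ?z x) \<le> \<eta> * real k / 48" using D by simp
      show "dst ?z x + J \<le> l"
      proof -
        have "real (dst ?z x) + real J \<le> real l" using D' kJ l by linarith
        then show ?thesis by linarith
      qed
      have "real_of_int (l1_int x) = real k * l1_real (ratv k x)" using l1_real_of_int[of x] X by (simp add: l1_real_scale)
      also have "\<dots> \<le> real k * 2"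
      proof (intro mult_left_mono)
        have "l1_real (ratv k x) \<le> l1_real (ratv k x - \<xi>) + l1_real \<xi>" using l1_real_triangle[of "ratv k x - \<xi>" \<xi>] by simp
        then show "l1_real (ratv k x) \<le> 2" using x xi(1) d eta by linarith
      qed simp
      finally have x2: "real_of_int (l1_int x) \<le> 2 * real k" by simp
      have "l1_int ?z \<le> l1_int x + l1_int (x - ?z)" using l1_int_triangle_diff[of ?z 0 x] l1_int_diff_commute[of x ?z] by simp
      then have "real_of_int (l1_int ?z) \<le> real_of_int (l1_int x + l1_int (x - ?z))" by (simp only: of_int_le_iff)
      then have z3: "real_of_int (l1_int ?z) \<le> 3 * real k"
      proof -
        have "\<eta> * real k \<le> 1 * real k" using eta by (intro mult_right_mono) auto
        then show ?thesis using \<open>real_of_int (l1_int ?z) \<le> real_of_int (l1_int x + l1_int (x - ?z))\<close> x2 D by simp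
      qed
      have Lk: "3 * real k \<le> real (nat \<lceil>144 / \<eta>\<rceil> * l)"
      proof -
        have "3 * real k = 144 / \<eta> * (\<eta> * real k / 48)" using eta by simp
        also have "\<dots> \<le> real (nat \<lceil>144 / \<eta>\<rceil>) * real l"
          using ek by (intro mult_mono[OF real_nat_ceiling_ge l48 of_nat_0_le_iff]) simp
        finally show ?thesis by simp
      qed
      show "l1_int x \<le> int (nat \<lceil>144 / \<eta>\<rceil> * l)" using x2 Lk by linarith
      show "l1_int ?z \<le> int (nat \<lceil>144 / \<eta>\<rceil> * l)" using z3 Lk by linarith
    qed
  qed
qed

context iid_env begin

text \<open>For the upper bound a ray is followed up to a time near \<open>(1 - \<eta>) k\<close>
  and then connected to \<open>x\<close>. For the lower bound an optimal path to \<open>x\<close> is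
  prolonged to a ray point at a time near \<open>(1 + \<eta>) k\<close>, where the cost along the
  ray is bounded below. The rays pass near \<open>\<xi> / (1 -+ \<eta>)\<close>, so that the ray
  point at that time is close to \<open>k \<xi>\<close>.\<close>

lemma local_shape_limit:
  assumes c: "c \<ge> 0" and xi: "\<xi> \<in> intU" and eps: "\<epsilon> > 0"
  shows "\<exists>\<delta>>0. AE W in P. \<forall>\<^sub>F k in sequentially. \<forall>x. admissible lazy k 0 x \<longrightarrow> l1_real (ratv k x - \<xi>) < \<delta> \<longrightarrow>
     ennreal (real k * (shape lazy c \<xi> - \<epsilon>)) \<le> pcost lazy c W k 0 x \<and>
     pcost lazy c W k 0 x \<le> ennreal (real k * (shape lazy c \<xi> + \<epsilon>))"
proof -
  let ?g = "shape lazy c"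
  obtain C where C: "C > 0" "\<And>\<Lambda>::nat. AE W in P. \<forall>\<^sub>F l in sequentially. \<forall>(x::int^'d) y n.
     l1_int x \<le> int (\<Lambda> * l) \<longrightarrow> l1_int y \<le> int (\<Lambda> * l) \<longrightarrow> dst x y + 20 * JJ \<le> l \<longrightarrow> 12 * l \<le> n \<longrightarrow>
     admissible lazy n x y \<longrightarrow> pcost lazy c W n x y \<le> ennreal (C * real n)"
    using connection_AE[OF c, of lazy] by blast
  have l1xi: "l1_real \<xi> < 1" using xi by (simp add: intU_def)
  have "isCont ?g \<xi>" using continuous_on_eq_continuous_at[OF open_intU, of ?g] continuous_shape[OF c, of lazy] xi by blast
  then obtain r0 where r0: "r0 > 0" "\<And>z. dist z \<xi> < r0 \<Longrightarrow> dist (?g z) (?g \<xi>) < \<epsilon> / 4"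
    unfolding continuous_at_eps_delta using eps by (metis divide_pos_pos zero_less_numeral)
  obtain r1 where r1: "r1 > 0" "ball \<xi> r1 \<subseteq> intU" using open_intU xi by (meson open_contains_ball)
  define r where "r = min r0 r1"
  have r: "r > 0" using r0 r1 by (simp add: r_def)
  have near: "z \<in> intU \<and> \<bar>?g z - ?g \<xi>\<bar> < \<epsilon> / 4" if "l1_real (z - \<xi>) < r" for z
  proof -
    have "norm (z - \<xi>) \<le> l1_real (z - \<xi>)" unfolding l1_real_def by (rule norm_le_l1_cart)
    then have "dist z \<xi> < r" using that by (simp add: dist_norm)
    then have "z \<in> ball \<xi> r1" "dist z \<xi> < r0" by (auto simp: r_def dist_commute)
    then show ?thesis using r0(2) r1(2) by (auto simp: dist_real_def)
  qed
  \<comment> \<open>The connection costs \<open>C\<close> times at most \<open>2 \<eta> k\<close>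
    steps, which must stay below \<open>(\<epsilon> / 4) k\<close>, and
    \<open>\<xi> / (1 -+ \<eta>)\<close> must remain where the shape function is within
    \<open>\<epsilon> / 4\<close> of its value at \<open>\<xi>\<close>.\<close>
  define \<eta> where "\<eta> = min (1/4) (min (r / 4) (\<epsilon> / (8 * C)))"
  have eta: "0 < \<eta>" "\<eta> \<le> 1/4" "\<eta> \<le> r / 4" "\<eta> \<le> \<epsilon> / (8 * C)" using r eps C(1) by (auto simp: \<eta>_def)
  have eC: "2 * C * \<eta> \<le> \<epsilon> / 4" using eta(4) C(1) by (simp add: field_simps)
  define \<delta> where "\<delta> = min (\<eta> / 240) (min (\<epsilon> / 16) (r / 4))"
  have del: "0 < \<delta>" "\<delta> \<le> \<eta> / 240" "\<delta> \<le> \<epsilon> / 16" "\<delta> \<le> r / 4" using eta r eps by (auto simp: \<delta>_def)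
  define \<Lambda> where "\<Lambda> = nat \<lceil>144 / \<eta>\<rceil>"
  have ray: "\<exists>m y. m \<ge> 1 \<and> mom2 lazy c m y \<and> y \<noteq> 0 \<and> l1_real (ratv m y - (1 / \<theta>) *\<^sub>R \<xi>) < \<delta> \<and>
      epc lazy c m y \<le> real m * (?g \<xi> + \<epsilon> / 4 + \<delta>) \<and> ?g \<xi> - \<epsilon> / 4 \<le> ?g (ratv m y)" if th: "\<bar>\<theta> - 1\<bar> = \<eta>" for \<theta>
  proof -
    have th0: "\<theta> \<ge> 3/4" using th eta by auto
    have "(1 / \<theta>) *\<^sub>R \<xi> - \<xi> = ((1 - \<theta>) / \<theta>) *\<^sub>R \<xi>" 
    proof -
      have "(1 - \<theta>) / \<theta> = 1 / \<theta> - 1" using th0 by (simp add: diff_divide_distrib)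
      then show ?thesis by (simp only: scaleR_diff_left scaleR_one)
    qed
    then have "l1_real ((1 / \<theta>) *\<^sub>R \<xi> - \<xi>) = \<eta> / \<theta> * l1_real \<xi>"
      using th th0 by (simp add: l1_real_scale abs_minus_commute)
    also have "\<dots> \<le> 2 * \<eta> * 1"
      using l1xi l1_real_nonneg[of \<xi>] eta th0 by (intro mult_mono) (auto simp: field_simps)
    finally have s: "l1_real ((1 / \<theta>) *\<^sub>R \<xi> - \<xi>) \<le> r / 2" using eta(3) by simp
    have "l1_real ((1 / \<theta>) *\<^sub>R \<xi> - \<xi>) < r" using s r by linarith
    note nt = near[OF this]
    have n1: "(1 / \<theta>) *\<^sub>R \<xi> \<in> intU" "?g ((1 / \<theta>) *\<^sub>R \<xi>) \<le> ?g \<xi> + \<epsilon> / 4"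
      using nt by (blast, linarith)
    obtain m y where my: "m \<ge> 1" "mom2 lazy c m y" "y \<noteq> 0" "l1_real (ratv m y - (1 / \<theta>) *\<^sub>R \<xi>) < \<delta>"
      "epc lazy c m y \<le> real m * (?g ((1 / \<theta>) *\<^sub>R \<xi>) + \<delta>)"
      by (rule shape_approx[OF c n1(1) del(1)])
    have "real m * (?g ((1 / \<theta>) *\<^sub>R \<xi>) + \<delta>) \<le> real m * (?g \<xi> + \<epsilon> / 4 + \<delta>)" using n1(2) by (intro mult_left_mono) auto
    then have e: "epc lazy c m y \<le> real m * (?g \<xi> + \<epsilon> / 4 + \<delta>)" using my(5) by linarith
    have "l1_real (ratv m y - \<xi>) < r" using l1_real_triangle_diff[of "ratv m y" \<xi> "(1 / \<theta>) *\<^sub>R \<xi>"] my(4) s del(4) r by linarith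
    from near[OF this] have "?g \<xi> - \<epsilon> / 4 \<le> ?g (ratv m y)" by linarith
    then show ?thesis using my e by blast
  qed
  have e0: "0 \<le> ?g \<xi>" by (rule shape_nonneg[OF c xi])
  have upper: "AE W in P. \<forall>\<^sub>F k in sequentially. \<forall>x. admissible lazy k 0 x \<longrightarrow> l1_real (ratv k x - \<xi>) < \<delta> \<longrightarrow>
     pcost lazy c W k 0 x \<le> ennreal (real k * (?g \<xi> + \<epsilon>))"
  proof -
    have th: "\<bar>(1 - \<eta>) - 1\<bar> = \<eta>" using eta by simp
    obtain m y where my: "m \<ge> 1" "mom2 lazy c m y" "y \<noteq> 0" "l1_real (ratv m y - (1 / (1 - \<eta>)) *\<^sub>R \<xi>) < \<delta>"
      "epc lazy c m y \<le> real m * (?g \<xi> + \<epsilon> / 4 + \<delta>)" using ray[OF th] by blast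
    have xi': "\<xi> = (1 - \<eta>) *\<^sub>R ((1 / (1 - \<eta>)) *\<^sub>R \<xi>)" using eta by simp
    have "real m * \<delta> > 0" using my(1) del by simp
    from C(2)[of \<Lambda>] ray_upper[OF my(2,3) this] show ?thesis
    proof eventually_elim
      case (elim W)
      obtain l0 where l0: "\<And>l x y n. l \<ge> l0 \<Longrightarrow> l1_int x \<le> int (\<Lambda> * l) \<Longrightarrow> l1_int y \<le> int (\<Lambda> * l) \<Longrightarrow> dst x y + 20 * JJ \<le> l \<Longrightarrow> 12 * l \<le> n \<Longrightarrow>
        admissible lazy n x y \<Longrightarrow> pcost lazy c W n x y \<le> ennreal (C * real n)"
        using elim(1) unfolding eventually_sequentially by blast
      obtain i0 where i0: "\<And>i. i \<ge> i0 \<Longrightarrow> pcost lazy c W (i\<^sup>2 * m) 0 (int (i\<^sup>2) *s y) \<le> ennreal (real (i\<^sup>2) * (epc lazy c m y + real m * \<delta>))"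
        using elim(2) unfolding eventually_sequentially by blast
      from sandwich_geometry[OF my(1) eta(1,2) th l1xi xi' del(1,2) my(4), of i0 l0 "20 * JJ"] eventually_gt_at_top[of 0]
      show ?case
      proof eventually_elim
        case (elim k)
        then obtain i l where il: "i \<ge> i0" "l \<ge> l0" "\<bar>real (i\<^sup>2 * m) - (1 - \<eta>) * real k\<bar> \<le> \<delta> * real k"
          and geom: "\<And>x n. l1_real (ratv k x - \<xi>) < \<delta> \<Longrightarrow> real n = \<bar>real k - real (i\<^sup>2 * m)\<bar> \<Longrightarrow>
             12 * l \<le> n \<and> dst (int (i\<^sup>2) *s y) x + 20 * JJ \<le> l \<and> l1_int x \<le> int (\<Lambda> * l) \<and> l1_int (int (i\<^sup>2) *s y) \<le> int (\<Lambda> * l)"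
          unfolding \<Lambda>_def by blast
        have dk: "\<delta> * real k \<le> \<eta> * real k" using del eta by (intro mult_right_mono) auto
        have ik: "real (i\<^sup>2 * m) \<le> real k" using il(3) dk by (simp add: left_diff_distrib)
        define n where "n = k - i\<^sup>2 * m"
        have n: "real n = \<bar>real k - real (i\<^sup>2 * m)\<bar>" "i\<^sup>2 * m + n = k" using ik unfolding n_def by linarith+
        have n2: "real n \<le> 2 * \<eta> * real k" using n(1) il(3) dk ik by (simp add: left_diff_distrib)
        show ?case
        proof (intro allI impI)
          fix x assume adm: "admissible lazy k 0 x" and x: "l1_real (ratv k x - \<xi>) < \<delta>"
          note g = geom[OF x n(1)]
          let ?z = "int (i\<^sup>2) *s y"
          have b1: "pcost lazy c W (i\<^sup>2 * m) 0 ?z \<le> ennreal (real (i\<^sup>2) * (epc lazy c m y + real m * \<delta>))" by (rule i0[OF il(1)])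
          \<comment> \<open>Parity is inherited: the ray point is reached, so it is admissible for
            its time, and the difference to the admissible pair \<open>(k, x)\<close> is admissible
            as well.\<close>
          have "pcost lazy c W (i\<^sup>2 * m) 0 ?z < \<infinity>" by (rule le_less_trans[OF b1]) simp
          then have "admissible lazy (i\<^sup>2 * m) 0 ?z" by (rule pcost_finite_admissible)
          then have "admissible lazy n ?z x" using adm n(2)[symmetric] unfolding admissible_def by (auto simp: sum_subtractf)
          then have b2: "pcost lazy c W n ?z x \<le> ennreal (C * real n)" using g by (intro l0[OF il(2)]) auto
          have "pcost lazy c W (i\<^sup>2 * m + n) 0 x \<le> pcost lazy c W (i\<^sup>2 * m) 0 ?z + pcost lazy c W n ?z x" by (rule pcost_triangle)
          also have "\<dots> \<le> ennreal (real (i\<^sup>2) * (epc lazy c m y + real m * \<delta>)) + ennreal (C * real n)" by (intro add_mono b1 b2)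
          also have "\<dots> = ennreal (real (i\<^sup>2) * (epc lazy c m y + real m * \<delta>) + C * real n)"
            using epc_nonneg[of lazy c m y] del C(1) by (intro ennreal_plus[symmetric]) auto
          also have "\<dots> \<le> ennreal (real k * (?g \<xi> + \<epsilon>))"
          proof (rule ennreal_leI)
            have "real (i\<^sup>2) * (epc lazy c m y + real m * \<delta>) \<le> real (i\<^sup>2) * (real m * (?g \<xi> + \<epsilon> / 4 + \<delta>) + real m * \<delta>)"
              using my(5) by (intro mult_left_mono) auto
            also have "\<dots> = real (i\<^sup>2 * m) * (?g \<xi> + \<epsilon> / 4 + 2 * \<delta>)" by (simp add: algebra_simps)
            also have "\<dots> \<le> real k * (?g \<xi> + \<epsilon> / 4 + 2 * \<delta>)" using ik e0 eps del by (intro mult_right_mono) auto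
            also have "\<dots> \<le> real k * (?g \<xi> + \<epsilon> / 2)" using del(3) eps by (intro mult_left_mono) auto
            finally have 1: "real (i\<^sup>2) * (epc lazy c m y + real m * \<delta>) \<le> real k * (?g \<xi> + \<epsilon> / 2)" .
            have "C * real n \<le> C * (2 * \<eta> * real k)" using n2 C(1) by (intro mult_left_mono) auto
            also have "\<dots> = (2 * C * \<eta>) * real k" by simp
            also have "\<dots> \<le> (\<epsilon> / 4) * real k" using eC by (intro mult_right_mono) auto
            also have "\<dots> \<le> (\<epsilon> / 2) * real k" using eps by (intro mult_right_mono) auto
            finally show "real (i\<^sup>2) * (epc lazy c m y + real m * \<delta>) + C * real n \<le> real k * (?g \<xi> + \<epsilon>)"
              using 1 by (simp add: algebra_simps)
          qed
          finally show "pcost lazy c W k 0 x \<le> ennreal (real k * (?g \<xi> + \<epsilon>))" unfolding n(2) .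
        qed
      qed
    qed
  qed
  have lower: "AE W in P. \<forall>\<^sub>F k in sequentially. \<forall>x. admissible lazy k 0 x \<longrightarrow> l1_real (ratv k x - \<xi>) < \<delta> \<longrightarrow>
     ennreal (real k * (?g \<xi> - \<epsilon>)) \<le> pcost lazy c W k 0 x"
  proof (cases "?g \<xi> < \<epsilon>")
    case True
    \<comment> \<open>\<open>ennreal\<close> truncates a nonpositive lower bound to
      \<open>0\<close>, so it holds trivially.\<close>
    have "ennreal (real k * (?g \<xi> - \<epsilon>)) = 0" for k
      using True by (intro ennreal_neg) (simp add: mult_nonneg_nonpos)
    then show ?thesis by simp
  next
    case False
    have th: "\<bar>(1 + \<eta>) - 1\<bar> = \<eta>" using eta by simp
    obtain m y where my: "m \<ge> 1" "mom2 lazy c m y" "y \<noteq> 0" "l1_real (ratv m y - (1 / (1 + \<eta>)) *\<^sub>R \<xi>) < \<delta>"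
      "?g \<xi> - \<epsilon> / 4 \<le> ?g (ratv m y)" using ray[OF th] by blast
    have xi': "\<xi> = (1 + \<eta>) *\<^sub>R ((1 / (1 + \<eta>)) *\<^sub>R \<xi>)" using eta by simp
    have md: "real m * \<delta> > 0" using my(1) del by simp
    \<comment> \<open>Repeated blocks have the same normalised endpoint, so
      \<open>shape_lower\<close> supplies the linear bound that \<open>ray_lower\<close>
      requires.\<close>
    have gam: "real L * (real m * ?g (ratv m y)) \<le> epc lazy c (L * m) (int L *s y)" if L: "L \<ge> 1" for L
    proof -
      have "ratv (L * m) (int L *s y) = ratv m y" using L my(1) by (simp add: ratv_def vec_eq_iff)
      then show ?thesis using shape_lower[of "L * m" lazy c "int L *s y"] mom2_mult[OF my(2) L] L my(1) by (simp add: mult.assoc)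
    qed
    have "AE W in P. \<forall>\<^sub>F j in sequentially. ennreal (real j * (real m * ?g (ratv m y) - real m * \<delta>)) \<le> pcost lazy c W (j * m) 0 (int j *s y)"
      by (rule ray_lower[OF my(2,3) md]) (rule gam)
    with C(2)[of \<Lambda>] show ?thesis
    proof eventually_elim
      case (elim W)
      obtain l0 where l0: "\<And>l x y n. l \<ge> l0 \<Longrightarrow> l1_int x \<le> int (\<Lambda> * l) \<Longrightarrow> l1_int y \<le> int (\<Lambda> * l) \<Longrightarrow> dst x y + 20 * JJ \<le> l \<Longrightarrow> 12 * l \<le> n \<Longrightarrow>
        admissible lazy n x y \<Longrightarrow> pcost lazy c W n x y \<le> ennreal (C * real n)"
        using elim(1) unfolding eventually_sequentially by blast
      obtain j0 where j0: "\<And>j. j \<ge> j0 \<Longrightarrow> ennreal (real j * (real m * ?g (ratv m y) - real m * \<delta>)) \<le> pcost lazy c W (j * m) 0 (int j *s y)"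
        using elim(2) unfolding eventually_sequentially by blast
      from sandwich_geometry[OF my(1) eta(1,2) th l1xi xi' del(1,2) my(4), of "max j0 1" l0 "20 * JJ"] eventually_gt_at_top[of 0]
      show ?case
      proof eventually_elim
        case (elim k)
        then obtain i l where il: "i \<ge> max j0 1" "l \<ge> l0" "\<bar>real (i\<^sup>2 * m) - (1 + \<eta>) * real k\<bar> \<le> \<delta> * real k"
          and geom: "\<And>x n. l1_real (ratv k x - \<xi>) < \<delta> \<Longrightarrow> real n = \<bar>real k - real (i\<^sup>2 * m)\<bar> \<Longrightarrow>
             12 * l \<le> n \<and> dst (int (i\<^sup>2) *s y) x + 20 * JJ \<le> l \<and> l1_int x \<le> int (\<Lambda> * l) \<and> l1_int (int (i\<^sup>2) *s y) \<le> int (\<Lambda> * l)"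
          unfolding \<Lambda>_def by blast
        have dk: "\<delta> * real k \<le> \<eta> * real k" using del eta by (intro mult_right_mono) auto
        have ik: "real k \<le> real (i\<^sup>2 * m)" using il(3) dk by (simp add: distrib_right)
        define n where "n = i\<^sup>2 * m - k"
        have n: "real n = \<bar>real k - real (i\<^sup>2 * m)\<bar>" "k + n = i\<^sup>2 * m" using ik unfolding n_def by linarith+
        have n2: "real n \<le> 2 * \<eta> * real k" using n(1) il(3) dk ik by (simp add: distrib_right)
        have i2: "j0 \<le> i\<^sup>2"
        proof -
          have "i \<le> i * i" by (cases i) auto
          then show ?thesis using il(1) unfolding power2_eq_square by linarith
        qed
        show ?case
        proof (intro allI impI)
          fix x assume adm: "admissible lazy k 0 x" and x: "l1_real (ratv k x - \<xi>) < \<delta>"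
          note g = geom[OF x n(1)]
          let ?z = "int (i\<^sup>2) *s y"
          have b1: "ennreal (real (i\<^sup>2) * (real m * ?g (ratv m y) - real m * \<delta>)) \<le> pcost lazy c W (i\<^sup>2 * m) 0 ?z" by (rule j0[OF i2])
          have "pcost lazy c W (i\<^sup>2 * m) 0 ?z < \<infinity>"
            using mom2_finite[OF mom2_mult[OF my(2)], of "i\<^sup>2" W 0] il(1) by simp
          then have "admissible lazy (i\<^sup>2 * m) 0 ?z" by (rule pcost_finite_admissible)
          then have "admissible lazy n x ?z" using adm n(2)[symmetric] unfolding admissible_def by (auto simp: sum_subtractf)
          moreover have "dst x ?z = dst ?z x" by (simp add: dst_def l1_int_diff_commute)
          ultimately have b2: "pcost lazy c W n x ?z \<le> ennreal (C * real n)" using g by (intro l0[OF il(2)]) auto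
          have kb: "real k * (?g \<xi> - \<epsilon>) + C * real n \<le> real (i\<^sup>2) * (real m * ?g (ratv m y) - real m * \<delta>)"
          proof -
            have "C * real n \<le> C * (2 * \<eta> * real k)" using n2 C(1) by (intro mult_left_mono) auto
            also have "\<dots> = (2 * C * \<eta>) * real k" by simp
            also have "\<dots> \<le> (\<epsilon> / 4) * real k" using eC by (intro mult_right_mono) auto
            finally have "real k * (?g \<xi> - \<epsilon>) + C * real n \<le> real k * (?g \<xi> - 3 * \<epsilon> / 4)" by (simp add: algebra_simps)
            also have "\<dots> \<le> real (i\<^sup>2 * m) * (?g \<xi> - 3 * \<epsilon> / 4)" using ik False eps by (intro mult_right_mono) auto
            also have "\<dots> \<le> real (i\<^sup>2 * m) * (?g (ratv m y) - \<delta>)" using my(5) del(3) eps by (intro mult_left_mono) auto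
            also have "\<dots> = real (i\<^sup>2) * (real m * ?g (ratv m y) - real m * \<delta>)" by (simp add: algebra_simps)
            finally show ?thesis .
          qed
          have "ennreal (real k * (?g \<xi> - \<epsilon>)) + ennreal (C * real n) = ennreal (real k * (?g \<xi> - \<epsilon>) + C * real n)"
            using False C(1) by (intro ennreal_plus[symmetric]) auto
          also have "\<dots> \<le> ennreal (real (i\<^sup>2) * (real m * ?g (ratv m y) - real m * \<delta>))" by (rule ennreal_leI[OF kb])
          also have "\<dots> \<le> pcost lazy c W (k + n) 0 ?z" using b1 n(2) by simp
          also have "\<dots> \<le> pcost lazy c W k 0 x + pcost lazy c W n x ?z" by (rule pcost_triangle)
          also have "\<dots> \<le> pcost lazy c W k 0 x + ennreal (C * real n)" by (intro add_left_mono b2)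
          finally have "ennreal (C * real n) + ennreal (real k * (?g \<xi> - \<epsilon>)) \<le> ennreal (C * real n) + pcost lazy c W k 0 x"
            by (metis add.commute)
          then show "ennreal (real k * (?g \<xi> - \<epsilon>)) \<le> pcost lazy c W k 0 x"
            by (simp add: ennreal_add_left_cancel_le)
        qed
      qed
    qed
  qed
  show ?thesis
  proof (intro exI[of _ \<delta>] conjI del(1))
    from lower upper show "AE W in P. \<forall>\<^sub>F k in sequentially. \<forall>x. admissible lazy k 0 x \<longrightarrow> l1_real (ratv k x - \<xi>) < \<delta> \<longrightarrow>
     ennreal (real k * (?g \<xi> - \<epsilon>)) \<le> pcost lazy c W k 0 x \<and> pcost lazy c W k 0 x \<le> ennreal (real k * (?g \<xi> + \<epsilon>))"
    proof eventually_elim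
      case (elim W)
      from elim show ?case by eventually_elim auto
    qed
  qed
qed

text \<open>The points with \<open>(1 + \<alpha>) * l1_real \<xi> \<le> 1\<close> form a compact
  subset of the open ball. It is covered by finitely many neighbourhoods on which the local limit
  holds and the shape function varies by at most \<open>\<epsilon> / 2\<close>, so one random time
  serves all endpoints.\<close>

lemma shape_limit:
  assumes c: "c \<ge> 0" and al: "\<alpha> > 0" and eps: "\<epsilon> > 0"
  shows "AE W in P. \<forall>\<^sub>F k in sequentially. \<forall>x. admissible lazy k 0 x \<longrightarrow> (1 + \<alpha>) * real_of_int (l1_int x) \<le> real k \<longrightarrow>
     \<bar>enn2real (pcost lazy c W k 0 x) - real k * shape lazy c (ratv k x)\<bar> \<le> \<epsilon> * real k"
proof -
  let ?g = "shape lazy c"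
  define S where "S = {\<xi> :: real^'d. l1_real \<xi> \<le> 1 / (1 + \<alpha>)}"
  have "1 / (1 + \<alpha>) < 1" using al by simp
  then have SU: "S \<subseteq> intU" by (auto simp: S_def intU_def)
  have "compact S"
  proof (rule compact_eq_bounded_closed[THEN iffD2], intro conjI)
    have "norm \<xi> \<le> 1 / (1 + \<alpha>)" if "\<xi> \<in> S" for \<xi>
      using norm_le_l1_cart[of \<xi>] that by (simp add: S_def l1_real_def)
    then show "bounded S" unfolding bounded_iff by blast
    show "closed S" unfolding S_def by (intro closed_Collect_le continuous_on_l1_real continuous_on_const)
  qed
  define A where "A \<xi> \<delta> \<longleftrightarrow> \<delta> > 0 \<and> (\<forall>z. l1_real (z - \<xi>) < \<delta> \<longrightarrow> \<bar>?g z - ?g \<xi>\<bar> \<le> \<epsilon> / 2) \<and>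
    (AE W in P. \<forall>\<^sub>F k in sequentially. \<forall>x. admissible lazy k 0 x \<longrightarrow> l1_real (ratv k x - \<xi>) < \<delta> \<longrightarrow>
     ennreal (real k * (?g \<xi> - \<epsilon> / 2)) \<le> pcost lazy c W k 0 x \<and> pcost lazy c W k 0 x \<le> ennreal (real k * (?g \<xi> + \<epsilon> / 2)))"
    for \<xi> :: "real^'d" and \<delta> :: real
  have "\<exists>\<delta>. A \<xi> \<delta>"
    if xi: "\<xi> \<in> S" for \<xi>
  proof -
    have xU: "\<xi> \<in> intU" using xi SU by blast
    have "isCont ?g \<xi>" using continuous_on_eq_continuous_at[OF open_intU, of ?g] continuous_shape[OF c, of lazy] xU by blast
    then obtain r where r: "r > 0" "\<And>z. dist z \<xi> < r \<Longrightarrow> dist (?g z) (?g \<xi>) < \<epsilon> / 2"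
      unfolding continuous_at_eps_delta using eps by (metis half_gt_zero)
    have r': "\<bar>?g z - ?g \<xi>\<bar> \<le> \<epsilon> / 2" if "l1_real (z - \<xi>) < r" for z
    proof -
      have "norm (z - \<xi>) \<le> l1_real (z - \<xi>)" unfolding l1_real_def by (rule norm_le_l1_cart)
      then have "dist z \<xi> < r" using that by (simp add: dist_norm)
      then show ?thesis using r(2)[of z] by (simp add: dist_real_def)
    qed
    have "\<epsilon> / 2 > 0" using eps by simp
    from local_shape_limit[OF c xU this, of lazy] obtain \<delta> where d: "\<delta> > 0"
      "AE W in P. \<forall>\<^sub>F k in sequentially. \<forall>x. admissible lazy k 0 x \<longrightarrow> l1_real (ratv k x - \<xi>) < \<delta> \<longrightarrow>
       ennreal (real k * (?g \<xi> - \<epsilon> / 2)) \<le> pcost lazy c W k 0 x \<and> pcost lazy c W k 0 x \<le> ennreal (real k * (?g \<xi> + \<epsilon> / 2))"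
      by blast
    show ?thesis
      unfolding A_def
    proof (intro exI[of _ "min r \<delta>"] conjI)
      show "0 < min r \<delta>" using r d by simp
      show "\<forall>z. l1_real (z - \<xi>) < min r \<delta> \<longrightarrow> \<bar>?g z - ?g \<xi>\<bar> \<le> \<epsilon> / 2" using r' by simp
      from d(2) show "AE W in P. \<forall>\<^sub>F k in sequentially. \<forall>x. admissible lazy k 0 x \<longrightarrow> l1_real (ratv k x - \<xi>) < min r \<delta> \<longrightarrow>
       ennreal (real k * (?g \<xi> - \<epsilon> / 2)) \<le> pcost lazy c W k 0 x \<and> pcost lazy c W k 0 x \<le> ennreal (real k * (?g \<xi> + \<epsilon> / 2))"
        by eventually_elim (auto elim!: eventually_mono)
    qed
  qed
  then obtain d where dA: "\<And>\<xi>. \<xi> \<in> S \<Longrightarrow> A \<xi> (d \<xi>)" using bchoice[of S A] by blast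
  note d = dA[unfolded A_def, THEN conjunct1] dA[unfolded A_def, THEN conjunct2, THEN conjunct1, rule_format]
    dA[unfolded A_def, THEN conjunct2, THEN conjunct2]
  define U where "U \<xi> = {z. l1_real (z - \<xi>) < d \<xi>}" for \<xi>
  have "open (U \<xi>)" for \<xi>
  proof -
    have "continuous_on UNIV (\<lambda>z. l1_real (z - \<xi>))" unfolding l1_real_def by (intro continuous_intros)
    then show ?thesis unfolding U_def by (intro open_Collect_less continuous_on_const)
  qed
  moreover have "S \<subseteq> (\<Union>\<xi>\<in>S. U \<xi>)"
  proof
    fix \<xi> assume "\<xi> \<in> S"
    then show "\<xi> \<in> (\<Union>\<xi>\<in>S. U \<xi>)" using d(1)[of \<xi>] by (intro UN_I[of \<xi>]) (auto simp: U_def l1_real_def)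
  qed
  ultimately obtain F where F: "F \<subseteq> S" "finite F" "S \<subseteq> (\<Union>\<xi>\<in>F. U \<xi>)"
    using compactE_image[OF \<open>compact S\<close>, of S U] by metis
  have "AE W in P. \<forall>\<xi>\<in>F. \<forall>\<^sub>F k in sequentially. \<forall>x. admissible lazy k 0 x \<longrightarrow> l1_real (ratv k x - \<xi>) < d \<xi> \<longrightarrow>
     ennreal (real k * (?g \<xi> - \<epsilon> / 2)) \<le> pcost lazy c W k 0 x \<and> pcost lazy c W k 0 x \<le> ennreal (real k * (?g \<xi> + \<epsilon> / 2))"
    using d(3) F(1) by (intro AE_finite_allI F(2)) auto
  then show ?thesis
  proof eventually_elim
    case (elim W)
    then have "\<forall>\<^sub>F k in sequentially. \<forall>\<xi>\<in>F. \<forall>x. admissible lazy k 0 x \<longrightarrow> l1_real (ratv k x - \<xi>) < d \<xi> \<longrightarrow>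
     ennreal (real k * (?g \<xi> - \<epsilon> / 2)) \<le> pcost lazy c W k 0 x \<and> pcost lazy c W k 0 x \<le> ennreal (real k * (?g \<xi> + \<epsilon> / 2))"
      by (intro eventually_ball_finite F(2))
    with eventually_ge_at_top[of 1] show ?case
    proof eventually_elim
      case (elim k)
      show ?case
      proof (intro allI impI)
        fix x :: "int^'d"
        assume adm: "admissible lazy k 0 x" and x: "(1 + \<alpha>) * real_of_int (l1_int x) \<le> real k"
        have k: "real k > 0" using elim(1) by simp
        have E1: "real k * l1_real (ratv k x) = real_of_int (l1_int x)"
          using l1_real_of_int[of x] ratv_scale[OF elim(1), of x] l1_real_scale[of "real k" "ratv k x"] by simp
        have "real k * ((1 + \<alpha>) * l1_real (ratv k x)) \<le> real k * 1"
          unfolding mult.left_commute[of "real k" "1 + \<alpha>"] E1 using x by simp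
        then have "(1 + \<alpha>) * l1_real (ratv k x) \<le> 1" by (rule mult_left_le_imp_le) (rule k)
        then have xS: "ratv k x \<in> S" using al by (simp add: S_def field_simps)
        then obtain \<xi> where xi: "\<xi> \<in> F" "l1_real (ratv k x - \<xi>) < d \<xi>" using F(3) by (auto simp: U_def)
        have b: "ennreal (real k * (?g \<xi> - \<epsilon> / 2)) \<le> pcost lazy c W k 0 x" "pcost lazy c W k 0 x \<le> ennreal (real k * (?g \<xi> + \<epsilon> / 2))"
          using elim(2) adm xi by blast+
        have gx: "\<bar>?g (ratv k x) - ?g \<xi>\<bar> \<le> \<epsilon> / 2" using d(2)[of \<xi> "ratv k x"] xi F(1) by blast
        have "0 \<le> ?g \<xi>" using shape_nonneg[OF c, of \<xi>] xi F(1) SU by blast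
        then have pos: "0 \<le> real k * (?g \<xi> + \<epsilon> / 2)" using eps by simp
        have fin: "pcost lazy c W k 0 x < top" by (rule le_less_trans[OF b(2) ennreal_less_top])
        have u: "enn2real (pcost lazy c W k 0 x) \<le> real k * (?g \<xi> + \<epsilon> / 2)" by (rule enn2real_leI[OF pos b(2)])
        have l: "real k * (?g \<xi> - \<epsilon> / 2) \<le> enn2real (pcost lazy c W k 0 x)"
        proof -
          have "ennreal (real k * (?g \<xi> - \<epsilon> / 2)) \<le> ennreal (enn2real (pcost lazy c W k 0 x))"
            using b(1) fin by (simp add: ennreal_enn2real)
          then show ?thesis by (simp add: ennreal_le_iff)
        qed
        have "real k * \<bar>?g (ratv k x) - ?g \<xi>\<bar> \<le> real k * (\<epsilon> / 2)" using gx by (intro mult_left_mono) auto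
        moreover have "real k * \<bar>?g (ratv k x) - ?g \<xi>\<bar> = \<bar>real k * ?g (ratv k x) - real k * ?g \<xi>\<bar>"
          by (simp add: abs_mult flip: right_diff_distrib)
        ultimately have "\<bar>real k * ?g (ratv k x) - real k * ?g \<xi>\<bar> \<le> \<epsilon> * real k / 2" by (simp add: mult.commute)
        moreover have "enn2real (pcost lazy c W k 0 x) \<le> real k * ?g \<xi> + \<epsilon> * real k / 2"
          "real k * ?g \<xi> - \<epsilon> * real k / 2 \<le> enn2real (pcost lazy c W k 0 x)"
          using u l by (simp_all add: algebra_simps)
        ultimately show "\<bar>enn2real (pcost lazy c W k 0 x) - real k * ?g (ratv k x)\<bar> \<le> \<epsilon> * real k"
          by linarith
      qed
    qed
  qed
qed

end

section \<open>The shape theorem\<close>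

text \<open>With the number of steps fixed, both costs rank the paths in the same way, so the
  optimal path of \<open>pcost\<close> attains the infimum in \<open>Gpp\<close>. A zero step has
  weight \<open>0\<close>, hence shifted cost \<open>- \<rho>\<close>, which explains the parameter
  of \<open>pcost\<close>.\<close>

lemma Gpp_eq_pcost:
  fixes w :: "(int^'d) set \<Rightarrow> real"
  assumes W: "\<And>e. e \<in> lattice_edges \<Longrightarrow> \<bar>W e\<bar> = w e - \<rho>" and rho: "\<rho> \<le> 0" and x: "x \<in> reach lazy k"
  shows "pcost lazy (- \<rho>) W k 0 x < \<infinity>"
    and "Gpp lazy w k x = enn2real (pcost lazy (- \<rho>) W k 0 x) + real k * \<rho>"
proof -
  define R where "R p = (\<Sum>i<k. if p i = p (Suc i) then - \<rho> else \<bar>W {p i, p (Suc i)}\<bar>)" for p :: "nat \<Rightarrow> int^'d"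
  have R0: "0 \<le> R p" for p unfolding R_def using rho by (intro sum_nonneg) auto
  have ec: "(\<Sum>i<k. ecost (- \<rho>) W (p i) (p (Suc i))) = ennreal (R p)" for p
  proof -
    have "(\<Sum>i<k. ecost (- \<rho>) W (p i) (p (Suc i))) = (\<Sum>i<k. ennreal (if p i = p (Suc i) then - \<rho> else \<bar>W {p i, p (Suc i)}\<bar>))"
      by (intro sum.cong refl) (auto simp: ecost_def)
    also have "\<dots> = ennreal (R p)" unfolding R_def using rho by (intro sum_ennreal) auto
    finally show ?thesis .
  qed
  have pw: "path_weight w k p = R p + real k * \<rho>" if p: "adm_path lazy k p" for p
  proof -
    have "path_weight w k p = (\<Sum>i<k. (if p i = p (Suc i) then - \<rho> else \<bar>W {p i, p (Suc i)}\<bar>) + \<rho>)"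
      unfolding path_weight_def
    proof (intro sum.cong refl)
      fix i assume i: "i \<in> {..<k}"
      show "step_weight w (p i) (p (Suc i)) = (if p i = p (Suc i) then - \<rho> else \<bar>W {p i, p (Suc i)}\<bar>) + \<rho>"
      proof (cases "p i = p (Suc i)")
        case False
        have "p (Suc i) - p i \<in> steps lazy" using p i by (simp add: adm_path_def)
        from step_edge[OF this, of "p i"] False have "{p i, p (Suc i)} \<in> lattice_edges" by auto
        then show ?thesis using False W by (simp add: step_weight_def)
      qed (simp add: step_weight_def)
    qed
    then show ?thesis by (simp add: R_def sum.distrib)
  qed
  obtain p where p: "adm_path lazy k p" "p 0 = 0" "p k = x" using x by (auto simp: reach_def)
  have "pcost lazy (- \<rho>) W k 0 x \<le> ennreal (R p)" using pcost_le_path[OF p(1), of "- \<rho>" W] p(2,3) ec[of p] by simp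
  then show fin: "pcost lazy (- \<rho>) W k 0 x < \<infinity>" by (rule le_less_trans) simp
  obtain q where q: "adm_path lazy k q" "q 0 = 0" "q k = x" "pcost lazy (- \<rho>) W k 0 x = (\<Sum>i<k. ecost (- \<rho>) W (q i) (q (Suc i)))"
    by (rule pcost_path_attained[OF fin])
  have q': "pcost lazy (- \<rho>) W k 0 x = ennreal (R q)" using q(4) ec[of q] by simp
  have "Gpp lazy w k x = path_weight w k q"
    unfolding Gpp_def
  proof (rule cInf_eq_minimum)
    show "path_weight w k q \<in> {path_weight w k p |p. adm_path lazy k p \<and> p 0 = 0 \<and> p k = x}" using q by blast
    fix v assume "v \<in> {path_weight w k p |p. adm_path lazy k p \<and> p 0 = 0 \<and> p k = x}"
    then obtain p where p: "v = path_weight w k p" "adm_path lazy k p" "p 0 = 0" "p k = x" by blast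
    have "ennreal (R q) \<le> ennreal (R p)" using pcost_le_path[OF p(2), of "- \<rho>" W] p(3,4) ec[of p] q' by simp
    then have "R q \<le> R p" using R0 by (simp add: ennreal_le_iff)
    then show "path_weight w k q \<le> v" using p pw[OF p(2)] pw[OF q(1)] by simp
  qed
  then show "Gpp lazy w k x = enn2real (pcost lazy (- \<rho>) W k 0 x) + real k * \<rho>"
    using pw[OF q(1)] q' R0[of q] by simp
qed

lemma AE_ess_inf_le:
  assumes "sets \<mu> = sets borel"
  shows "AE y in \<mu>. ess_inf \<mu> \<le> ereal y"
proof -
  have "AE y in \<mu>. - ereal y \<le> esssup \<mu> (\<lambda>y. - ereal y)" by (rule esssup_AE)
  then show ?thesis unfolding ess_inf_def by eventually_elim (simp add: ereal_uminus_le_reorder)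
qed

theorem theoremB1:
  fixes M :: "'a measure"
    and t :: "(int ^ 'd) set \<Rightarrow> 'a \<Rightarrow> real"
    and \<mu> :: "real measure"
    and lazy :: bool
  assumes d2: "CARD('d) \<ge> 2"
    and P: "prob_space M"
    and rv: "\<And>e. e \<in> lattice_edges \<Longrightarrow> t e \<in> borel_measurable M"
    and indep: "prob_space.indep_vars M (\<lambda>_. borel) t lattice_edges"
    and ident: "\<And>e. e \<in> lattice_edges \<Longrightarrow> distr M borel (t e) = \<mu>"
    and r0_fin: "ess_inf \<mu> > -\<infinity>"
    and moment: "(\<integral>\<^sup>+ y. ennreal ((Min ((\<lambda>i. max (y i) 0) ` {..<2 * CARD('d)})) ^ CARD('d))
                   \<partial>(PiM {..<2 * CARD('d)} (\<lambda>_. \<mu>))) < \<infinity>"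
  shows "\<exists>g :: real ^ 'd \<Rightarrow> real.
           continuous_on intU g \<and> convex_on intU g \<and>
           (\<forall>\<xi>\<in>intU. min (ess_inf \<mu>) 0 \<le> ereal (g \<xi>)) \<and>
           (\<forall>\<alpha>>0. \<forall>\<epsilon>>0. \<exists>K :: 'a \<Rightarrow> nat. K \<in> measurable M (count_space UNIV) \<and>
              (AE \<omega> in M. \<forall>k x. k \<ge> K \<omega> \<and> real k \<ge> (1 + \<alpha>) * real_of_int (l1_int x)
                    \<and> x \<in> reach lazy k \<longrightarrow>
                 \<bar>Gpp lazy (\<lambda>e. t e \<omega>) k x - real k * g (\<chi> i. real_of_int (x $ i) / real k)\<bar>
                   \<le> \<epsilon> * real k))"
proof -
  interpret M: prob_space M by (rule P)
  have ne: "lattice_edges \<noteq> ({} :: (int^'d) set set)"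
    using step_edge[of "axis undefined 1" False 0] by (auto simp: steps_def)
  then obtain e0 :: "(int^'d) set" where e0: "e0 \<in> lattice_edges" by blast
  have mu: "prob_space \<mu>" unfolding ident[OF e0, symmetric] by (rule M.prob_space_distr[OF rv[OF e0]])
  have smu: "sets \<mu> = sets borel" unfolding ident[OF e0, symmetric] by simp
  define \<rho> where "\<rho> = real_of_ereal (min (ess_inf \<mu>) 0)"
  have "\<bar>min (ess_inf \<mu>) 0\<bar> \<noteq> \<infinity>" using r0_fin by (cases "ess_inf \<mu>") (auto simp: min_def)
  then have rho: "ereal \<rho> = min (ess_inf \<mu>) 0" by (simp add: \<rho>_def ereal_real')
  have "ereal \<rho> \<le> 0" unfolding rho by simp
  then have rho0: "\<rho> \<le> 0" by simp
  define c where "c = - \<rho>"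
  have c: "c \<ge> 0" using rho0 by (simp add: c_def)
  \<comment> \<open>The truncation at \<open>0\<close> acts only on weights below
    \<open>\<rho>\<close>, a null event, and makes the shifted weights nonnegative
    everywhere.\<close>
  define \<psi> where "\<psi> y = max (y - \<rho>) 0" for y :: real
  have psim[measurable]: "\<psi> \<in> borel_measurable borel" unfolding \<psi>_def[abs_def] by measurable
  have psim': "\<psi> \<in> borel_measurable \<mu>" using psim by (simp add: measurable_cong_sets[OF smu refl])
  define \<nu> where "\<nu> = distr \<mu> borel \<psi>"
  have nu: "prob_space \<nu>" unfolding \<nu>_def by (rule prob_space.prob_space_distr[OF mu psim'])
  have snu: "sets \<nu> = sets borel" by (simp add: \<nu>_def)
  let ?I = "{..<2 * CARD('d)}"
  have Ine: "?I \<noteq> {}" by (simp add: lessThan_empty_iff)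
  \<comment> \<open>The shift raises the minimum of the positive parts by at most
    \<open>c = - \<rho>\<close>, and \<open>(a + c)^d \<le> 2^d (a^d + c^d)\<close>; so the moment
    hypothesis carries over.\<close>
  have momnu: "(\<integral>\<^sup>+ y. ennreal ((Min ((\<lambda>i. \<bar>y i\<bar>) ` ?I)) ^ CARD('d)) \<partial>(PiM ?I (\<lambda>_. \<nu>))) < \<infinity>"
  proof -
    have "distr \<mu> \<nu> \<psi> = \<nu>" unfolding \<nu>_def by (intro distr_cong) simp_all
    then have "PiM ?I (\<lambda>_. \<nu>) = distr (PiM ?I (\<lambda>_. \<mu>)) (PiM ?I (\<lambda>_. \<nu>)) (compose ?I \<psi>)"
      using distr_PiM_finite_prob_space'[of ?I "\<lambda>_. \<mu>" "\<lambda>_. \<nu>" \<psi>] mu nu psim'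
      by (simp add: measurable_cong_sets[OF refl snu])
    then have "(\<integral>\<^sup>+ y. ennreal ((Min ((\<lambda>i. \<bar>y i\<bar>) ` ?I)) ^ CARD('d)) \<partial>(PiM ?I (\<lambda>_. \<nu>)))
      = (\<integral>\<^sup>+ y. ennreal ((Min ((\<lambda>i. \<bar>y i\<bar>) ` ?I)) ^ CARD('d)) \<partial>(distr (PiM ?I (\<lambda>_. \<mu>)) (PiM ?I (\<lambda>_. \<nu>)) (compose ?I \<psi>)))"
      by simp
    also have "\<dots> = (\<integral>\<^sup>+ y. ennreal ((Min ((\<lambda>i. \<bar>compose ?I \<psi> y i\<bar>) ` ?I)) ^ CARD('d)) \<partial>(PiM ?I (\<lambda>_. \<mu>)))"
    proof (rule nn_integral_distr)
      show "compose ?I \<psi> \<in> measurable (PiM ?I (\<lambda>_. \<mu>)) (PiM ?I (\<lambda>_. \<nu>))"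
        unfolding compose_def
      proof (rule measurable_restrict)
        fix i assume "i \<in> ?I"
        then have "(\<lambda>y. y i) \<in> measurable (PiM ?I (\<lambda>_. \<mu>)) \<mu>" by (rule measurable_component_singleton)
        from measurable_compose[OF this psim'] show "(\<lambda>y. \<psi> (y i)) \<in> measurable (PiM ?I (\<lambda>_. \<mu>)) \<nu>"
          by (simp add: measurable_cong_sets[OF refl snu])
      qed
      have "(\<lambda>y. Min ((\<lambda>i. \<bar>y i\<bar>) ` ?I)) \<in> borel_measurable (PiM ?I (\<lambda>_. \<nu>))"
      proof (rule borel_measurable_Min)
        fix i assume "i \<in> ?I"
        then have "(\<lambda>y. y i) \<in> measurable (PiM ?I (\<lambda>_. \<nu>)) \<nu>" by (rule measurable_component_singleton)
        then have "(\<lambda>y. y i) \<in> borel_measurable (PiM ?I (\<lambda>_. \<nu>))" by (simp add: measurable_cong_sets[OF refl snu])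
        then show "(\<lambda>y. \<bar>y i\<bar>) \<in> borel_measurable (PiM ?I (\<lambda>_. \<nu>))" by measurable
      qed simp
      then show "(\<lambda>y. ennreal ((Min ((\<lambda>i. \<bar>y i\<bar>) ` ?I)) ^ CARD('d))) \<in> borel_measurable (distr (PiM ?I (\<lambda>_. \<mu>)) (PiM ?I (\<lambda>_. \<nu>)) (compose ?I \<psi>))"
        unfolding measurable_distr_eq1 by measurable
    qed
    also have "\<dots> \<le> (\<integral>\<^sup>+ y. ennreal (2 ^ CARD('d)) * (ennreal ((Min ((\<lambda>i. max (y i) 0) ` ?I)) ^ CARD('d)) + ennreal (c ^ CARD('d))) \<partial>(PiM ?I (\<lambda>_. \<mu>)))"
    proof (intro nn_integral_mono)
      fix y :: "nat \<Rightarrow> real"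
      let ?m = "Min ((\<lambda>i. max (y i) 0) ` ?I)"
      have m0: "0 \<le> ?m" using Ine by (intro Min.boundedI) auto
      have "?m \<in> (\<lambda>i. max (y i) 0) ` ?I" using Ine by (intro Min_in) auto
      then obtain i where i: "i \<in> ?I" "?m = max (y i) 0" by blast
      have "Min ((\<lambda>i. \<bar>compose ?I \<psi> y i\<bar>) ` ?I) \<le> \<bar>compose ?I \<psi> y i\<bar>" using i by (intro Min_le) auto
      also have "\<dots> \<le> ?m + c" using i(1) c unfolding i(2) by (auto simp: compose_def \<psi>_def c_def max_def)
      also have "\<dots> \<le> 2 * max ?m c" by (simp add: max_def)
      finally have 1: "Min ((\<lambda>i. \<bar>compose ?I \<psi> y i\<bar>) ` ?I) \<le> 2 * max ?m c" .
      have 0: "0 \<le> Min ((\<lambda>i. \<bar>compose ?I \<psi> y i\<bar>) ` ?I)" using Ine by (intro Min.boundedI) auto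
      have "Min ((\<lambda>i. \<bar>compose ?I \<psi> y i\<bar>) ` ?I) ^ CARD('d) \<le> (2 * max ?m c) ^ CARD('d)" by (intro power_mono 1 0)
      also have "\<dots> = 2 ^ CARD('d) * (max ?m c) ^ CARD('d)" by (rule power_mult_distrib)
      also have "\<dots> \<le> 2 ^ CARD('d) * (?m ^ CARD('d) + c ^ CARD('d))"
        using m0 c by (intro mult_left_mono) (auto simp: max_def)
      finally have "ennreal (Min ((\<lambda>i. \<bar>compose ?I \<psi> y i\<bar>) ` ?I) ^ CARD('d)) \<le> ennreal (2 ^ CARD('d) * (?m ^ CARD('d) + c ^ CARD('d)))"
        by (rule ennreal_leI)
      also have "\<dots> = ennreal (2 ^ CARD('d)) * (ennreal (?m ^ CARD('d)) + ennreal (c ^ CARD('d)))"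
        using m0 c by (subst ennreal_mult') auto
      finally show "ennreal (Min ((\<lambda>i. \<bar>compose ?I \<psi> y i\<bar>) ` ?I) ^ CARD('d)) \<le> ennreal (2 ^ CARD('d)) * (ennreal (?m ^ CARD('d)) + ennreal (c ^ CARD('d)))" .
    qed
    also have "\<dots> = ennreal (2 ^ CARD('d)) * ((\<integral>\<^sup>+ y. ennreal ((Min ((\<lambda>i. max (y i) 0) ` ?I)) ^ CARD('d)) \<partial>(PiM ?I (\<lambda>_. \<mu>))) + ennreal (c ^ CARD('d)))"
    proof -
      have "(\<lambda>y. Min ((\<lambda>i. max (y i) 0) ` ?I)) \<in> borel_measurable (PiM ?I (\<lambda>_. \<mu>))"
      proof (rule borel_measurable_Min)
        fix i assume "i \<in> ?I"
        then have "(\<lambda>y. y i) \<in> measurable (PiM ?I (\<lambda>_. \<mu>)) \<mu>" by (rule measurable_component_singleton)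
        then have "(\<lambda>y. y i) \<in> borel_measurable (PiM ?I (\<lambda>_. \<mu>))" by (simp add: measurable_cong_sets[OF refl smu])
        then show "(\<lambda>y. max (y i) 0) \<in> borel_measurable (PiM ?I (\<lambda>_. \<mu>))" by measurable
      qed simp
      then have m: "(\<lambda>y. ennreal ((Min ((\<lambda>i. max (y i) 0) ` ?I)) ^ CARD('d))) \<in> borel_measurable (PiM ?I (\<lambda>_. \<mu>))" by measurable
      have "prob_space (PiM ?I (\<lambda>_. \<mu>))" by (intro prob_space_PiM mu)
      then have "emeasure (PiM ?I (\<lambda>_. \<mu>)) (space (PiM ?I (\<lambda>_. \<mu>))) = 1" by (rule prob_space.emeasure_space_1)
      then show ?thesis using m by (subst nn_integral_cmult) (auto simp: nn_integral_add)
    qed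
    also have "\<dots> < \<infinity>" using moment by (simp add: ennreal_mult_less_top)
    finally show ?thesis .
  qed
  interpret env: iid_env \<nu> "TYPE('d)"
    by (rule iid_env.intro[OF nu snu d2 momnu])
  define W where "W \<omega> = (\<lambda>e\<in>lattice_edges. \<psi> (t e \<omega>))" for \<omega>
  have tm: "(\<lambda>\<omega>. \<psi> (t e \<omega>)) \<in> borel_measurable M" if "e \<in> lattice_edges" for e
    by (rule measurable_compose[OF rv[OF that] psim])
  have Wm: "W \<in> measurable M (PiM lattice_edges (\<lambda>_. borel))"
    unfolding W_def[abs_def] by (intro measurable_restrict tm)
  \<comment> \<open>Independence and identical laws say that the shifted weights jointly have the
    law \<open>env.P\<close>; almost sure statements about \<open>env.P\<close> can then be pulled
    back along \<open>W\<close>.\<close>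
  have dW: "distr M (PiM lattice_edges (\<lambda>_. borel)) W = env.P"
  proof -
    have "M.indep_vars (\<lambda>_. borel) (\<lambda>e \<omega>. \<psi> (t e \<omega>)) lattice_edges"
      by (rule M.indep_vars_compose2[OF indep]) (rule psim)
    then have "distr M (PiM lattice_edges (\<lambda>_. borel)) W = PiM lattice_edges (\<lambda>e. distr M borel (\<lambda>\<omega>. \<psi> (t e \<omega>)))"
      unfolding W_def[abs_def] by (subst (asm) M.indep_vars_iff_distr_eq_PiM'[OF ne]) (auto intro: tm)
    also have "\<dots> = env.P"
      unfolding env.P_def
    proof (intro PiM_cong refl)
      fix e :: "(int^'d) set" assume e: "e \<in> lattice_edges"
      have "distr M borel (\<lambda>\<omega>. \<psi> (t e \<omega>)) = distr (distr M borel (t e)) borel \<psi>"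
        by (subst distr_distr[OF psim rv[OF e]]) (simp add: comp_def)
      then show "distr M borel (\<lambda>\<omega>. \<psi> (t e \<omega>)) = \<nu>" by (simp add: ident[OF e] \<nu>_def)
    qed
    finally show ?thesis .
  qed
  have transfer: "AE V in env.P. Q V \<Longrightarrow> AE \<omega> in M. Q (W \<omega>)" for Q
    by (rule AE_distrD[OF Wm, unfolded dW])
  have WP: "W \<in> measurable M env.P" using Wm by (simp add: measurable_cong_sets[OF refl env.sets_P])
  have low: "AE \<omega> in M. \<forall>e\<in>lattice_edges. \<bar>W \<omega> e\<bar> = t e \<omega> - \<rho>"
  proof (subst AE_ball_countable[OF countable_lattice_edges], rule ballI)
    fix e :: "(int^'d) set" assume e: "e \<in> lattice_edges"
    have "AE y in distr M borel (t e). ess_inf \<mu> \<le> ereal y" unfolding ident[OF e] by (rule AE_ess_inf_le[OF smu])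
    from AE_distrD[OF rv[OF e] this] show "AE \<omega> in M. \<bar>W \<omega> e\<bar> = t e \<omega> - \<rho>"
    proof eventually_elim
      case (elim \<omega>)
      have "ereal \<rho> \<le> ereal (t e \<omega>)" unfolding rho using elim by (rule min.coboundedI1)
      then show ?case using e by (simp add: W_def \<psi>_def)
    qed
  qed
  \<comment> \<open>Adding \<open>\<rho>\<close> undoes the shift. As \<open>env.shape\<close> is
    nonnegative on the open ball, \<open>\<rho>\<close>, the minimum of the essential infimum and
    \<open>0\<close>, is a lower bound there.\<close>
  define g where "g \<xi> = env.shape lazy c \<xi> + \<rho>" for \<xi>
  have main: "\<exists>K :: 'a \<Rightarrow> nat. K \<in> measurable M (count_space UNIV) \<and>
              (AE \<omega> in M. \<forall>k x. k \<ge> K \<omega> \<and> real k \<ge> (1 + \<alpha>) * real_of_int (l1_int x)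
                    \<and> x \<in> reach lazy k \<longrightarrow>
                 \<bar>Gpp lazy (\<lambda>e. t e \<omega>) k x - real k * g (\<chi> i. real_of_int (x $ i) / real k)\<bar> \<le> \<epsilon> * real k)"
    if al: "\<alpha> > 0" and eps: "\<epsilon> > 0" for \<alpha> \<epsilon>
  proof -
    define Q where "Q V k \<longleftrightarrow> (\<forall>x::int^'d. admissible lazy k 0 x \<longrightarrow> (1 + \<alpha>) * real_of_int (l1_int x) \<le> real k \<longrightarrow>
     \<bar>enn2real (pcost lazy c V k 0 x) - real k * env.shape lazy c (ratv k x)\<bar> \<le> \<epsilon> * real k)" for V k
    \<comment> \<open>The least time from which on the bound persists; it is measurable because
      countably many conditions describe it. Where no such time exists \<open>LEAST\<close> gives an
      unspecified number, which concerns a null event only.\<close>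
    define K where "K V = (LEAST N. \<forall>k. N \<le> k \<longrightarrow> Q V k)" for V
    have Qm: "Measurable.pred env.P (\<lambda>V. Q V k)" for k unfolding Q_def by measurable
    have Km: "K \<in> measurable env.P (count_space UNIV)"
      unfolding K_def by (intro measurable_Least pred_intros_countable pred_intros_imp' Qm)
    have "AE \<omega> in M. \<forall>\<^sub>F k in sequentially. Q (W \<omega>) k"
      unfolding Q_def by (rule transfer, rule env.shape_limit[OF c al eps])
    then have lim: "AE \<omega> in M. \<forall>k x. k \<ge> K (W \<omega>) \<and> real k \<ge> (1 + \<alpha>) * real_of_int (l1_int x) \<and> x \<in> reach lazy k \<longrightarrow>
                 \<bar>Gpp lazy (\<lambda>e. t e \<omega>) k x - real k * g (\<chi> i. real_of_int (x $ i) / real k)\<bar> \<le> \<epsilon> * real k"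
      using low
    proof eventually_elim
      case (elim \<omega>)
      from elim(1) have "\<exists>N. \<forall>k. N \<le> k \<longrightarrow> Q (W \<omega>) k" by (simp add: eventually_sequentially)
      then have K: "\<forall>k. K (W \<omega>) \<le> k \<longrightarrow> Q (W \<omega>) k" unfolding K_def by (rule LeastI_ex)
      show ?case
      proof (intro allI impI, elim conjE)
        fix k and x :: "int^'d"
        assume k: "K (W \<omega>) \<le> k" and kx: "(1 + \<alpha>) * real_of_int (l1_int x) \<le> real k" and x: "x \<in> reach lazy k"
        have Wt: "\<bar>W \<omega> e\<bar> = t e \<omega> - \<rho>" if "e \<in> lattice_edges" for e using elim(2) that by blast
        \<comment> \<open>\<open>Q\<close> speaks of admissible endpoints; a reachable endpoint has
          finite cost and is therefore admissible.\<close>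
        have fin: "pcost lazy c (W \<omega>) k 0 x < \<infinity>"
          unfolding c_def by (rule Gpp_eq_pcost(1)[where w="\<lambda>e. t e \<omega>", OF Wt rho0 x])
        have G: "Gpp lazy (\<lambda>e. t e \<omega>) k x = enn2real (pcost lazy c (W \<omega>) k 0 x) + real k * \<rho>"
          unfolding c_def by (rule Gpp_eq_pcost(2)[where w="\<lambda>e. t e \<omega>", OF Wt rho0 x])
        have QW: "Q (W \<omega>) k" using K k by blast
        have "\<bar>enn2real (pcost lazy c (W \<omega>) k 0 x) - real k * env.shape lazy c (ratv k x)\<bar> \<le> \<epsilon> * real k"
          by (rule QW[unfolded Q_def, rule_format, OF pcost_finite_admissible[OF fin] kx])
        moreover have "Gpp lazy (\<lambda>e. t e \<omega>) k x - real k * g (ratv k x) = enn2real (pcost lazy c (W \<omega>) k 0 x) - real k * env.shape lazy c (ratv k x)"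
          unfolding G g_def by (simp add: algebra_simps)
        ultimately show "\<bar>Gpp lazy (\<lambda>e. t e \<omega>) k x - real k * g (\<chi> i. real_of_int (x $ i) / real k)\<bar> \<le> \<epsilon> * real k"
          unfolding ratv_def by simp
      qed
    qed
    show ?thesis
      by (rule exI[of _ "\<lambda>\<omega>. K (W \<omega>)"], intro conjI measurable_compose[OF WP Km] lim)
  qed
  show ?thesis
  proof (intro exI[of _ g] conjI)
    show "continuous_on intU g" unfolding g_def by (intro continuous_intros env.continuous_shape[OF c])
    show "convex_on intU g"
      unfolding g_def using env.convex_shape[OF c, of lazy]
      by (intro convex_on_add) (auto simp: convex_on_const convex_intU)
    show "\<forall>\<xi>\<in>intU. min (ess_inf \<mu>) 0 \<le> ereal (g \<xi>)"
      unfolding rho[symmetric] g_def using env.shape_nonneg[OF c, of _ lazy] by simp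
  qed (use main in blast)
qed

end
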